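(* Assume $\mathsf{TC}^0\subsetneq\mathsf{NC}^1$. Then a modern Hopfield model with $n$ steps of chain of thought, embedding size $\log n$ and constant precision can solve the word problem $\mathcal{L}_{S_5}$. However, a modern Hopfield model with constant depth, polynomial embedding size $\mathrm{poly}(n)$ and $\log n$ precision, but without chain of thought, cannot solve it.
   Context: Word problem: for a group $G$ and $n$ elements $f_1,\dots,f_n$ of $G$, $\mathcal{L}_G$ is the problem of determining whether $f_1\circ f_2\circ\cdots\circ f_n$ equals the identity of $G$. $S_5$ is the permutation group over 5 elements. Circuit classes. $\mathsf{TC}^0$: languages computed by circuit families of polynomial size and constant depth with unbounded fan-in $\mathsf{AND}$, $\mathsf{OR}$, $\mathsf{NOT}$ and $\mathsf{MAJORITY}$ gates. $\mathsf{NC}^1$: languages computed by circuit families of polynomial size and depth $O(\log n)$ with bounded fan-in $\mathsf{AND}$, $\mathsf{OR}$ and $\mathsf{NOT}$ gates. Precision. Precision $p$ means computing with $p$-bit floating-point numbers: pairs $\langle s,e\rangle$ of integers with $s\in(-2^p,-2^{p-1}]\cup\{0\}\cup[2^{p-1},2^p)$ and $e\in[-2^p,2^p)$, of value $s\cdot2^e$, with results rounded to this set. Modern Hopfield model. Let $\mathcal V$ be the vocabulary, $n_{\max}$ the maximum input length and $d$ the embedding size. The model is GPT-like, with a token embedding $\theta_{\mathsf{TE}}:\mathcal V\to\mathbb R^d$, a position encoding $\theta_{\mathsf{PE}}:\{1,\dots,n_{\max}\}\to\mathbb R^d$, an output layer $h\mapsto\mathrm{softmax}(\theta_{\mathsf{OUTPUT}}h)$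 with $\theta_{\mathsf{OUTPUT}}\in\mathbb R^{|\mathcal V|\times d}$, and $L$ identically structured decoder layers ($L$ is the depth). Each decoder layer consists of a single Hopfield layer and a two-layer ReLU feed-forward network, with trainable parameters; together they form an $L$-layer modern Hopfield network $\mathsf{MHN}$. The Hopfield layer maps state patterns $R\in\mathbb R^{n\times d}$ and stored patterns $Y\in\mathbb R^{n\times d}$ to $Z=\mathrm{softmax}(\beta\cdot RW_QW_K^\top Y^\top)Y\tilde W_V$ (row-wise softmax), where $W_Q,W_K\in\mathbb R^{d\times d}$, $\beta>0$, and $\tilde W_V\in\mathbb R^{d\times d}$ is $W_KW_V$ or a stand-alone parameter matrix. The feed-forward network maps each row $x$ (as a column vector) to $W_2\,\mathsf{ReLU}(W_1x+b_1)+b_2$ with $W_1,W_2\in\mathbb R^{d\times d}$, $b_1,b_2\in\mathbb R^d$. $\theta$ denotes all parameters. On input $(x_1,\dots,x_n)\in\mathcal V^n$, $n\le n_{\max}$: $h_i^{(0)}=\theta_{\mathsf{TE}}(x_i)+\theta_{\mathsf{PE}}(i)$; $(h_1^{(1)},\dots,h_n^{(1)})=\mathsf{MHN}(h_1^{(0)},\dots,h_n^{(0)})$; $p_\theta(\cdot\mid x_1,\dots,x_i)=\mathrm{softmax}(\theta_{\mathsf{OUTPUT}}h_i^{(1)})$; and $\mathsf{MHM}_\theta(x_1,\dots,x_n)=\arg\max_{y\in\mathcal V}p_\theta(y\mid x_1,\dots,x_n)$. Chain of thought. $\mathsf{MHM}^1_\theta=\mathsf{MHM}_\theta$ and, recursively,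 $\mathsf{MHM}^i_\theta(x_1,\dots,x_n)=\mathsf{MHM}^{i-1}_\theta(x_1,\dots,x_n,\mathsf{MHM}_\theta(x_1,\dots,x_n))$, provided $i+n\le n_{\max}-1$; so $\mathsf{MHM}^i_\theta$ is the $i$-th token generated autoregressively. A model with $n$ steps of chain of thought outputs $\mathsf{MHM}^n_\theta$; one without chain of thought outputs $\mathsf{MHM}_\theta$. *)

theory Defs
  imports
    Complex_Main
    "HOL-Library.Landau_Symbols"
    "HOL-Algebra.Sym_Groups"
    "Jordan_Normal_Form.Matrix"
begin

section \<open>Circuit classes\<close>

text \<open>
  A circuit is a list of gates in topological order: a gate refers to earlier gates by their list
  position, and the last gate is the output.  An input gate names an input bit.  Argument lists may
  contain repetitions (multiple wires between two gates); every wire counts towards the size.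
\<close>

datatype gate =
    InputG nat
  | NotG nat
  | AndG "nat list"
  | OrG "nat list"
  | MajG "nat list"

type_synonym circuit = "gate list"

fun gate_args :: "gate \<Rightarrow> nat list" where
  "gate_args (InputG k) = []"
| "gate_args (NotG j) = [j]"
| "gate_args (AndG js) = js"
| "gate_args (OrG js) = js"
| "gate_args (MajG js) = js"

fun is_MajG :: "gate \<Rightarrow> bool" where
  "is_MajG (MajG js) = True"
| "is_MajG _ = False"

definition wf_circuit :: "nat \<Rightarrow> circuit \<Rightarrow> bool" where
  "wf_circuit n C \<longleftrightarrow> C \<noteq> [] \<and>
     (\<forall>i<length C. \<forall>j\<in>set (gate_args (C ! i)). j < i) \<and>
     (\<forall>k. InputG k \<in> set C \<longrightarrow> k < n)"

text \<open>
  A majority gate outputs true iff more than half of its arguments are true.  The list \<open>vs\<close>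
  contains the values of the gates evaluated so far.
\<close>

fun gate_val :: "bool list \<Rightarrow> bool list \<Rightarrow> gate \<Rightarrow> bool" where
  "gate_val x vs (InputG k) = x ! k"
| "gate_val x vs (NotG j) = (\<not> vs ! j)"
| "gate_val x vs (AndG js) = (\<forall>j\<in>set js. vs ! j)"
| "gate_val x vs (OrG js) = (\<exists>j\<in>set js. vs ! j)"
| "gate_val x vs (MajG js) = (length js < 2 * length (filter (\<lambda>j. vs ! j) js))"

definition circuit_eval :: "circuit \<Rightarrow> bool list \<Rightarrow> bool" where
  "circuit_eval C x = last (foldl (\<lambda>vs g. vs @ [gate_val x vs g]) [] C)"

fun gate_depth :: "nat list \<Rightarrow> gate \<Rightarrow> nat" where
  "gate_depth ds (InputG k) = 0"
| "gate_depth ds g = Suc (Max (insert 0 ((\<lambda>j. ds ! j) ` set (gate_args g))))"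

definition circuit_depth :: "circuit \<Rightarrow> nat" where
  "circuit_depth C = Max (insert 0 (set (foldl (\<lambda>ds g. ds @ [gate_depth ds g]) [] C)))"

definition circuit_size :: "circuit \<Rightarrow> nat" where
  "circuit_size C = length C + (\<Sum>g\<leftarrow>C. length (gate_args g))"

definition polynomial_size :: "(nat \<Rightarrow> circuit) \<Rightarrow> bool" where
  "polynomial_size C \<longleftrightarrow> (\<exists>k. (\<lambda>n. real (circuit_size (C n))) \<in> O(\<lambda>n. real n ^ k))"

text \<open>
  Circuit families are non-uniform: one circuit for each input length.
\<close>

definition computed_by :: "(nat \<Rightarrow> circuit) \<Rightarrow> bool list set \<Rightarrow> bool" where
  "computed_by C A \<longleftrightarrow>
     (\<forall>n. wf_circuit n (C n)) \<and> (\<forall>x. x \<in> A \<longleftrightarrow> circuit_eval (C (length x)) x)"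

definition TC0 :: "bool list set set" where
  "TC0 = {A. \<exists>C. computed_by C A \<and> polynomial_size C \<and> (\<exists>D. \<forall>n. circuit_depth (C n) \<le> D)}"

definition NC1 :: "bool list set set" where
  "NC1 = {A. \<exists>C. computed_by C A \<and> polynomial_size C \<and>
     (\<lambda>n. real (circuit_depth (C n))) \<in> O(\<lambda>n. ln (real n)) \<and>
     (\<forall>n. \<forall>g\<in>set (C n). \<not> is_MajG g) \<and>
     (\<exists>b. \<forall>n. \<forall>g\<in>set (C n). length (gate_args g) \<le> b)}"


section \<open>The word problem\<close>

definition word_problem :: "('a, 'b) monoid_scheme \<Rightarrow> 'a list set" where
  "word_problem G = {fs. set fs \<subseteq> carrier G \<and> foldr (mult G) fs (one G) = one G}"


section \<open>Floating-point arithmetic\<close>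

definition fp :: "nat \<Rightarrow> real set" where
  "fp p = {real_of_int s * 2 powi e | s e :: int.
     s \<in> {- (2 ^ p) <.. - (2 ^ (p - 1))} \<union> {0} \<union> {2 ^ (p - 1) ..< 2 ^ p} \<and>
     e \<in> {- (2 ^ p) ..< 2 ^ p}}"

text \<open>
  Rounding to nearest.  The rule for breaking ties is left open; values beyond the largest float
  are rounded to it (saturation).
\<close>

definition rounding :: "nat \<Rightarrow> (real \<Rightarrow> real) \<Rightarrow> bool" where
  "rounding p r \<longleftrightarrow> (\<forall>x. r x \<in> fp p \<and> (\<forall>y\<in>fp p. \<bar>x - r x\<bar> \<le> \<bar>x - y\<bar>))"

text \<open>
  In the following operations \<open>r\<close> is the rounding function.  The result of each arithmetic
  operation is rounded.  A sum of several terms counts as one operation: the rounded terms are added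
  exactly and the total is rounded once.
\<close>

definition fp_dot :: "(real \<Rightarrow> real) \<Rightarrow> real vec \<Rightarrow> real vec \<Rightarrow> real" where
  "fp_dot r u v = r (\<Sum>k<dim_vec v. r (u $ k * v $ k))"

definition fp_mat_mult :: "(real \<Rightarrow> real) \<Rightarrow> real mat \<Rightarrow> real mat \<Rightarrow> real mat" where
  "fp_mat_mult r A B = mat (dim_row A) (dim_col B) (\<lambda>(i, j). fp_dot r (row A i) (col B j))"

definition fp_mat_vec :: "(real \<Rightarrow> real) \<Rightarrow> real mat \<Rightarrow> real vec \<Rightarrow> real vec" where
  "fp_mat_vec r A v = vec (dim_row A) (\<lambda>i. fp_dot r (row A i) v)"

definition fp_vec_add :: "(real \<Rightarrow> real) \<Rightarrow> real vec \<Rightarrow> real vec \<Rightarrow> real vec" where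
  "fp_vec_add r u v = map_vec r (u + v)"

definition fp_softmax :: "(real \<Rightarrow> real) \<Rightarrow> real vec \<Rightarrow> real vec" where
  "fp_softmax r v = vec (dim_vec v)
     (\<lambda>i. r (r (exp (v $ i)) / r (\<Sum>j<dim_vec v. r (exp (v $ j)))))"

definition map_rows :: "nat \<Rightarrow> (real vec \<Rightarrow> real vec) \<Rightarrow> real mat \<Rightarrow> real mat" where
  "map_rows c f A = mat_of_rows c (map f (rows A))"


section \<open>Modern Hopfield models\<close>

text \<open>
  The matrix \<open>tilde W_V\<close> of a Hopfield layer is either a parameter of its own or the product
  \<open>W_K W_V\<close> for a parameter \<open>W_V\<close>.
\<close>

datatype value_param = StandAlone "real mat" | Factored "real mat"

record decoder_layer =
  WQ :: "real mat"
  WK :: "real mat"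
  WV :: value_param
  beta :: real
  W1 :: "real mat"
  b1 :: "real vec"
  W2 :: "real mat"
  b2 :: "real vec"

text \<open>
  The vocabulary consists of the tokens \<open>0, \<dots>, vocab - 1\<close>; positions are counted from 1.
\<close>

record mhm_model =
  vocab :: nat
  max_len :: nat
  embed_dim :: nat
  token_enc :: "nat \<Rightarrow> real vec"
  pos_enc :: "nat \<Rightarrow> real vec"
  layers :: "decoder_layer list"
  output_mat :: "real mat"

definition fp_carrier_vec :: "nat \<Rightarrow> nat \<Rightarrow> real vec set" where
  "fp_carrier_vec p d = {v \<in> carrier_vec d. \<forall>i<d. v $ i \<in> fp p}"

definition fp_carrier_mat :: "nat \<Rightarrow> nat \<Rightarrow> nat \<Rightarrow> real mat set" where
  "fp_carrier_mat p m d = {A \<in> carrier_mat m d. \<forall>i<m. \<forall>j<d. A $$ (i, j) \<in> fp p}"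

fun value_param_mat :: "value_param \<Rightarrow> real mat" where
  "value_param_mat (StandAlone W) = W"
| "value_param_mat (Factored W) = W"

definition wf_layer :: "nat \<Rightarrow> nat \<Rightarrow> decoder_layer \<Rightarrow> bool" where
  "wf_layer p d l \<longleftrightarrow>
     WQ l \<in> fp_carrier_mat p d d \<and> WK l \<in> fp_carrier_mat p d d \<and>
     value_param_mat (WV l) \<in> fp_carrier_mat p d d \<and>
     beta l \<in> fp p \<and> 0 < beta l \<and>
     W1 l \<in> fp_carrier_mat p d d \<and> b1 l \<in> fp_carrier_vec p d \<and>
     W2 l \<in> fp_carrier_mat p d d \<and> b2 l \<in> fp_carrier_vec p d"

definition wf_mhm :: "nat \<Rightarrow> mhm_model \<Rightarrow> bool" where
  "wf_mhm p M \<longleftrightarrow>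
     0 < vocab M \<and>
     (\<forall>x<vocab M. token_enc M x \<in> fp_carrier_vec p (embed_dim M)) \<and>
     (\<forall>i\<in>{1..max_len M}. pos_enc M i \<in> fp_carrier_vec p (embed_dim M)) \<and>
     (\<forall>l\<in>set (layers M). wf_layer p (embed_dim M) l) \<and>
     output_mat M \<in> fp_carrier_mat p (vocab M) (embed_dim M)"

fun tilde_WV :: "(real \<Rightarrow> real) \<Rightarrow> real mat \<Rightarrow> value_param \<Rightarrow> real mat" where
  "tilde_WV r K (StandAlone W) = W"
| "tilde_WV r K (Factored W) = fp_mat_mult r K W"

text \<open>
  The product of state and stored patterns is evaluated as \<open>(R W_Q) (Y W_K)^T\<close>.
\<close>

definition hopfield :: "(real \<Rightarrow> real) \<Rightarrow> decoder_layer \<Rightarrow> real mat \<Rightarrow> real mat \<Rightarrow> real mat" where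
  "hopfield r l R Y =
     (let S = fp_mat_mult r (fp_mat_mult r R (WQ l)) (transpose_mat (fp_mat_mult r Y (WK l)));
          P = map_rows (dim_row Y) (fp_softmax r) (map_mat (\<lambda>s. r (beta l * s)) S)
      in fp_mat_mult r P (fp_mat_mult r Y (tilde_WV r (WK l) (WV l))))"

definition ffn :: "(real \<Rightarrow> real) \<Rightarrow> decoder_layer \<Rightarrow> real vec \<Rightarrow> real vec" where
  "ffn r l x =
     (let h = map_vec (max 0) (fp_vec_add r (fp_mat_vec r (W1 l) x) (b1 l))
      in fp_vec_add r (fp_mat_vec r (W2 l) h) (b2 l))"

text \<open>
  In a decoder layer the hidden states are both the state and the stored patterns.
\<close>

definition decoder :: "(real \<Rightarrow> real) \<Rightarrow> decoder_layer \<Rightarrow> real mat \<Rightarrow> real mat" where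
  "decoder r l H = map_rows (dim_col H) (ffn r l) (hopfield r l H H)"

definition mhn :: "(real \<Rightarrow> real) \<Rightarrow> decoder_layer list \<Rightarrow> real mat \<Rightarrow> real mat" where
  "mhn r ls H = fold (decoder r) ls H"

definition embed :: "(real \<Rightarrow> real) \<Rightarrow> mhm_model \<Rightarrow> nat list \<Rightarrow> real mat" where
  "embed r M xs = mat_of_rows (embed_dim M)
     (map (\<lambda>i. fp_vec_add r (token_enc M (xs ! i)) (pos_enc M (Suc i))) [0..<length xs])"

definition next_token_dist :: "(real \<Rightarrow> real) \<Rightarrow> mhm_model \<Rightarrow> nat list \<Rightarrow> real vec" where
  "next_token_dist r M xs = fp_softmax r
     (fp_mat_vec r (output_mat M) (row (mhn r (layers M) (embed r M xs)) (length xs - 1)))"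

text \<open>
  If several tokens have maximal probability, the smallest one is chosen.
\<close>

definition mhm :: "(real \<Rightarrow> real) \<Rightarrow> mhm_model \<Rightarrow> nat list \<Rightarrow> nat" where
  "mhm r M xs = (LEAST y. y < vocab M \<and>
     (\<forall>z<vocab M. next_token_dist r M xs $ z \<le> next_token_dist r M xs $ y))"

fun mhm_cot :: "(real \<Rightarrow> real) \<Rightarrow> mhm_model \<Rightarrow> nat \<Rightarrow> nat list \<Rightarrow> nat" where
  "mhm_cot r M (Suc 0) xs = mhm r M xs"
| "mhm_cot r M (Suc (Suc i)) xs = mhm_cot r M (Suc i) (xs @ [mhm r M xs])"

text \<open>
  Whether the \<open>i\<close>-th generated token is defined for inputs of length \<open>n\<close>.  The condition
  \<open>i + n \<le> max_len - 1\<close> of the recursion is invariant under the recursive call.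
\<close>

definition cot_defined :: "mhm_model \<Rightarrow> nat \<Rightarrow> nat \<Rightarrow> bool" where
  "cot_defined M i n \<longleftrightarrow> 1 \<le> i \<and> n \<le> max_len M \<and> (2 \<le> i \<longrightarrow> i + n < max_len M)"

text \<open>
  A family of models has one model \<open>M n\<close> for each input length \<open>n \<ge> 1\<close>, over a vocabulary of
  constant size \<open>V\<close> and with depth bounded by a constant \<open>L\<close>; \<open>p\<close> and \<open>d\<close> are its precision and
  its embedding size.
\<close>

definition mhm_family ::
    "nat \<Rightarrow> nat \<Rightarrow> (nat \<Rightarrow> nat) \<Rightarrow> (nat \<Rightarrow> nat) \<Rightarrow> (nat \<Rightarrow> mhm_model) \<Rightarrow> bool" where
  "mhm_family V L p d M \<longleftrightarrow>
     (\<forall>n\<ge>1. wf_mhm (p n) (M n) \<and> vocab (M n) = V \<and> embed_dim (M n) = d n \<and>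
            length (layers (M n)) \<le> L)"

text \<open>
  The family solves the word problem of \<open>G\<close> with \<open>T n\<close> generated tokens: group elements are
  presented as tokens, and the last generated token is the answer.
\<close>

definition solves_word_problem ::
    "('a, 'b) monoid_scheme \<Rightarrow> nat \<Rightarrow> (nat \<Rightarrow> real \<Rightarrow> real) \<Rightarrow> (nat \<Rightarrow> nat) \<Rightarrow>
     (nat \<Rightarrow> mhm_model) \<Rightarrow> (nat \<Rightarrow> nat) \<Rightarrow> bool" where
  "solves_word_problem G V rnd p M T \<longleftrightarrow>
     (\<exists>enc yes no.
        inj_on enc (carrier G) \<and> enc ` carrier G \<subseteq> {..<V} \<and>
        yes < V \<and> no < V \<and> yes \<noteq> no \<and>
        (\<forall>n\<ge>1. cot_defined (M n) (T n) n \<and>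
          (\<forall>fs. length fs = n \<and> set fs \<subseteq> carrier G \<longrightarrow>
             mhm_cot (rnd (p n)) (M n) (T n) (map enc fs) =
               (if fs \<in> word_problem G then yes else no))))"

end

theory Submission
  imports Defs
begin

text \<open>
  Without chain of thought: by Barrington's theorem, which uses only that \<open>A\<^sub>5\<close> is perfect, a
  language in \<open>NC1\<close> reduces to the word problem of \<open>S\<^sub>5\<close> by words of polynomial length, each letter
  of which depends on a single input bit.  At logarithmic precision there are polynomially many
  floats.  So constant-depth threshold circuits can hold every number of the computation of a model
  in unary, and they evaluate operations with at most two arguments by table lookup.  As rounding is
  monotone, a rounded sum only needs comparisons of sums of integers with polynomially many bits.
  Hence a family of models for the word problem would give \<open>NC1 \<subseteq> TC0\<close>.

  With chain of thought: the \<open>i\<close>-th generated token is the \<open>i\<close>-th partial product of the word.  One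
  layer suffices to multiply the current product by the next letter, which is found by comparing
  positions coded in binary.  This makes the embedding size logarithmic, and the attention is hard
  because at precision 8 the exponentials of all nonzero scores underflow.
\<close>


section \<open>Composing circuits\<close>

text \<open>The obstacle at logarithmic precision is the exponent range: exponents have polynomial
  size, so the summands of a dot product are integers with polynomially many bits, and adding them
  produces long carries. Therefore only the sign of a sum is computed, after the threshold has
  become one more summand. In Horner's scheme, run from the top column, the sign is settled once the
  partial value leaves an interval of polynomial size.

  The word that replaces an input of \<open>n\<close> bits has length \<open>w = n ^ e\<close>, so
  the model in use is the one for length \<open>w\<close>. Its precision and embedding size are
  bounded in terms of \<open>w\<close>, which is still polynomial in \<open>n\<close>.

  The penalty 256 of the chain-of-thought model is the exponent bound \<open>2 ^ 8\<close> of the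
  format, so that a single differing bit already makes an exponential underflow. From step 2 on,
  attention averages two positions and halves the letter, the state and the flag. As all biases are
  zero, this factor passes unchanged through the ReLU layer, and the output matrix uses 512 to make
  up for it.\<close>

definition gate_vals :: "bool list \<Rightarrow> circuit \<Rightarrow> bool list" where
  "gate_vals x C = foldl (\<lambda>vs g. vs @ [gate_val x vs g]) [] C"

definition gate_depths :: "circuit \<Rightarrow> nat list" where
  "gate_depths C = foldl (\<lambda>ds g. ds @ [gate_depth ds g]) [] C"

lemma gate_vals_simps [simp]:
  "gate_vals x [] = []"
  "gate_vals x (C @ [g]) = gate_vals x C @ [gate_val x (gate_vals x C) g]"
  by (simp_all add: gate_vals_def)

lemma gate_depths_simps [simp]:
  "gate_depths [] = []"
  "gate_depths (C @ [g]) = gate_depths C @ [gate_depth (gate_depths C) g]"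
  by (simp_all add: gate_depths_def)

lemma length_gate_vals [simp]: "length (gate_vals x C) = length C"
  by (induction C rule: rev_induct) auto

lemma length_gate_depths [simp]: "length (gate_depths C) = length C"
  by (induction C rule: rev_induct) auto

lemma gate_vals_append:
  assumes "i < length C"
  shows "gate_vals x (C @ D) ! i = gate_vals x C ! i"
proof (induction D rule: rev_induct)
  case (snoc g D)
  have "gate_vals x (C @ D @ [g]) = gate_vals x (C @ D) @ [gate_val x (gate_vals x (C @ D)) g]"
    using gate_vals_simps(2)[of x "C @ D" g] by simp
  then show ?case using snoc assms by (simp add: nth_append)
qed simp

lemma gate_depths_append:
  assumes "i < length C"
  shows "gate_depths (C @ D) ! i = gate_depths C ! i"
proof (induction D rule: rev_induct)
  case (snoc g D)
  have "gate_depths (C @ D @ [g]) = gate_depths (C @ D) @ [gate_depth (gate_depths (C @ D)) g]"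
    using gate_depths_simps(2)[of "C @ D" g] by simp
  then show ?case using snoc assms by (simp add: nth_append)
qed simp

definition topological :: "nat \<Rightarrow> circuit \<Rightarrow> bool" where
  "topological n C \<longleftrightarrow> (\<forall>i<length C. \<forall>j\<in>set (gate_args (C ! i)). j < i) \<and>
     (\<forall>k. InputG k \<in> set C \<longrightarrow> k < n)"

lemma topological_Nil [simp]: "topological n []"
  by (simp add: topological_def)

lemma topological_snoc:
  "topological n (C @ [g]) \<longleftrightarrow>
     topological n C \<and> (\<forall>j\<in>set (gate_args g). j < length C) \<and> (\<forall>k. g = InputG k \<longrightarrow> k < n)"
  unfolding topological_def by (auto simp: nth_append less_Suc_eq)

lemma circuit_size_append [simp]: "circuit_size (C @ D) = circuit_size C + circuit_size D"
  by (simp add: circuit_size_def)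

text \<open>
  The quantification over an arbitrary prefix \<open>C\<close> makes the notion composable without any
  renumbering of gates.
\<close>

definition computes :: "nat \<Rightarrow> nat \<Rightarrow> nat \<Rightarrow> (bool list \<Rightarrow> bool) \<Rightarrow> bool" where
  "computes n d s f \<longleftrightarrow> (\<forall>C. topological n C \<longrightarrow>
     (\<exists>D i. topological n (C @ D) \<and> circuit_size D \<le> s \<and>
        (\<forall>j\<in>{length C..<length (C @ D)}. gate_depths (C @ D) ! j \<le> d) \<and>
        length C \<le> i \<and> i < length (C @ D) \<and>
        (\<forall>x. length x = n \<longrightarrow> gate_vals x (C @ D) ! i = f x)))"

lemma computes_mono:
  assumes "computes n d s f" "d \<le> d'" "s \<le> s'"
  shows "computes n d' s' f"
  unfolding computes_def
proof (intro allI impI)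
  fix C assume "topological n C"
  then obtain D i where *: "topological n (C @ D)" "circuit_size D \<le> s"
    "\<forall>j\<in>{length C..<length (C @ D)}. gate_depths (C @ D) ! j \<le> d"
    "length C \<le> i" "i < length (C @ D)"
    "\<forall>x. length x = n \<longrightarrow> gate_vals x (C @ D) ! i = f x"
    using assms(1) unfolding computes_def by blast
  have "\<forall>j\<in>{length C..<length (C @ D)}. gate_depths (C @ D) ! j \<le> d'"
    using *(3) assms(2) order_trans by blast
  then show "\<exists>D i. topological n (C @ D) \<and> circuit_size D \<le> s' \<and>
        (\<forall>j\<in>{length C..<length (C @ D)}. gate_depths (C @ D) ! j \<le> d') \<and>
        length C \<le> i \<and> i < length (C @ D) \<and>
        (\<forall>x. length x = n \<longrightarrow> gate_vals x (C @ D) ! i = f x)"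
    using * assms(3) by (meson order_trans)
qed

lemma computes_input:
  assumes "k < n"
  shows "computes n 0 1 (\<lambda>x. x ! k)"
  unfolding computes_def
proof (intro allI impI)
  fix C assume C: "topological n C"
  show "\<exists>D i. topological n (C @ D) \<and> circuit_size D \<le> 1 \<and>
        (\<forall>j\<in>{length C..<length (C @ D)}. gate_depths (C @ D) ! j \<le> 0) \<and>
        length C \<le> i \<and> i < length (C @ D) \<and>
        (\<forall>x. length x = n \<longrightarrow> gate_vals x (C @ D) ! i = x ! k)"
    using C assms
    by (intro exI[of _ "[InputG k]"] exI[of _ "length C"])
       (auto simp: topological_snoc circuit_size_def nth_append)
qed

text \<open>The blocks are placed one after the other. Their depths do not add up, since the bound
  \<open>d\<close> for a new block holds behind every prefix.\<close>

lemma computes_list: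
  assumes "\<forall>f\<in>set fs. computes n d s f" "topological n C"
  shows "\<exists>D is. topological n (C @ D) \<and> circuit_size D \<le> length fs * s \<and>
        (\<forall>j\<in>{length C..<length (C @ D)}. gate_depths (C @ D) ! j \<le> d) \<and>
        length is = length fs \<and> (\<forall>i\<in>set is. length C \<le> i \<and> i < length (C @ D)) \<and>
        (\<forall>x. length x = n \<longrightarrow> map ((!) (gate_vals x (C @ D))) is = map (\<lambda>f. f x) fs)"
  using assms(1)
proof (induction fs rule: rev_induct)
  case Nil
  show ?case using assms(2)
    by (intro exI[of _ "[]"]) (simp add: circuit_size_def)
next
  case (snoc f fs)
  then have "\<forall>f\<in>set fs. computes n d s f" by simp
  from snoc.IH[OF this] obtain D "is" where D: "topological n (C @ D)"
    "circuit_size D \<le> length fs * s"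
    "\<forall>j\<in>{length C..<length (C @ D)}. gate_depths (C @ D) ! j \<le> d"
    "length is = length fs" "\<forall>i\<in>set is. length C \<le> i \<and> i < length (C @ D)"
    "\<forall>x. length x = n \<longrightarrow> map ((!) (gate_vals x (C @ D))) is = map (\<lambda>f. f x) fs"
    by blast
  have "computes n d s f" using snoc.prems by simp
  then obtain E i where E: "topological n ((C @ D) @ E)" "circuit_size E \<le> s"
    "\<forall>j\<in>{length (C @ D)..<length ((C @ D) @ E)}. gate_depths ((C @ D) @ E) ! j \<le> d"
    "length (C @ D) \<le> i" "i < length ((C @ D) @ E)"
    "\<forall>x. length x = n \<longrightarrow> gate_vals x ((C @ D) @ E) ! i = f x"
    using D(1) unfolding computes_def by blast
  have depth: "gate_depths (C @ D @ E) ! j \<le> d"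
    if "length C \<le> j" "j < length (C @ D @ E)" for j
  proof (cases "j < length (C @ D)")
    case True
    then show ?thesis using gate_depths_append[of j "C @ D" E] D(3) that by simp
  next
    case False
    then show ?thesis using E(3) that by simp
  qed
  have vals: "map ((!) (gate_vals x (C @ D @ E))) (is @ [i]) = map (\<lambda>f. f x) (fs @ [f])"
    if "length x = n" for x
  proof -
    have "map ((!) (gate_vals x (C @ D @ E))) is = map ((!) (gate_vals x (C @ D))) is"
      using D(5) gate_vals_append[of _ "C @ D" x E] by simp
    then show ?thesis using D(6) E(6) that by simp
  qed
  show ?case
  proof (intro exI conjI)
    show "topological n (C @ (D @ E))" using E(1) by simp
    show "circuit_size (D @ E) \<le> length (fs @ [f]) * s" using D(2) E(2) by simp
    show "length (is @ [i]) = length (fs @ [f])" using D(4) by simp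
    show "\<forall>j\<in>{length C..<length (C @ D @ E)}. gate_depths (C @ D @ E) ! j \<le> d"
      using depth by simp
    show "\<forall>i\<in>set (is @ [i]). length C \<le> i \<and> i < length (C @ D @ E)"
      using D(5) E(4,5) by auto
    show "\<forall>x. length x = n \<longrightarrow>
        map ((!) (gate_vals x (C @ D @ E))) (is @ [i]) = map (\<lambda>f. f x) (fs @ [f])"
      using vals by blast
  qed
qed

lemma computes_gate:
  assumes fs: "\<forall>f\<in>set fs. computes n d s f"
    and args: "\<And>is. length is = length fs \<Longrightarrow> gate_args (g is) = is"
    and val: "\<And>x vs is. length is = length fs \<Longrightarrow> gate_val x vs (g is) = op (map ((!) vs) is)"
    and ninp: "\<And>is k. length is = length fs \<Longrightarrow> g is \<noteq> InputG k"
  shows "computes n (Suc d) (length fs * s + 1 + length fs) (\<lambda>x. op (map (\<lambda>f. f x) fs))"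
  unfolding computes_def
proof (intro allI impI)
  fix C assume C: "topological n C"
  from computes_list[OF fs C] obtain D "is" where D: "topological n (C @ D)"
    "circuit_size D \<le> length fs * s"
    "\<forall>j\<in>{length C..<length (C @ D)}. gate_depths (C @ D) ! j \<le> d"
    "length is = length fs" "\<forall>i\<in>set is. length C \<le> i \<and> i < length (C @ D)"
    "\<forall>x. length x = n \<longrightarrow> map ((!) (gate_vals x (C @ D))) is = map (\<lambda>f. f x) fs"
    by blast
  let ?g = "g is"
  have vals: "gate_vals x (C @ D @ [?g]) = gate_vals x (C @ D) @ [gate_val x (gate_vals x (C @ D)) ?g]" for x
    using gate_vals_simps(2)[of x "C @ D" ?g] by simp
  have depths: "gate_depths (C @ D @ [?g]) = gate_depths (C @ D) @ [gate_depth (gate_depths (C @ D)) ?g]"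
    using gate_depths_simps(2)[of "C @ D" ?g] by simp
  have gd: "gate_depth (gate_depths (C @ D)) ?g \<le> Suc d"
  proof -
    have "gate_depth (gate_depths (C @ D)) ?g =
        Suc (Max (insert 0 ((\<lambda>j. gate_depths (C @ D) ! j) ` set is)))"
      using ninp[OF D(4)] args[OF D(4)] by (cases "?g") auto
    also have "\<dots> \<le> Suc d" using D(3,5) by auto
    finally show ?thesis .
  qed
  show "\<exists>E i. topological n (C @ E) \<and> circuit_size E \<le> length fs * s + 1 + length fs \<and>
        (\<forall>j\<in>{length C..<length (C @ E)}. gate_depths (C @ E) ! j \<le> Suc d) \<and>
        length C \<le> i \<and> i < length (C @ E) \<and>
        (\<forall>x. length x = n \<longrightarrow> gate_vals x (C @ E) ! i = op (map (\<lambda>f. f x) fs))"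
  proof (intro exI[of _ "D @ [?g]"] exI[of _ "length (C @ D)"] conjI)
    show "topological n (C @ D @ [?g])"
      using topological_snoc[of n "C @ D" ?g] D(1,5) args[OF D(4)] ninp[OF D(4)] by auto
    show "circuit_size (D @ [?g]) \<le> length fs * s + 1 + length fs"
      using D(2,4) args[OF D(4)] by (simp add: circuit_size_def)
    show "\<forall>j\<in>{length C..<length (C @ D @ [?g])}. gate_depths (C @ D @ [?g]) ! j \<le> Suc d"
    proof
      fix j assume j: "j \<in> {length C..<length (C @ D @ [?g])}"
      show "gate_depths (C @ D @ [?g]) ! j \<le> Suc d"
      proof (cases "j < length (C @ D)")
        case True
        then have "gate_depths (C @ D @ [?g]) ! j = gate_depths (C @ D) ! j"
          by (simp only: depths) (simp add: nth_append)
        moreover have "gate_depths (C @ D) ! j \<le> d" using D(3) j True by simp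
        ultimately show ?thesis by simp
      next
        case False
        with j have "j = length (C @ D)" by auto
        then have "gate_depths (C @ D @ [?g]) ! j = gate_depth (gate_depths (C @ D)) ?g"
          by (simp only: depths) (simp add: nth_append)
        then show ?thesis using gd by simp
      qed
    qed
    show "\<forall>x. length x = n \<longrightarrow> gate_vals x (C @ D @ [?g]) ! length (C @ D) = op (map (\<lambda>f. f x) fs)"
    proof (intro allI impI)
      fix x :: "bool list" assume "length x = n"
      have "gate_vals x (C @ D @ [?g]) ! length (C @ D) = gate_val x (gate_vals x (C @ D)) ?g"
        by (simp only: vals) (simp add: nth_append)
      then show "gate_vals x (C @ D @ [?g]) ! length (C @ D) = op (map (\<lambda>f. f x) fs)"
        using val[OF D(4)] D(6) \<open>length x = n\<close> by simp
    qed
  qed auto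
qed

lemma computes_cong:
  assumes "computes n d s f" "\<And>x. length x = n \<Longrightarrow> f x = g x"
  shows "computes n d s g"
  using assms(1) unfolding computes_def using assms(2) by simp

lemma computes_imp_circuit:
  assumes "computes n d s f"
  shows "\<exists>C. wf_circuit n C \<and> circuit_depth C \<le> Suc d \<and> circuit_size C \<le> s + 2 \<and>
    (\<forall>x. length x = n \<longrightarrow> circuit_eval C x = f x)"
proof -
  have "topological n []" by simp
  with assms obtain D i where D: "topological n D" "circuit_size D \<le> s"
    "\<forall>j\<in>{0..<length D}. gate_depths D ! j \<le> d" "i < length D"
    "\<forall>x. length x = n \<longrightarrow> gate_vals x D ! i = f x"
    unfolding computes_def by (metis append_Nil list.size(3))
  \<comment> \<open>\<open>circuit_eval\<close> reads the last gate, so a one-argument AND copies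
    gate \<open>i\<close> to the end. It costs one level of depth and 2 in size, for a gate and a
    wire.\<close>
  define C where "C = D @ [AndG [i]]"
  have "wf_circuit n C"
    using D(1,4) topological_snoc[of n D "AndG [i]"]
    unfolding wf_circuit_def C_def topological_def by simp
  moreover have "v \<le> Suc d" if v: "v \<in> set (gate_depths C)" for v
  proof -
    consider "v \<in> set (gate_depths D)" | "v = Suc (gate_depths D ! i)"
      using v by (auto simp: C_def)
    then show ?thesis
      by cases (use D(3,4) in \<open>auto simp: in_set_conv_nth intro: le_SucI\<close>)
  qed
  hence "circuit_depth C \<le> Suc d"
    unfolding circuit_depth_def gate_depths_def[symmetric] by auto
  moreover have "circuit_size C \<le> s + 2"
    using D(2) by (simp add: C_def) (simp add: circuit_size_def)
  moreover have "circuit_eval C x = f x" if "length x = n" for x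
    unfolding circuit_eval_def gate_vals_def[symmetric] C_def using D(5) that by simp
  ultimately show ?thesis by blast
qed


section \<open>Constant-depth threshold circuits\<close>

text \<open>A single number \<open>k\<close> bounds the depth and the exponent of the size. The cost
  of a composed circuit is thus a term in the costs of its parts that contains neither
  \<open>n\<close> nor \<open>N\<close>, and constant factors are absorbed into powers of
  \<open>N \<ge> 2\<close>.\<close>

definition tc :: "nat \<Rightarrow> nat \<Rightarrow> nat \<Rightarrow> (bool list \<Rightarrow> bool) \<Rightarrow> bool" where
  "tc n N k f \<longleftrightarrow> 2 \<le> N \<and> computes n k (N ^ k) f"

lemma tc_base: "tc n N k f \<Longrightarrow> 2 \<le> N"
  by (simp add: tc_def)

lemma tc_mono:
  assumes "tc n N k f" "k \<le> k'"
  shows "tc n N k' f"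
proof -
  have "N ^ k \<le> N ^ k'" using assms by (intro power_increasing) (auto simp: tc_def)
  then show ?thesis using assms by (auto simp: tc_def intro: computes_mono)
qed

lemma tc_cong:
  assumes "tc n N k f" "\<And>x. length x = n \<Longrightarrow> f x = g x"
  shows "tc n N k g"
  using assms computes_cong unfolding tc_def by blast

lemma tc_weaken:
  assumes "tc n N k f" "k \<le> k'" "\<And>x. length x = n \<Longrightarrow> f x = g x"
  shows "tc n N k' g"
  using tc_cong[OF tc_mono[OF assms(1,2)]] assms(3) .

lemma tc_input: "2 \<le> N \<Longrightarrow> i < n \<Longrightarrow> tc n N 0 (\<lambda>x. x ! i)"
  using computes_input by (simp add: tc_def)

text \<open>The left side is the size from \<open>computes_gate\<close>: three terms of at most
  \<open>N ^ (a + k)\<close> each, and \<open>3 \<le> N ^ 2\<close>.\<close>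

lemma power_gate_bound:
  fixes N :: nat
  assumes "2 \<le> N" "m \<le> N ^ a"
  shows "m * N ^ k + 1 + m \<le> N ^ (k + a + 2)"
proof -
  have "1 \<le> N ^ a" "1 \<le> N ^ k" using assms by auto
  have "m * N ^ k \<le> N ^ a * N ^ k" using assms(2) by simp
  moreover have "m \<le> N ^ a * N ^ k" using assms(2) \<open>1 \<le> N ^ k\<close>
    by (metis le_trans mult_le_mono nat_mult_1_right)
  moreover have "1 \<le> N ^ a * N ^ k" using \<open>1 \<le> N ^ a\<close> \<open>1 \<le> N ^ k\<close>
    by (metis mult_le_mono nat_mult_1)
  ultimately have "m * N ^ k + 1 + m \<le> 3 * (N ^ a * N ^ k)" by linarith
  also have "\<dots> \<le> N ^ 2 * (N ^ a * N ^ k)"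
  proof (rule mult_right_mono)
    have "2 * 2 \<le> N * N" using assms(1) by (intro mult_le_mono)
    then show "3 \<le> N ^ 2" by (simp add: power2_eq_square)
  qed simp
  finally show ?thesis by (simp only: power_add mult_ac)
qed

lemma tc_gate:
  assumes "2 \<le> N" and fs: "\<forall>f\<in>set fs. tc n N k f" and len: "length fs \<le> N ^ a"
    and "\<And>is. length is = length fs \<Longrightarrow> gate_args (g is) = is"
    and "\<And>x vs is. length is = length fs \<Longrightarrow> gate_val x vs (g is) = op (map ((!) vs) is)"
    and "\<And>is k. length is = length fs \<Longrightarrow> g is \<noteq> InputG k"
  shows "tc n N (k + a + 2) (\<lambda>x. op (map (\<lambda>f. f x) fs))"
proof -
  have "computes n (Suc k) (length fs * N ^ k + 1 + length fs) (\<lambda>x. op (map (\<lambda>f. f x) fs))"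
    using assms by (intro computes_gate[where g = g]) (auto simp: tc_def)
  then have "computes n (k + a + 2) (N ^ (k + a + 2)) (\<lambda>x. op (map (\<lambda>f. f x) fs))"
    by (rule computes_mono) (use power_gate_bound[OF assms(1) len] in auto)
  then show ?thesis using assms(1) by (simp add: tc_def)
qed

lemma tc_not:
  assumes "tc n N k f"
  shows "tc n N (k + 2) (\<lambda>x. \<not> f x)"
proof -
  have "tc n N (k + 0 + 2) (\<lambda>x. (\<lambda>bs. \<not> hd bs) (map (\<lambda>f. f x) [f]))"
    using assms
    by (intro tc_gate[where g = "\<lambda>is. NotG (hd is)"])
       (auto simp: length_Suc_conv tc_base)
  then show ?thesis by simp
qed

lemma ex_list_of_finite:
  assumes "finite I"
  shows "\<exists>is. set is = I \<and> distinct is \<and> length is = card I"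
  using finite_distinct_list[OF assms] distinct_card by metis

lemma tc_Ball:
  assumes "2 \<le> N" "finite I" "card I \<le> N ^ a" "\<And>i. i \<in> I \<Longrightarrow> tc n N k (f i)"
  shows "tc n N (k + a + 2) (\<lambda>x. \<forall>i\<in>I. f i x)"
proof -
  obtain "is" where "is": "set is = I" "length is = card I"
    using ex_list_of_finite assms(2) by metis
  have "tc n N (k + a + 2) (\<lambda>x. (\<lambda>bs. \<forall>b\<in>set bs. b) (map (\<lambda>f. f x) (map f is)))"
    by (intro tc_gate[where g = AndG]) (use assms "is" in auto)
  then show ?thesis by (simp add: "is")
qed

lemma tc_Bex:
  assumes "2 \<le> N" "finite I" "card I \<le> N ^ a" "\<And>i. i \<in> I \<Longrightarrow> tc n N k (f i)"
  shows "tc n N (k + a + 2) (\<lambda>x. \<exists>i\<in>I. f i x)"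
proof -
  obtain "is" where "is": "set is = I" "length is = card I"
    using ex_list_of_finite assms(2) by metis
  have "tc n N (k + a + 2) (\<lambda>x. (\<lambda>bs. \<exists>b\<in>set bs. b) (map (\<lambda>f. f x) (map f is)))"
    by (intro tc_gate[where g = OrG]) (use assms "is" in auto)
  then show ?thesis by (simp add: "is")
qed

lemma tc_const: "2 \<le> N \<Longrightarrow> tc n N 2 (\<lambda>x. c)"
  using tc_Ball[of N "{} :: nat set" 0 n 0 "\<lambda>_ _. True"]
    tc_Bex[of N "{} :: nat set" 0 n 0 "\<lambda>_ _. True"] by (cases c) (simp_all add: numeral_2_eq_2)

lemma tc_conj:
  assumes "tc n N k f" "tc n N k g"
  shows "tc n N (k + 3) (\<lambda>x. f x \<and> g x)"
proof -
  have "tc n N (k + 1 + 2) (\<lambda>x. \<forall>b\<in>{False, True}. (if b then f else g) x)"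
    using assms tc_base[OF assms(1)] by (intro tc_Ball) auto
  then show ?thesis by (rule tc_weaken) auto
qed

lemma tc_disj:
  assumes "tc n N k f" "tc n N k g"
  shows "tc n N (k + 3) (\<lambda>x. f x \<or> g x)"
proof -
  have "tc n N (k + 1 + 2) (\<lambda>x. \<exists>b\<in>{False, True}. (if b then f else g) x)"
    using assms tc_base[OF assms(1)] by (intro tc_Bex) auto
  then show ?thesis by (rule tc_weaken) auto
qed

lemma power_le_sum:
  fixes N :: nat
  assumes "2 \<le> N"
  shows "N ^ a + N ^ b \<le> N ^ (a + b + 1)"
proof -
  have "1 \<le> N ^ a" "1 \<le> N ^ b" using assms by auto
  then have "N ^ a \<le> N ^ a * N ^ b" "N ^ b \<le> N ^ a * N ^ b"
    by simp_all
  then have "N ^ a + N ^ b \<le> 2 * (N ^ a * N ^ b)" by linarith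
  also have "\<dots> \<le> N * (N ^ a * N ^ b)" using assms by (intro mult_le_mono1)
  finally show ?thesis by (simp add: power_add mult_ac)
qed

section \<open>Counting with majority gates\<close>

lemma tc_count:
  assumes "2 \<le> N" "finite I" "card I \<le> N ^ a" "\<And>i. i \<in> I \<Longrightarrow> tc n N k (f i)"
  shows "tc n N (k + a + 6) (\<lambda>x. t \<le> card {i \<in> I. f i x})"
proof (cases "t = 0 \<or> card I < t")
  case True
  have "card {i \<in> I. f i x} \<le> card I" for x using assms(2) by (intro card_mono) auto
  then have *: "(t \<le> card {i \<in> I. f i x}) = (t = 0)" for x
    using True leD[of "card {i \<in> I. f i x}" "card I"] by (auto simp: not_le dest: le_less_trans)
  show ?thesis unfolding * by (rule tc_mono[OF tc_const]) (use assms in auto)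
next
  case False
  then have t: "0 < t" "t \<le> card I" by auto
  obtain "is" where "is": "set is = I" "distinct is" "length is = card I"
    using ex_list_of_finite assms(2) by metis
  \<comment> \<open>Dummy arguments, \<open>u\<close> true and \<open>l\<close> false ones, move the
    cut-off of a majority gate to \<open>t\<close>: with \<open>card I + l + 1 = 2 * t + u\<close>,
    a count satisfies \<open>card I + u + l < 2 * (count + u)\<close> iff
    \<open>t \<le> count\<close>. Depending on \<open>t\<close>, one of \<open>u\<close> and
    \<open>l\<close> is zero.\<close>
  define u where "u = (if card I + 1 \<le> 2 * t then 0 else card I + 1 - 2 * t)"
  define l where "l = (if card I + 1 \<le> 2 * t then 2 * t - 1 - card I else 0)"
  define fs where "fs = map f is @ replicate u (\<lambda>_. True) @ replicate l (\<lambda>_. False)"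
  have ul: "card I + l + 1 = 2 * t + u" "u \<le> card I" "l \<le> card I"
    using t by (auto simp: u_def l_def)
  have "card I * 3 \<le> N ^ a * N ^ 2"
  proof (rule mult_le_mono[OF assms(3)])
    have "2 * 2 \<le> N * N" using assms(1) by (intro mult_le_mono)
    then show "3 \<le> N ^ 2" by (simp add: power2_eq_square)
  qed
  then have len: "length fs \<le> N ^ (a + 2)"
    using ul unfolding fs_def power_add by (simp add: "is")
  have "tc n N ((k + 2) + (a + 2) + 2)
      (\<lambda>x. (\<lambda>bs. length bs < 2 * length (filter id bs)) (map (\<lambda>f. f x) fs))"
  proof (rule tc_gate[where g = MajG])
    show "\<forall>f\<in>set fs. tc n N (k + 2) f"
      using assms(4) "is"(1) tc_mono[OF tc_const[OF assms(1)], of "k + 2"]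
        tc_mono[of n N k _ "k + 2"] by (auto simp: fs_def simp del: add_2_eq_Suc')
  qed (use assms len in \<open>auto simp: filter_map o_def\<close>)
  moreover have "(length fs < 2 * length (filter id (map (\<lambda>f. f x) fs))) =
      (t \<le> card {i \<in> I. f i x})" for x
  proof -
    have "length (filter id (map (\<lambda>f. f x) (map f is))) = card {i \<in> I. f i x}"
      using "is" distinct_card[OF distinct_filter[OF "is"(2), of "\<lambda>i. f i x"]]
      by (simp add: filter_map o_def)
    then have "length (filter id (map (\<lambda>f. f x) fs)) = card {i \<in> I. f i x} + u"
      by (simp add: fs_def)
    moreover have "length fs = card I + u + l" by (simp add: fs_def "is")
    ultimately show ?thesis using ul by linarith
  qed
  ultimately show ?thesis by (rule_tac tc_weaken) auto
qed

text \<open>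
  A feature is a function of the input bits with polynomially many values for which each test
  \<open>F x = v\<close> has a small circuit; features thus represent numbers in unary.
\<close>

definition feat :: "nat \<Rightarrow> nat \<Rightarrow> nat \<Rightarrow> (bool list \<Rightarrow> 'a) \<Rightarrow> bool" where
  "feat n N k F \<longleftrightarrow> 2 \<le> N \<and> (\<exists>V. finite V \<and> card V \<le> N ^ k \<and> (\<forall>x. length x = n \<longrightarrow> F x \<in> V)) \<and>
     (\<forall>v. tc n N k (\<lambda>x. F x = v))"

lemma feat_base: "feat n N k F \<Longrightarrow> 2 \<le> N"
  by (simp add: feat_def)

lemma feat_mono:
  assumes "feat n N k F" "k \<le> k'"
  shows "feat n N k' F"
proof -
  have "N ^ k \<le> N ^ k'" using assms by (intro power_increasing) (auto simp: feat_def)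
  then show ?thesis using assms tc_mono unfolding feat_def by (meson le_trans)
qed

lemma feat_cong:
  assumes "feat n N k F" "\<And>x. length x = n \<Longrightarrow> F x = G x"
  shows "feat n N k G"
proof -
  have "tc n N k (\<lambda>x. G x = v)" for v
  proof (rule tc_cong)
    show "tc n N k (\<lambda>x. F x = v)" using assms(1) by (simp add: feat_def)
  qed (simp add: assms(2))
  moreover have "\<exists>V. finite V \<and> card V \<le> N ^ k \<and> (\<forall>x. length x = n \<longrightarrow> G x \<in> V)"
    using assms(1) unfolding feat_def by (metis assms(2))
  ultimately show ?thesis using feat_base[OF assms(1)] unfolding feat_def by blast
qed

lemma feat_const:
  assumes "2 \<le> N"
  shows "feat n N 2 (\<lambda>x. c)"
  unfolding feat_def using assms tc_const[OF assms]
  by (auto intro!: exI[of _ "{c}"])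

lemma feat_pred:
  assumes "feat n N k F"
  shows "tc n N (2 * k + 2) (\<lambda>x. P (F x))"
proof -
  obtain V where V: "finite V" "card V \<le> N ^ k" "\<And>x. length x = n \<Longrightarrow> F x \<in> V"
    using assms unfolding feat_def by blast
  have "card {v \<in> V. P v} \<le> card V" using V(1) by (intro card_mono) auto
  then have "tc n N (k + k + 2) (\<lambda>x. \<exists>v\<in>{v \<in> V. P v}. F x = v)"
    using assms V unfolding feat_def by (intro tc_Bex) auto
  then show ?thesis by (rule tc_weaken) (use V(3) in auto)
qed

text \<open>Table lookup by a disjunction over at most \<open>N ^ (2 * k)\<close> pairs of values.
  Nothing is assumed of \<open>h\<close>, so \<open>exp\<close>, division and rounding cost no more
  than addition.\<close>

lemma feat_map2:
  assumes "feat n N k F" "feat n N k G"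
  shows "feat n N (3 * k + 5) (\<lambda>x. h (F x) (G x))"
proof -
  obtain V where V: "finite V" "card V \<le> N ^ k" "\<And>x. length x = n \<Longrightarrow> F x \<in> V"
    using assms(1) unfolding feat_def by blast
  obtain W where W: "finite W" "card W \<le> N ^ k" "\<And>x. length x = n \<Longrightarrow> G x \<in> W"
    using assms(2) unfolding feat_def by blast
  have N: "2 \<le> N" using assms feat_base by blast
  have VW: "card (V \<times> W) \<le> N ^ (2 * k)"
    using mult_le_mono[OF V(2) W(2)] by (simp add: card_cartesian_product power_add mult_2)
  have tcs: "tc n N (3 * k + 5) (\<lambda>x. h (F x) (G x) = v)" for v
  proof -
    have "card {(a, b). (a, b) \<in> V \<times> W \<and> h a b = v} \<le> card (V \<times> W)"
      using V W by (intro card_mono) auto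
    then have "tc n N ((k + 3) + 2 * k + 2)
        (\<lambda>x. \<exists>p\<in>{(a, b). (a, b) \<in> V \<times> W \<and> h a b = v}. F x = fst p \<and> G x = snd p)"
      using assms VW V(1) W(1) N unfolding feat_def
      by (intro tc_Bex tc_conj) (auto intro: finite_subset[of _ "V \<times> W"])
    then show ?thesis
      by (rule tc_weaken) (use V(3) W(3) in auto)
  qed
  have "card ((\<lambda>(a, b). h a b) ` (V \<times> W)) \<le> N ^ (2 * k)"
    using card_image_le[of "V \<times> W" "\<lambda>(a, b). h a b"] V(1) W(1) VW by simp
  also have "\<dots> \<le> N ^ (3 * k + 5)" using N by (intro power_increasing) auto
  finally show ?thesis unfolding feat_def using tcs N V W
    by (auto intro!: exI[of _ "(\<lambda>(a, b). h a b) ` (V \<times> W)"])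
qed

lemma feat_map:
  assumes "feat n N k F"
  shows "feat n N (3 * k + 5) (\<lambda>x. h (F x))"
  using feat_map2[OF assms assms, of "\<lambda>a b. h a"] .

text \<open>With unary summands, a sum is the number of pairs \<open>(i, v)\<close> with
  \<open>1 \<le> v \<le> F i x\<close>, which \<open>tc_count\<close> compares with any
  threshold.\<close>

lemma feat_sum_nat:
  fixes F :: "'i \<Rightarrow> bool list \<Rightarrow> nat"
  assumes N: "2 \<le> N" and I: "finite I" "card I \<le> N ^ a"
    and F: "\<And>i. i \<in> I \<Longrightarrow> feat n N k (F i)"
    and le: "\<And>i x. i \<in> I \<Longrightarrow> length x = n \<Longrightarrow> F i x \<le> N ^ b"
  shows "feat n N (2 * k + a + b + 13) (\<lambda>x. \<Sum>i\<in>I. F i x)"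
proof -
  let ?J = "I \<times> {1..N ^ b}"
  have J: "finite ?J" "card ?J \<le> N ^ (a + b)"
    using I by (auto simp: card_cartesian_product power_add)
  have count: "card {(i, v) \<in> ?J. v \<le> F i x} = (\<Sum>i\<in>I. F i x)" if "length x = n" for x
  proof -
    have "{(i, v) \<in> ?J. v \<le> F i x} = Sigma I (\<lambda>i. {1..F i x})"
      using le[OF _ that] by (fastforce intro: order_trans)
    then show ?thesis using I(1) by (simp add: card_SigmaI)
  qed
  have ge: "tc n N (2 * k + a + b + 8) (\<lambda>x. t \<le> (\<Sum>i\<in>I. F i x))" for t
  proof -
    have *: "tc n N ((2 * k + 2) + (a + b) + 6) (\<lambda>x. t \<le> card {p \<in> ?J. snd p \<le> F (fst p) x})"
    proof (rule tc_count[OF N J])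
      fix p assume "p \<in> ?J"
      then show "tc n N (2 * k + 2) (\<lambda>x. snd p \<le> F (fst p) x)"
        by (intro feat_pred F) auto
    qed
    have "{p \<in> ?J. snd p \<le> F (fst p) x} = {(i, v) \<in> ?J. v \<le> F i x}" for x by auto
    then show ?thesis using count by (intro tc_weaken[OF *]) auto
  qed
  have eq: "tc n N (2 * k + a + b + 13) (\<lambda>x. (\<Sum>i\<in>I. F i x) = t)" for t
  proof -
    have "tc n N ((2 * k + a + b + 10) + 3) (\<lambda>x. t \<le> (\<Sum>i\<in>I. F i x) \<and> \<not> Suc t \<le> (\<Sum>i\<in>I. F i x))"
      by (intro tc_conj tc_mono[OF ge[of t]] tc_weaken[OF tc_not[OF ge[of "Suc t"]]]) auto
    then show ?thesis by (rule tc_weaken) auto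
  qed
  have bound: "(\<Sum>i\<in>I. F i x) \<in> {..N ^ (a + b)}" if "length x = n" for x
  proof -
    have "(\<Sum>i\<in>I. F i x) \<le> card I * N ^ b"
      using sum_bounded_above[of I "\<lambda>i. F i x" "N ^ b"] le[OF _ that] by simp
    also have "\<dots> \<le> N ^ a * N ^ b" using I(2) by simp
    finally show ?thesis by (simp add: power_add)
  qed
  have "card {..N ^ (a + b)} \<le> N ^ (2 * k + a + b + 13)"
  proof -
    have "card {..N ^ (a + b)} \<le> N ^ 0 + N ^ (a + b)" by simp
    also have "\<dots> \<le> N ^ (0 + (a + b) + 1)" by (rule power_le_sum[OF N])
    also have "\<dots> \<le> N ^ (2 * k + a + b + 13)" using N by (intro power_increasing) auto
    finally show ?thesis .
  qed
  then show ?thesis unfolding feat_def using N eq bound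
    by (auto intro!: exI[of _ "{..N ^ (a + b)}"])
qed

lemma feat_sum_int:
  fixes F :: "'i \<Rightarrow> bool list \<Rightarrow> int"
  assumes N: "2 \<le> N" and I: "finite I" "card I \<le> N ^ a"
    and F: "\<And>i. i \<in> I \<Longrightarrow> feat n N k (F i)"
    and le: "\<And>i x. i \<in> I \<Longrightarrow> length x = n \<Longrightarrow> \<bar>F i x\<bar> \<le> int (N ^ b)"
  shows "feat n N (18 * k + 3 * a + 3 * b + 77) (\<lambda>x. \<Sum>i\<in>I. F i x)"
proof -
  \<comment> \<open>The shift by \<open>N ^ b\<close> makes the summands natural numbers. The total
    shift \<open>card I * N ^ b\<close> is a constant and is undone by a table lookup.\<close>
  define G where "G i x = nat (F i x + int (N ^ b))" for i x
  have "feat n N (2 * (3 * k + 5) + a + (b + 1) + 13) (\<lambda>x. \<Sum>i\<in>I. G i x)"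
  proof (rule feat_sum_nat[OF N I])
    show "feat n N (3 * k + 5) (G i)" if "i \<in> I" for i
      unfolding G_def by (rule feat_map[OF F[OF that]])
    show "G i x \<le> N ^ (b + 1)" if "i \<in> I" "length x = n" for i x
    proof -
      have "G i x \<le> nat (int (N ^ b) + int (N ^ b))"
        using le[OF that] unfolding G_def by (intro nat_mono) linarith
      also have "\<dots> = 2 * N ^ b" by linarith
      also have "\<dots> \<le> N * N ^ b" using N by (intro mult_le_mono1)
      finally show ?thesis by simp
    qed
  qed
  from feat_map[OF this, of "\<lambda>s. int s - int (card I) * int (N ^ b)"]
  have "feat n N (3 * (2 * (3 * k + 5) + a + (b + 1) + 13) + 5)
      (\<lambda>x. int (\<Sum>i\<in>I. G i x) - int (card I) * int (N ^ b))" .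
  then show ?thesis
  proof (rule feat_cong[OF feat_mono])
    fix x :: "bool list" assume x: "length x = n"
    have "int (\<Sum>i\<in>I. G i x) = (\<Sum>i\<in>I. F i x + int (N ^ b))"
      unfolding of_nat_sum
    proof (rule sum.cong)
      fix i assume "i \<in> I"
      then have "0 \<le> F i x + int (N ^ b)" using le[OF _ x, of i] by linarith
      then show "int (G i x) = F i x + int (N ^ b)" unfolding G_def by simp
    qed simp
    then show "int (\<Sum>i\<in>I. G i x) - int (card I) * int (N ^ b) = (\<Sum>i\<in>I. F i x)"
      by (simp add: sum.distrib)
  qed simp
qed


section \<open>Sums of exponentially large integers\<close>

lemma sum_binary_digits:
  fixes u :: nat
  shows "(\<Sum>j<M. (u div 2 ^ j mod 2) * 2 ^ j) = u mod 2 ^ M"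
proof (induction M)
  case (Suc M)
  have "u mod 2 ^ Suc M = 2 ^ M * (u div 2 ^ M mod 2) + u mod 2 ^ M"
    using mod_mult2_eq[of u "2 ^ M" 2] by (simp add: mult.commute)
  then show ?case using Suc by (simp add: mult.commute)
qed simp

text \<open>Every digit carries the sign of the whole number, so a column sum over positive and
  negative numbers is bounded by the number of summands.\<close>

definition signed_digit :: "int \<Rightarrow> nat \<Rightarrow> int" where
  "signed_digit v j = sgn v * int (nat \<bar>v\<bar> div 2 ^ j mod 2)"

lemma abs_signed_digit: "\<bar>signed_digit v j\<bar> \<le> 1"
proof -
  have "nat \<bar>v\<bar> div 2 ^ j mod 2 \<le> 1" using mod_less_divisor[of 2 "nat \<bar>v\<bar> div 2 ^ j"] by linarith
  then show ?thesis by (auto simp: signed_digit_def abs_mult sgn_if)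
qed

lemma sum_signed_digit:
  assumes "\<bar>v\<bar> < 2 ^ M"
  shows "(\<Sum>j<M. signed_digit v j * 2 ^ j) = v"
proof -
  have "(\<Sum>j<M. signed_digit v j * 2 ^ j) =
      sgn v * int (\<Sum>j<M. (nat \<bar>v\<bar> div 2 ^ j mod 2) * 2 ^ j)"
    by (simp add: signed_digit_def sum_distrib_left mult.assoc)
  also have "\<dots> = sgn v * int (nat \<bar>v\<bar> mod 2 ^ M)" by (simp only: sum_binary_digits)
  also have "nat \<bar>v\<bar> mod 2 ^ M = nat \<bar>v\<bar>"
    using assms by (intro mod_less) (simp add: nat_less_iff)
  finally show ?thesis by (simp add: sgn_mult_abs)
qed

text \<open>
  The Horner values \<open>h k\<close> of \<open>\<Sum>j. c j * 2 ^ j\<close> stay beyond \<open>\<plusminus>B\<close> once they have left \<open>[-B, B]\<close>,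
  and inside this interval they are determined modulo \<open>2 ^ L\<close>, hence by the next \<open>L\<close> columns.
  The first exit from the interval is thus detected by local conditions.
\<close>

locale columns =
  fixes c :: "nat \<Rightarrow> int" and m L :: nat and B :: int
  assumes bound: "\<And>j. \<bar>c j\<bar> \<le> B" and zero: "\<And>j. m \<le> j \<Longrightarrow> c j = 0"
    and L: "2 * B < 2 ^ L"
begin

definition horner :: "nat \<Rightarrow> int" where
  "horner k = (\<Sum>j\<in>{k..<m}. c j * 2 ^ (j - k))"

definition window :: "nat \<Rightarrow> int" where
  "window k = (\<Sum>i<L. c (k + i) * 2 ^ i)"

text \<open>If \<open>horner (Suc k)\<close> lies in \<open>[-B, B]\<close>, it is the
  representative of the window of the next \<open>L\<close> columns in
  \<open>[-B, 2 ^ L - B)\<close>, and one Horner step leads to \<open>horner k\<close>. Thus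
  \<open>L + 1\<close> columns suffice.\<close>

definition local_value :: "nat \<Rightarrow> int" where
  "local_value k = 2 * ((window (Suc k) + B) mod 2 ^ L - B) + c k"

lemma horner_zero: "m \<le> k \<Longrightarrow> horner k = 0"
  by (simp add: horner_def)

lemma horner_Suc: "horner k = 2 * horner (Suc k) + c k"
proof (cases "k < m")
  case True
  have "(\<Sum>j\<in>{Suc k..<m}. c j * 2 ^ (j - k)) = 2 * horner (Suc k)"
    unfolding horner_def sum_distrib_left
    by (intro sum.cong) (auto simp: Suc_diff_le[symmetric] Suc_diff_Suc simp flip: power_Suc)
  then show ?thesis using True by (simp add: horner_def sum.atLeast_Suc_lessThan)
qed (simp add: horner_zero zero)

lemma horner_unfold: "horner k = (\<Sum>i<l. c (k + i) * 2 ^ i) + 2 ^ l * horner (k + l)"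
proof (induction l)
  case (Suc l)
  then show ?case using horner_Suc[of "k + l"] by (simp add: algebra_simps)
qed simp

lemma horner_window:
  assumes "\<bar>horner k\<bar> \<le> B"
  shows "(window k + B) mod 2 ^ L - B = horner k"
proof -
  have "window k + B = (horner k + B) + 2 ^ L * (- horner (k + L))"
    using horner_unfold[of k L] by (simp add: window_def)
  then have "(window k + B) mod 2 ^ L = (horner k + B) mod 2 ^ L"
    by (simp only: mod_mult_self2)
  also have "\<dots> = horner k + B" using assms L by (intro mod_pos_pos_trivial) auto
  finally show ?thesis by simp
qed

lemma horner_eq_local_value:
  "\<bar>horner (Suc k)\<bar> \<le> B \<Longrightarrow> horner k = local_value k"
  using horner_window[of "Suc k"] horner_Suc[of k] by (simp add: local_value_def)

lemma horner_bounded: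
  assumes "\<And>j. k \<le> j \<Longrightarrow> j < m \<Longrightarrow> \<bar>local_value j\<bar> \<le> B"
  shows "\<bar>horner k\<bar> \<le> B"
  using assms
proof (induction "m - k" arbitrary: k)
  case 0
  then show ?case using bound[of 0] by (simp add: horner_zero)
next
  case (Suc d)
  then have "\<bar>horner (Suc k)\<bar> \<le> B" by simp
  from horner_eq_local_value[OF this] show ?case using Suc.prems[of k] Suc.hyps(2) by simp
qed

text \<open>Beyond \<open>B\<close>, doubling outruns a column: \<open>2 * (B + 1) - B > B\<close>,
  so neither can the value come back nor can its sign change.\<close>

lemma horner_escape:
  assumes "\<bar>horner k\<bar> > B"
  shows "\<bar>horner 0\<bar> > B \<and> sgn (horner 0) = sgn (horner k)"
  using assms
proof (induction k)
  case (Suc k)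
  have "\<bar>horner k\<bar> > B \<and> sgn (horner k) = sgn (horner (Suc k))"
    using Suc.prems horner_Suc[of k] bound[of k] by (auto simp: sgn_if abs_if split: if_splits)
  then show ?case using Suc.IH by simp
qed simp

text \<open>The highest column \<open>k\<close> whose local value leaves \<open>[-B, B]\<close>
  decides: above it the local values are the true Horner values, at \<open>k\<close> the local value
  is still correct, and \<open>horner_escape\<close> carries its sign down to column 0. Below
  \<open>k\<close> local values may be wrong, so the conditions only speak of columns from
  \<open>k\<close> upwards.\<close>

lemma horner_nonneg_iff:
  "0 \<le> horner 0 \<longleftrightarrow>
     ((\<forall>j<m. \<bar>local_value j\<bar> \<le> B) \<and> (m = 0 \<or> 0 \<le> local_value 0)) \<or>
     (\<exists>k<m. (\<forall>j<m. k < j \<longrightarrow> \<bar>local_value j\<bar> \<le> B) \<and> B < local_value k)"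
    (is "_ \<longleftrightarrow> ?small \<or> ?large")
proof (cases "\<forall>j<m. \<bar>local_value j\<bar> \<le> B")
  case True
  then have "\<not> ?large" by (auto simp: abs_le_iff not_less)
  moreover have "0 < m \<Longrightarrow> horner 0 = local_value 0"
    using True by (intro horner_eq_local_value horner_bounded) auto
  moreover have "m = 0 \<Longrightarrow> horner 0 = 0" unfolding horner_def by simp
  ultimately show ?thesis using True by (cases "m = 0") auto
next
  case False
  let ?K = "{j. j < m \<and> B < \<bar>local_value j\<bar>}"
  define k where "k = Max ?K"
  have K: "finite ?K" "?K \<noteq> {}" using False by (auto simp: not_le)
  have k: "k < m" "B < \<bar>local_value k\<bar>" using Max_in[OF K] by (auto simp: k_def)
  have above: "\<bar>local_value j\<bar> \<le> B" if "k < j" "j < m" for j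
    using Max_ge[OF K(1), of j] that by (force simp: k_def not_le[symmetric])
  have "\<bar>horner (Suc k)\<bar> \<le> B" by (rule horner_bounded) (use above in auto)
  then have hk: "horner k = local_value k" by (rule horner_eq_local_value)
  have B: "0 \<le> B" using bound[of 0] by simp
  have "?large \<longleftrightarrow> B < local_value k"
  proof
    assume ?large
    then obtain k' where k': "k' < m" "\<forall>j<m. k' < j \<longrightarrow> \<bar>local_value j\<bar> \<le> B" "B < local_value k'"
      by blast
    have "\<not> k < k'" using above[of k'] k'(1,3) by fastforce
    moreover have "\<not> k' < k" using k'(2) k by (auto simp: not_le[symmetric])
    ultimately show "B < local_value k" using k'(3) by (metis linorder_neqE_nat)
  qed (use k(1) above in blast)
  moreover have "0 \<le> horner 0 \<longleftrightarrow> B < local_value k"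
    using horner_escape[of k] k(2) B unfolding hk by (auto simp: sgn_if abs_if split: if_splits)
  ultimately show ?thesis using False by blast
qed

end

text \<open>The summands may be exponentially large, but as features they take polynomially many
  values, so each digit is a table lookup. Column sums are at most \<open>card I\<close> and windows
  have logarithmic length, so both are of polynomial size and hence features, and the conditions of
  \<open>horner_nonneg_iff\<close> turn into gates.\<close>

lemma tc_sum_nonneg:
  fixes F :: "'i \<Rightarrow> bool list \<Rightarrow> int"
  assumes N: "2 \<le> N" and I: "finite I" "card I \<le> N ^ a" and M: "M \<le> N ^ a"
    and F: "\<And>i. i \<in> I \<Longrightarrow> feat n N k (F i)"
    and le: "\<And>i x. i \<in> I \<Longrightarrow> length x = n \<Longrightarrow> \<bar>F i x\<bar> < 2 ^ M"
  shows "tc n N (20000 * (k + a + 3)) (\<lambda>x. 0 \<le> (\<Sum>i\<in>I. F i x))"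
proof -
  define c where "c x j = (if j < M then \<Sum>i\<in>I. signed_digit (F i x) j else 0)" for x j
  define B where "B = card I"
  define k1 where "k1 = 54 * k + 3 * a + 167"
  define k2 where "k2 = 54 * k1 + 9 * a + 185"
  define k3 where "k3 = 3 * k2 + 5"
  have c_bound: "\<bar>c x j\<bar> \<le> int B" for x j
  proof -
    have "\<bar>\<Sum>i\<in>I. signed_digit (F i x) j\<bar> \<le> (\<Sum>i\<in>I. 1)"
      by (intro order_trans[OF sum_abs] sum_mono abs_signed_digit)
    then show ?thesis by (simp add: c_def B_def)
  qed
  have c_feat: "feat n N k1 (\<lambda>x. c x j)" for j
  proof (cases "j < M")
    case True
    have "feat n N (18 * (3 * k + 5) + 3 * a + 3 * 0 + 77) (\<lambda>x. \<Sum>i\<in>I. signed_digit (F i x) j)"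
      by (rule feat_sum_int[OF N I]) (use feat_map[OF F] abs_signed_digit in auto)
    then show ?thesis using True by (simp add: c_def k1_def algebra_simps)
  next
    case False
    have "feat n N k1 (\<lambda>x. 0 :: int)" by (rule feat_mono[OF feat_const[OF N]]) (simp add: k1_def)
    then show ?thesis using False by (simp add: c_def)
  qed
  \<comment> \<open>For \<open>L = l + 1\<close>, \<open>2 * B < 2 ^ L\<close> makes residues in
    \<open>[-B, B]\<close> unique, while \<open>2 ^ L \<le> 4 * B + 2\<close> keeps the windows
    polynomial.\<close>
  obtain l where "2 ^ l \<le> 2 * B + 1" "2 * B + 1 < 2 ^ (l + 1)"
    using ex_power_ivl1[of 2 "2 * B + 1"] by auto
  define L where "L = l + 1"
  have L: "2 * B < 2 ^ L" "2 ^ L \<le> 4 * B + 2"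
    using \<open>2 ^ l \<le> 2 * B + 1\<close> \<open>2 * B + 1 < 2 ^ (l + 1)\<close> by (auto simp: L_def)
  have Na: "1 \<le> N ^ a" using N by simp
  have N3: "8 \<le> N ^ 3" using power_mono[OF N, of 3] by simp
  have L_bound: "2 ^ L \<le> N ^ (a + 3)"
  proof -
    have "2 ^ L \<le> N ^ a * 8" using L(2) I(2) Na unfolding B_def by linarith
    also have "\<dots> \<le> N ^ a * N ^ 3" by (rule mult_le_mono2[OF N3])
    finally show ?thesis by (simp only: power_add)
  qed
  interpret cols: columns "c x" M L "int B" for x
  proof
    show "2 * int B < 2 ^ L" using L(1) by (metis of_nat_less_iff of_nat_mult of_nat_numeral of_nat_power)
  qed (use c_bound in \<open>auto simp: c_def\<close>)
  have window_feat: "feat n N k2 (\<lambda>x. cols.window x j)" for j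
  proof -
    have "feat n N (18 * (3 * k1 + 5) + 3 * (a + 3) + 3 * (a + (a + 3)) + 77)
        (\<lambda>x. \<Sum>i<L. c x (j + i) * 2 ^ i)"
    proof (rule feat_sum_int[OF N])
      show "card {..<L} \<le> N ^ (a + 3)" using le_trans[OF less_imp_le[OF less_exp] L_bound] by simp
      show "\<bar>c x (j + i) * 2 ^ i\<bar> \<le> int (N ^ (a + (a + 3)))" if "i \<in> {..<L}" for i x
      proof -
        have "\<bar>c x (j + i) * 2 ^ i\<bar> \<le> int B * 2 ^ L"
          unfolding abs_mult using c_bound that by (intro mult_mono) auto
        also have "\<dots> = int (B * 2 ^ L)" by simp
        also have "B * 2 ^ L \<le> N ^ a * N ^ (a + 3)"
          using I(2) L_bound unfolding B_def by (intro mult_le_mono)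
        finally show ?thesis by (simp only: power_add of_nat_le_iff)
      qed
    qed (use feat_map[OF c_feat] in auto)
    then show ?thesis unfolding cols.window_def k2_def by (rule feat_mono) simp
  qed
  have local_feat: "feat n N k3 (\<lambda>x. cols.local_value x j)" for j
    unfolding cols.local_value_def k3_def
    by (rule feat_map2[where h = "\<lambda>u v. 2 * ((u + int B) mod 2 ^ L - int B) + v"])
       (use window_feat feat_mono[OF c_feat] in \<open>auto simp: k2_def\<close>)
  have sum_eq: "(\<Sum>i\<in>I. F i x) = cols.horner x 0" if "length x = n" for x
  proof -
    have "cols.horner x 0 = (\<Sum>j<M. \<Sum>i\<in>I. signed_digit (F i x) j * 2 ^ j)"
      by (simp add: cols.horner_def c_def sum_distrib_right atLeast0LessThan)
    also have "\<dots> = (\<Sum>i\<in>I. \<Sum>j<M. signed_digit (F i x) j * 2 ^ j)" by (rule sum.swap)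
    also have "\<dots> = (\<Sum>i\<in>I. F i x)"
      using sum_signed_digit le[OF _ that] by (intro sum.cong) auto
    finally show ?thesis ..
  qed
  let ?K = "2 * k3 + 2"
  have small: "tc n N (?K + a + 2) (\<lambda>x. \<forall>j\<in>{..<M}. \<bar>cols.local_value x j\<bar> \<le> int B)"
    by (rule tc_Ball[OF N]) (use M feat_pred[OF local_feat] in auto)
  have small0: "tc n N ?K (\<lambda>x. M = 0 \<or> 0 \<le> cols.local_value x 0)"
    by (rule feat_pred[OF local_feat])
  have above: "tc n N (?K + a + 2) (\<lambda>x. \<forall>j\<in>{k<..<M}. \<bar>cols.local_value x j\<bar> \<le> int B)" for k
    by (rule tc_Ball[OF N]) (use M feat_pred[OF local_feat] in auto)
  have step: "tc n N ((?K + a + 2) + 3)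
      (\<lambda>x. (\<forall>j\<in>{k<..<M}. \<bar>cols.local_value x j\<bar> \<le> int B) \<and> int B < cols.local_value x k)" for k
    by (rule tc_conj[OF above tc_mono[OF feat_pred[OF local_feat]]]) simp
  have large: "tc n N (((?K + a + 2) + 3) + a + 2) (\<lambda>x. \<exists>k\<in>{..<M}.
      (\<forall>j\<in>{k<..<M}. \<bar>cols.local_value x j\<bar> \<le> int B) \<and> int B < cols.local_value x k)"
    by (rule tc_Bex[OF N]) (use M step in auto)
  have first: "tc n N ((?K + a + 2) + 3) (\<lambda>x. (\<forall>j\<in>{..<M}. \<bar>cols.local_value x j\<bar> \<le> int B) \<and>
      (M = 0 \<or> 0 \<le> cols.local_value x 0))"
    by (rule tc_conj[OF small tc_mono[OF small0]]) simp
  have "tc n N ((((?K + a + 2) + 3) + a + 2) + 3)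
    (\<lambda>x. ((\<forall>j\<in>{..<M}. \<bar>cols.local_value x j\<bar> \<le> int B) \<and> (M = 0 \<or> 0 \<le> cols.local_value x 0)) \<or>
      (\<exists>k\<in>{..<M}. (\<forall>j\<in>{k<..<M}. \<bar>cols.local_value x j\<bar> \<le> int B) \<and> int B < cols.local_value x k))"
    by (rule tc_disj[OF tc_mono[OF first] large]) simp
  then show ?thesis
  proof (rule tc_weaken)
    \<comment> \<open>Unfolding the levels gives \<open>k\<close> the coefficient
      \<open>6 * 54 * 54 = 17496\<close>, which \<open>20000\<close> rounds up.\<close>
    show "(((?K + a + 2) + 3) + a + 2) + 3 \<le> 20000 * (k + a + 3)"
      by (simp add: k1_def k2_def k3_def)
  qed (simp only: sum_eq cols.horner_nonneg_iff Ball_def Bex_def lessThan_iff greaterThanLessThan_iff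
        conj_commute imp_conjL, blast)
qed


section \<open>Rounded sums\<close>

text \<open>Holds for every rule for ties: \<open>r y < r x\<close> would put \<open>x\<close> at or
  above and \<open>y\<close> at or below the midpoint of the two floats, so \<open>x = y\<close>,
  and then both would be rounded alike.\<close>

lemma rounding_mono:
  assumes "rounding p r" "x \<le> y"
  shows "r x \<le> r y"
proof (rule ccontr)
  assume "\<not> r x \<le> r y"
  then have "r y < r x" by simp
  have r: "r x \<in> fp p" "r y \<in> fp p" "\<bar>x - r x\<bar> \<le> \<bar>x - r y\<bar>" "\<bar>y - r y\<bar> \<le> \<bar>y - r x\<bar>"
    using assms(1) unfolding rounding_def by auto
  have "x \<noteq> y" using \<open>r y < r x\<close> by auto
  then have "x < y" using assms(2) by simp
  then show False using \<open>r y < r x\<close> r(3,4) by (auto simp: abs_if split: if_splits)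
qed

lemma rounding_in: "rounding p r \<Longrightarrow> r x \<in> fp p"
  by (simp add: rounding_def)

lemma rounding_fp:
  assumes "rounding p r" "x \<in> fp p"
  shows "r x = x"
proof -
  have "\<bar>x - r x\<bar> \<le> \<bar>x - x\<bar>" using assms unfolding rounding_def by blast
  then show ?thesis by simp
qed

text \<open>No float has an exponent below \<open>- (2 ^ p)\<close>, so on \<open>fp p\<close> the
  scaled number is already an integer and the floor only changes its type.\<close>

definition fp_scaled :: "nat \<Rightarrow> real \<Rightarrow> int" where
  "fp_scaled p v = \<lfloor>v * 2 ^ (2 ^ p)\<rfloor>"

lemma fp_significand_bound:
  fixes s :: int
  assumes "s \<in> {- (2 ^ p) <.. - (2 ^ (p - 1))} \<union> {0} \<union> {2 ^ (p - 1) ..< 2 ^ p}"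
  shows "\<bar>s\<bar> < 2 ^ p"
proof -
  have pos: "(0::int) < 2 ^ p" "(0::int) < 2 ^ (p - 1)" by simp_all
  consider "- (2 ^ p) < s" "s \<le> - (2 ^ (p - 1))" | "s = 0" | "2 ^ (p - 1) \<le> s" "s < 2 ^ p"
    using assms unfolding Un_iff greaterThanAtMost_iff atLeastLessThan_iff singleton_iff by blast
  then show ?thesis by cases (use pos in linarith)+
qed

lemma fp_scaled:
  assumes "v \<in> fp p"
  shows "v = of_int (fp_scaled p v) / 2 ^ (2 ^ p)" "\<bar>fp_scaled p v\<bar> < 2 ^ (p + 2 * 2 ^ p)"
proof -
  obtain s e :: int where v: "v = of_int s * 2 powi e"
    and s: "s \<in> {- (2 ^ p) <.. - (2 ^ (p - 1))} \<union> {0} \<union> {2 ^ (p - 1) ..< 2 ^ p}"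
    and e: "e \<in> {- (2 ^ p) ..< 2 ^ p}"
    using assms unfolding fp_def by blast
  define l where "l = nat (e + 2 ^ p)"
  have l: "e = int l - int (2 ^ p)" "l < 2 * 2 ^ p"
    using e by (auto simp: l_def nat_less_iff)
  have "2 powi e = (2 ^ l / 2 ^ (2 ^ p) :: real)"
    unfolding l(1) by (simp add: power_int_diff del: of_nat_power)
  then have scaled: "v * 2 ^ (2 ^ p) = of_int (s * 2 ^ l)" by (simp add: v)
  then have z: "fp_scaled p v = s * 2 ^ l" unfolding fp_scaled_def by (metis floor_of_int)
  show "v = of_int (fp_scaled p v) / 2 ^ (2 ^ p)"
    unfolding z using scaled by (simp add: field_simps)
  have sp: "\<bar>s\<bar> < 2 ^ p" by (rule fp_significand_bound[OF s])
  have "\<bar>s * 2 ^ l\<bar> < 2 ^ p * 2 ^ l" using sp by (simp add: abs_mult)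
  also have "\<dots> \<le> 2 ^ p * 2 ^ (2 * 2 ^ p)"
    using l(2) by (intro mult_left_mono power_increasing) auto
  finally show "\<bar>fp_scaled p v\<bar> < 2 ^ (p + 2 * 2 ^ p)" unfolding z by (simp only: power_add)
qed

lemma finite_fp: "finite (fp p)"
  and card_fp: "card (fp p) \<le> 4 * (2 ^ p * 2 ^ p)"
proof -
  let ?A = "{- (2 ^ p) ..< 2 ^ p :: int}"
  have sub: "fp p \<subseteq> (\<lambda>(s, e). of_int s * 2 powi e) ` (?A \<times> ?A)"
  proof
    fix v assume "v \<in> fp p"
    then obtain s e :: int where v: "v = of_int s * 2 powi e"
      and s: "s \<in> {- (2 ^ p) <.. - (2 ^ (p - 1))} \<union> {0} \<union> {2 ^ (p - 1) ..< 2 ^ p}"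
      and e: "e \<in> ?A"
      unfolding fp_def by blast
    have "s \<in> ?A" using fp_significand_bound[OF s] by auto
    then show "v \<in> (\<lambda>(s, e). of_int s * 2 powi e) ` (?A \<times> ?A)" using v e by auto
  qed
  then show "finite (fp p)" by (rule finite_subset) simp
  have "nat (2 * 2 ^ p :: int) = 2 * 2 ^ p"
    by (metis nat_int of_nat_mult of_nat_numeral of_nat_power)
  then have "card (?A \<times> ?A) = 4 * (2 ^ p * 2 ^ p)"
    by (simp add: card_cartesian_product)
  then show "card (fp p) \<le> 4 * (2 ^ p * 2 ^ p)"
    using surj_card_le[OF _ sub] by simp
qed

text \<open>The threshold joins the sum as a summand \<open>- t\<close> with index
  \<open>None\<close>, which leaves a sign test. It may exceed the other summands by the factor
  \<open>card I\<close>, hence the bit length \<open>card I + M\<close>.\<close>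

lemma tc_sum_ge:
  fixes F :: "'i \<Rightarrow> bool list \<Rightarrow> int"
  assumes N: "2 \<le> N" and I: "finite I" "card I \<le> N ^ a" and M: "M \<le> N ^ a"
    and F: "\<And>i. i \<in> I \<Longrightarrow> feat n N k (F i)" and k: "2 \<le> k"
    and le: "\<And>i x. i \<in> I \<Longrightarrow> length x = n \<Longrightarrow> \<bar>F i x\<bar> < 2 ^ M"
    and t: "\<bar>t\<bar> \<le> int (card I) * 2 ^ M"
  shows "tc n N (20000 * (k + a + 4)) (\<lambda>x. t \<le> (\<Sum>i\<in>I. F i x))"
proof -
  define G where "G j x = (case j of None \<Rightarrow> - t | Some i \<Rightarrow> F i x)" for j x
  let ?J = "insert None (Some ` I)"
  have J: "finite ?J" using I by simp
  have sum: "(\<Sum>j\<in>?J. G j x) = (\<Sum>i\<in>I. F i x) - t" for x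
    using I(1) by (simp add: G_def sum.reindex)
  have "card I + M \<le> N * N ^ a"
    using I(2) M mult_le_mono1[OF N, of "N ^ a"] by linarith
  then have MI: "card I + M \<le> N ^ (a + 1)" by simp
  have "1 \<le> N ^ a" using N by simp
  then have "card I + 1 \<le> N * N ^ a"
    using I(2) mult_le_mono1[OF N, of "N ^ a"] by linarith
  then have "card ?J \<le> N ^ (a + 1)"
    using I(1) by (simp add: card_image)
  then have "tc n N (20000 * (k + (a + 1) + 3)) (\<lambda>x. 0 \<le> (\<Sum>j\<in>?J. G j x))"
  proof (rule tc_sum_nonneg[OF N J _ MI])
    show "feat n N k (G j)" if "j \<in> ?J" for j
      using that F feat_mono[OF feat_const[OF N] k] unfolding G_def by auto
    show "\<bar>G j x\<bar> < 2 ^ (card I + M)" if "j \<in> ?J" "length x = n" for j x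
    proof (cases j)
      case None
      have "int (card I) < 2 ^ card I" using less_exp[of "card I"]
        by (metis of_nat_less_iff of_nat_numeral of_nat_power)
      then have "\<bar>t\<bar> < 2 ^ card I * 2 ^ M"
        using t by (meson le_less_trans mult_strict_right_mono zero_less_numeral zero_less_power)
      then show ?thesis using None by (simp add: G_def power_add)
    next
      case (Some i)
      then have "\<bar>G j x\<bar> < 2 ^ M" using that le by (auto simp: G_def)
      also have "(2::int) ^ M \<le> 2 ^ (card I + M)" by (intro power_increasing) auto
      finally show ?thesis .
    qed
  qed
  then show ?thesis by (rule tc_weaken) (auto simp: sum)
qed

text \<open>By monotonicity, the integer totals that are rounded to a given \<open>y\<close> form an
  interval, whose ends do not depend on the input. They are built into the circuit, so the test for
  \<open>y\<close> consists of two comparisons.\<close>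

lemma feat_rounded_sum:
  fixes F :: "'i \<Rightarrow> bool list \<Rightarrow> real"
  assumes r: "rounding p r" and N: "2 \<le> N" and p: "2 ^ p \<le> N ^ a"
    and I: "finite I" "card I \<le> N ^ a"
    and F: "\<And>i. i \<in> I \<Longrightarrow> feat n N k (F i)"
    and Fp: "\<And>i x. i \<in> I \<Longrightarrow> length x = n \<Longrightarrow> F i x \<in> fp p"
  shows "feat n N (60000 * (k + a + 4)) (\<lambda>x. r (\<Sum>i\<in>I. F i x))"
proof -
  define M where "M = p + 2 * 2 ^ p"
  define Z where "Z i x = fp_scaled p (F i x)" for i x
  let ?D = "2 ^ (2 ^ p) :: real"
  define b where "b = int (card I) * 2 ^ M"
  have Z: "F i x = of_int (Z i x) / ?D" "\<bar>Z i x\<bar> < 2 ^ M" if "i \<in> I" "length x = n" for i x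
    using fp_scaled[OF Fp[OF that]] by (auto simp: Z_def M_def)
  have N2: "4 \<le> N ^ 2" using power_mono[OF N, of 2] by simp
  \<comment> \<open>The bit length \<open>M\<close> is polynomial because \<open>2 ^ p\<close> is.
    Logarithmic precision is used here and for the number of floats below.\<close>
  have "M \<le> N ^ a * 4" using p less_exp[of p] unfolding M_def by linarith
  also have "\<dots> \<le> N ^ a * N ^ 2" using N2 by (rule mult_le_mono2)
  finally have M: "M \<le> N ^ (a + 2)" by (simp only: power_add)
  have I2: "card I \<le> N ^ (a + 2)"
    using I(2) power_increasing[of a "a + 2" N] N by linarith
  have sum: "(\<Sum>i\<in>I. F i x) = of_int (\<Sum>i\<in>I. Z i x) / ?D" if "length x = n" for x
    using Z(1)[OF _ that] by (simp add: sum_divide_distrib)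
  have sum_le: "\<bar>\<Sum>i\<in>I. Z i x\<bar> \<le> b" if "length x = n" for x
  proof -
    have "\<bar>\<Sum>i\<in>I. Z i x\<bar> \<le> (\<Sum>i\<in>I. 2 ^ M)"
      using Z(2)[OF _ that] by (intro order_trans[OF sum_abs] sum_mono less_imp_le)
    then show ?thesis by (simp add: b_def)
  qed
  have Z_feat: "feat n N (3 * k + 5) (\<lambda>x. g (Z i x))" if "i \<in> I" for i and g :: "int \<Rightarrow> int"
    unfolding Z_def by (rule feat_map[OF F[OF that], of "\<lambda>v. g (fp_scaled p v)"])
  have ge: "tc n N (20000 * ((3 * k + 5) + (a + 2) + 4)) (\<lambda>x. t \<le> (\<Sum>i\<in>I. Z i x))"
    if "\<bar>t\<bar> \<le> b" for t
    by (rule tc_sum_ge[OF N I(1) I2 M Z_feat[of _ "\<lambda>v. v"]]) (use Z(2) that in \<open>auto simp: b_def\<close>)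
  have le: "tc n N (20000 * ((3 * k + 5) + (a + 2) + 4)) (\<lambda>x. (\<Sum>i\<in>I. Z i x) \<le> t)"
    if "\<bar>t\<bar> \<le> b" for t
  proof -
    have "tc n N (20000 * ((3 * k + 5) + (a + 2) + 4)) (\<lambda>x. - t \<le> (\<Sum>i\<in>I. - Z i x))"
      by (rule tc_sum_ge[OF N I(1) I2 M Z_feat[of _ uminus]]) (use Z(2) that in \<open>auto simp: b_def\<close>)
    then show ?thesis by (rule tc_weaken) (auto simp: sum_negf)
  qed
  have tc: "tc n N (20000 * (3 * k + a + 11) + 3) (\<lambda>x. r (\<Sum>i\<in>I. F i x) = y)" for y
  proof -
    define A where "A = {t. \<bar>t\<bar> \<le> b \<and> r (of_int t / ?D) = y}"
    have "A \<subseteq> {- b..b}" by (auto simp: A_def)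
    then have fin: "finite A" by (rule finite_subset) simp
    show ?thesis
    proof (cases "A = {}")
      case True
      have "tc n N 2 (\<lambda>x. False)" by (rule tc_const[OF N])
      then show ?thesis
      proof (rule tc_weaken)
        fix x :: "bool list" assume x: "length x = n"
        have "(\<Sum>i\<in>I. Z i x) \<notin> A" using True by simp
        then show "False = (r (\<Sum>i\<in>I. F i x) = y)"
          using sum_le[OF x] sum[OF x] by (simp add: A_def)
      qed simp
    next
      case False
      have lo: "Min A \<in> A" and hi: "Max A \<in> A" using fin False by auto
      have conv: "t \<in> A" if "Min A \<le> t" "t \<le> Max A" for t
      proof -
        have "r (of_int (Min A) / ?D) \<le> r (of_int t / ?D)" "r (of_int t / ?D) \<le> r (of_int (Max A) / ?D)"
          by (rule rounding_mono[OF r], use that in \<open>simp add: divide_right_mono\<close>)+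
        then show ?thesis using lo hi that by (auto simp: A_def)
      qed
      have "tc n N (20000 * (3 * k + a + 11) + 3)
          (\<lambda>x. Min A \<le> (\<Sum>i\<in>I. Z i x) \<and> (\<Sum>i\<in>I. Z i x) \<le> Max A)"
        by (intro tc_conj tc_mono[OF ge] tc_mono[OF le]) (use lo hi in \<open>auto simp: A_def\<close>)
      moreover have "(Min A \<le> (\<Sum>i\<in>I. Z i x) \<and> (\<Sum>i\<in>I. Z i x) \<le> Max A) =
          (r (\<Sum>i\<in>I. F i x) = y)" if "length x = n" for x
      proof -
        have "(Min A \<le> (\<Sum>i\<in>I. Z i x) \<and> (\<Sum>i\<in>I. Z i x) \<le> Max A) = ((\<Sum>i\<in>I. Z i x) \<in> A)"
          using conv fin by (auto intro: Min_le Max_ge)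
        then show ?thesis using sum_le[OF that] sum[OF that] by (simp add: A_def)
      qed
      ultimately show ?thesis by (rule tc_cong)
    qed
  qed
  have "card (fp p) \<le> N ^ (2 + (a + a))"
  proof -
    have "card (fp p) \<le> N ^ 2 * (N ^ a * N ^ a)"
      using card_fp[of p] mult_le_mono[OF N2 mult_le_mono[OF p p]] by linarith
    then show ?thesis by (simp only: power_add)
  qed
  also have "\<dots> \<le> N ^ (60000 * (k + a + 4))" using N by (intro power_increasing) auto
  finally show ?thesis unfolding feat_def
    using N finite_fp rounding_in[OF r] tc_mono[OF tc, of "60000 * (k + a + 4)"] by (auto intro!: exI[of _ "fp p"])
qed


section \<open>Circuits for Hopfield models\<close>

text \<open>Replaces \<open>LEAST\<close> by quantifiers over finite index sets, which become
  gates.\<close>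

lemma mhm_eq_iff:
  assumes "0 < vocab M"
  shows "mhm s M xs = y \<longleftrightarrow>
    (y < vocab M \<and> (\<forall>z\<in>{..<vocab M}. next_token_dist s M xs $ z \<le> next_token_dist s M xs $ y)) \<and>
    (\<forall>y'\<in>{..<y}. \<not> (y' < vocab M \<and>
      (\<forall>z\<in>{..<vocab M}. next_token_dist s M xs $ z \<le> next_token_dist s M xs $ y')))"
proof -
  let ?D = "\<lambda>z. next_token_dist s M xs $ z"
  let ?P = "\<lambda>y. y < vocab M \<and> (\<forall>z\<in>{..<vocab M}. ?D z \<le> ?D y)"
  have "Max (?D ` {..<vocab M}) \<in> ?D ` {..<vocab M}" using assms by (intro Max_in) auto
  then obtain w where w: "w < vocab M" "?D w = Max (?D ` {..<vocab M})" by auto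
  then have "?P w" by auto
  then have "?P (LEAST y. ?P y)" by (rule LeastI)
  moreover have "\<not> ?P y'" if "y' < (LEAST y. ?P y)" for y' using that by (rule not_less_Least)
  moreover have "(LEAST y. ?P y) = y" if "?P y" "\<forall>y'\<in>{..<y}. \<not> ?P y'"
    using that by (intro Least_equality) (auto simp: not_less[symmetric])
  moreover have "mhm s M xs = (LEAST y. ?P y)" by (simp only: mhm_def Ball_def lessThan_iff)
  ultimately show ?thesis by (metis (no_types, lifting) lessThan_iff)
qed

locale simulation =
  fixes n N a p :: nat and r :: "real \<Rightarrow> real"
  assumes N: "2 \<le> N" and rounding: "rounding p r" and p: "2 ^ p \<le> N ^ a"
begin

definition feat_vec :: "nat \<Rightarrow> nat \<Rightarrow> (bool list \<Rightarrow> real vec) \<Rightarrow> bool" where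
  "feat_vec k m v \<longleftrightarrow> (\<forall>x. length x = n \<longrightarrow> dim_vec (v x) = m) \<and> (\<forall>i<m. feat n N k (\<lambda>x. v x $ i))"

definition feat_mat :: "nat \<Rightarrow> nat \<Rightarrow> nat \<Rightarrow> (bool list \<Rightarrow> real mat) \<Rightarrow> bool" where
  "feat_mat k l m H \<longleftrightarrow> (\<forall>x. length x = n \<longrightarrow> dim_row (H x) = l \<and> dim_col (H x) = m) \<and>
     (\<forall>i<l. \<forall>j<m. feat n N k (\<lambda>x. H x $$ (i, j)))"

text \<open>This function and the following ones tell how an operation raises the level. They depend
  on \<open>a\<close> but not on \<open>n\<close>, \<open>N\<close> or \<open>p\<close>, so
  iterating them over boundedly many layers gives one level for all input lengths.\<close>

definition dot_level :: "nat \<Rightarrow> nat" where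
  "dot_level k = 60000 * (3 * k + 5 + a + 4)"

definition softmax_level :: "nat \<Rightarrow> nat" where
  "softmax_level k = 3 * dot_level k + 5"

definition add_level :: "nat \<Rightarrow> nat" where
  "add_level k = 3 * k + 5"

definition hopfield_level :: "nat \<Rightarrow> nat" where
  "hopfield_level k = dot_level (softmax_level (add_level (dot_level (dot_level k))))"

definition ffn_level :: "nat \<Rightarrow> nat" where
  "ffn_level k = add_level (dot_level (add_level (add_level (dot_level k))))"

definition decoder_level :: "nat \<Rightarrow> nat" where
  "decoder_level k = ffn_level (hopfield_level k)"

lemmas level_defs = dot_level_def softmax_level_def add_level_def hopfield_level_def
  ffn_level_def decoder_level_def

lemma feat_vec_mono: "feat_vec k m v \<Longrightarrow> k \<le> k' \<Longrightarrow> feat_vec k' m v"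
  unfolding feat_vec_def using feat_mono by blast

lemma feat_mat_mono: "feat_mat k l m H \<Longrightarrow> k \<le> k' \<Longrightarrow> feat_mat k' l m H"
  unfolding feat_mat_def using feat_mono by blast

lemma feat_mat_cong:
  assumes "feat_mat k l m H" "\<And>x. length x = n \<Longrightarrow> H x = G x"
  shows "feat_mat k l m G"
  unfolding feat_mat_def
proof (intro conjI allI impI)
  fix i j assume "i < l" "j < m"
  then have "feat n N k (\<lambda>x. H x $$ (i, j))" using assms(1) by (auto simp: feat_mat_def)
  then show "feat n N k (\<lambda>x. G x $$ (i, j))" by (rule feat_cong) (simp add: assms(2))
qed (use assms in \<open>auto simp: feat_mat_def\<close>)

section \<open>Floating-point linear algebra on features\<close>

lemma feat_dot:
  assumes "m \<le> N ^ a" "feat_vec k m u" "feat_vec k m v"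
  shows "feat n N (dot_level k) (\<lambda>x. fp_dot r (u x) (v x))"
proof -
  have "feat n N (60000 * (3 * k + 5 + a + 4)) (\<lambda>x. r (\<Sum>i<m. r (u x $ i * v x $ i)))"
  proof (rule feat_rounded_sum[OF rounding N p])
    show "feat n N (3 * k + 5) (\<lambda>x. r (u x $ i * v x $ i))" if "i \<in> {..<m}" for i
      using assms that unfolding feat_vec_def
      by (intro feat_map2[where h = "\<lambda>b c. r (b * c)"]) auto
  qed (use assms(1) rounding_in[OF rounding] in auto)
  then show ?thesis unfolding dot_level_def
    by (rule feat_cong) (use assms(3) in \<open>auto simp: fp_dot_def feat_vec_def\<close>)
qed

lemma feat_vec_const: "v \<in> carrier_vec m \<Longrightarrow> feat_vec 2 m (\<lambda>x. v)"
  unfolding feat_vec_def using feat_const[OF N] by auto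

lemma feat_mat_const: "A \<in> carrier_mat l m \<Longrightarrow> feat_mat 2 l m (\<lambda>x. A)"
  unfolding feat_mat_def using feat_const[OF N] by auto

lemma feat_vec_row:
  assumes "feat_mat k l m H" "i < l"
  shows "feat_vec k m (\<lambda>x. row (H x) i)"
  unfolding feat_vec_def
proof (intro conjI allI impI)
  fix j assume "j < m"
  then have "feat n N k (\<lambda>x. H x $$ (i, j))" using assms by (auto simp: feat_mat_def)
  then show "feat n N k (\<lambda>x. row (H x) i $ j)"
    by (rule feat_cong) (use assms \<open>j < m\<close> in \<open>auto simp: feat_mat_def\<close>)
qed (use assms in \<open>auto simp: feat_mat_def\<close>)

lemma feat_vec_col:
  assumes "feat_mat k l m H" "j < m"
  shows "feat_vec k l (\<lambda>x. col (H x) j)"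
  unfolding feat_vec_def
proof (intro conjI allI impI)
  fix i assume "i < l"
  then have "feat n N k (\<lambda>x. H x $$ (i, j))" using assms by (auto simp: feat_mat_def)
  then show "feat n N k (\<lambda>x. col (H x) j $ i)"
    by (rule feat_cong) (use assms \<open>i < l\<close> in \<open>auto simp: feat_mat_def\<close>)
qed (use assms in \<open>auto simp: feat_mat_def\<close>)

lemma feat_mat_transpose:
  assumes "feat_mat k l m H"
  shows "feat_mat k m l (\<lambda>x. transpose_mat (H x))"
  unfolding feat_mat_def
proof (intro conjI allI impI)
  fix i j assume ij: "i < m" "j < l"
  then have "feat n N k (\<lambda>x. H x $$ (j, i))" using assms by (auto simp: feat_mat_def)
  then show "feat n N k (\<lambda>x. transpose_mat (H x) $$ (i, j))"
    by (rule feat_cong) (use assms ij in \<open>auto simp: feat_mat_def\<close>)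
qed (use assms in \<open>auto simp: feat_mat_def\<close>)

lemma feat_mat_mult:
  assumes "m \<le> N ^ a" "feat_mat k l m A" "feat_mat k m q B"
  shows "feat_mat (dot_level k) l q (\<lambda>x. fp_mat_mult r (A x) (B x))"
  unfolding feat_mat_def
proof (intro conjI allI impI)
  fix i j assume ij: "i < l" "j < q"
  have "feat n N (dot_level k) (\<lambda>x. fp_dot r (row (A x) i) (col (B x) j))"
    by (rule feat_dot[OF assms(1) feat_vec_row[OF assms(2) ij(1)] feat_vec_col[OF assms(3) ij(2)]])
  then show "feat n N (dot_level k) (\<lambda>x. fp_mat_mult r (A x) (B x) $$ (i, j))"
    by (rule feat_cong) (use assms ij in \<open>auto simp: feat_mat_def fp_mat_mult_def\<close>)
qed (use assms in \<open>auto simp: feat_mat_def fp_mat_mult_def\<close>)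

lemma feat_mat_vec:
  assumes "m \<le> N ^ a" "feat_mat k l m A" "feat_vec k m v"
  shows "feat_vec (dot_level k) l (\<lambda>x. fp_mat_vec r (A x) (v x))"
  unfolding feat_vec_def
proof (intro conjI allI impI)
  fix i assume i: "i < l"
  have "feat n N (dot_level k) (\<lambda>x. fp_dot r (row (A x) i) (v x))"
    by (rule feat_dot[OF assms(1) feat_vec_row[OF assms(2) i] assms(3)])
  then show "feat n N (dot_level k) (\<lambda>x. fp_mat_vec r (A x) (v x) $ i)"
    by (rule feat_cong) (use assms i in \<open>auto simp: feat_mat_def fp_mat_vec_def\<close>)
qed (use assms in \<open>auto simp: feat_mat_def fp_mat_vec_def\<close>)

lemma feat_mat_map:
  assumes "feat_mat k l m H"
  shows "feat_mat (add_level k) l m (\<lambda>x. map_mat f (H x))"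
  unfolding feat_mat_def
proof (intro conjI allI impI)
  fix i j assume ij: "i < l" "j < m"
  then have "feat n N (add_level k) (\<lambda>x. f (H x $$ (i, j)))"
    unfolding add_level_def using assms by (intro feat_map) (auto simp: feat_mat_def)
  then show "feat n N (add_level k) (\<lambda>x. map_mat f (H x) $$ (i, j))"
    by (rule feat_cong) (use assms ij in \<open>auto simp: feat_mat_def\<close>)
qed (use assms in \<open>auto simp: feat_mat_def\<close>)

lemma feat_vec_map:
  assumes "feat_vec k m v"
  shows "feat_vec (add_level k) m (\<lambda>x. map_vec f (v x))"
  unfolding feat_vec_def
proof (intro conjI allI impI)
  fix i assume i: "i < m"
  then have "feat n N (add_level k) (\<lambda>x. f (v x $ i))"
    unfolding add_level_def using assms by (intro feat_map) (auto simp: feat_vec_def)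
  then show "feat n N (add_level k) (\<lambda>x. map_vec f (v x) $ i)"
    by (rule feat_cong) (use assms i in \<open>auto simp: feat_vec_def\<close>)
qed (use assms in \<open>auto simp: feat_vec_def\<close>)

lemma feat_vec_add:
  assumes "feat_vec k m u" "feat_vec k m v"
  shows "feat_vec (add_level k) m (\<lambda>x. fp_vec_add r (u x) (v x))"
  unfolding feat_vec_def
proof (intro conjI allI impI)
  fix i assume i: "i < m"
  then have "feat n N (add_level k) (\<lambda>x. r (u x $ i + v x $ i))"
    unfolding add_level_def using assms
    by (intro feat_map2[where h = "\<lambda>b c. r (b + c)"]) (auto simp: feat_vec_def)
  then show "feat n N (add_level k) (\<lambda>x. fp_vec_add r (u x) (v x) $ i)"
    by (rule feat_cong) (use assms i in \<open>auto simp: feat_vec_def fp_vec_add_def\<close>)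
qed (use assms in \<open>auto simp: feat_vec_def fp_vec_add_def\<close>)

lemma feat_vec_softmax:
  assumes "m \<le> N ^ a" "feat_vec k m v"
  shows "feat_vec (softmax_level k) m (\<lambda>x. fp_softmax r (v x))"
  unfolding feat_vec_def
proof (intro conjI allI impI)
  fix i assume i: "i < m"
  have exps: "feat n N (3 * k + 5) (\<lambda>x. r (exp (v x $ j)))" if "j < m" for j
    using assms(2) that by (intro feat_map[where h = "\<lambda>y. r (exp y)"]) (auto simp: feat_vec_def)
  have "feat n N (dot_level k) (\<lambda>x. r (\<Sum>j<m. r (exp (v x $ j))))"
    unfolding dot_level_def
    by (rule feat_rounded_sum[OF rounding N p]) (use assms(1) exps rounding_in[OF rounding] in auto)
  then have "feat n N (softmax_level k)
      (\<lambda>x. r (r (exp (v x $ i)) / r (\<Sum>j<m. r (exp (v x $ j)))))"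
    unfolding softmax_level_def
    by (intro feat_map2[where h = "\<lambda>b c. r (b / c)"] feat_mono[OF exps[OF i]])
       (auto simp: dot_level_def)
  then show "feat n N (softmax_level k) (\<lambda>x. fp_softmax r (v x) $ i)"
    by (rule feat_cong) (use assms i in \<open>auto simp: feat_vec_def fp_softmax_def\<close>)
qed (use assms in \<open>auto simp: feat_vec_def fp_softmax_def\<close>)

lemma feat_mat_map_rows:
  assumes H: "feat_mat k l m H"
    and f: "\<And>v. feat_vec k m v \<Longrightarrow> feat_vec k' c (\<lambda>x. f (v x))"
  shows "feat_mat k' l c (\<lambda>x. map_rows c f (H x))"
  unfolding feat_mat_def
proof (intro conjI allI impI)
  fix i j assume ij: "i < l" "j < c"
  have "feat n N k' (\<lambda>x. f (row (H x) i) $ j)"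
    using f[OF feat_vec_row[OF H ij(1)]] ij(2) by (simp add: feat_vec_def)
  then show "feat n N k' (\<lambda>x. map_rows c f (H x) $$ (i, j))"
    by (rule feat_cong) (use H ij in \<open>auto simp: feat_mat_def map_rows_def mat_of_rows_def rows_def\<close>)
qed (use H in \<open>auto simp: feat_mat_def map_rows_def\<close>)

section \<open>Layers and the complete model\<close>

lemma wf_layerD:
  assumes "wf_layer q d l"
  shows "WQ l \<in> carrier_mat d d" "WK l \<in> carrier_mat d d" "tilde_WV s (WK l) (WV l) \<in> carrier_mat d d"
    "W1 l \<in> carrier_mat d d" "b1 l \<in> carrier_vec d" "W2 l \<in> carrier_mat d d" "b2 l \<in> carrier_vec d"
  using assms unfolding wf_layer_def fp_carrier_mat_def fp_carrier_vec_def
  by (cases "WV l"; auto simp: fp_mat_mult_def)+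

lemma feat_hopfield:
  assumes "d \<le> N ^ a" "l \<le> N ^ a" "2 \<le> k" "wf_layer q d ly" "feat_mat k l d H"
  shows "feat_mat (hopfield_level k) l d (\<lambda>x. hopfield r ly (H x) (H x))"
proof -
  note wf = wf_layerD[OF assms(4)]
  note const = feat_mat_mono[OF feat_mat_const \<open>2 \<le> k\<close>]
  let ?S = "\<lambda>x. fp_mat_mult r (fp_mat_mult r (H x) (WQ ly)) (transpose_mat (fp_mat_mult r (H x) (WK ly)))"
  have S: "feat_mat (dot_level (dot_level k)) l l ?S"
    by (intro feat_mat_mult[OF assms(1)] feat_mat_transpose assms(5) const wf)
  have "feat_mat (softmax_level (add_level (dot_level (dot_level k)))) l l
      (\<lambda>x. map_rows l (fp_softmax r) (map_mat (\<lambda>s. r (beta ly * s)) (?S x)))"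
    by (intro feat_mat_map_rows[OF feat_mat_map[OF S]] feat_vec_softmax[OF assms(2)])
  moreover have "feat_mat (softmax_level (add_level (dot_level (dot_level k)))) l d
      (\<lambda>x. fp_mat_mult r (H x) (tilde_WV r (WK ly) (WV ly)))"
    by (rule feat_mat_mono[OF feat_mat_mult[OF assms(1) assms(5) const[OF wf(3)]]])
       (simp add: level_defs)
  ultimately have *: "feat_mat (hopfield_level k) l d
     (\<lambda>x. fp_mat_mult r (map_rows l (fp_softmax r) (map_mat (\<lambda>s. r (beta ly * s)) (?S x)))
        (fp_mat_mult r (H x) (tilde_WV r (WK ly) (WV ly))))"
    unfolding hopfield_level_def by (rule feat_mat_mult[OF assms(2)])
  have "dim_row (H x) = l" if "length x = n" for x
    using assms(5) that by (auto simp: feat_mat_def)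
  then show ?thesis by (intro feat_mat_cong[OF *]) (simp add: hopfield_def)
qed

lemma feat_ffn:
  assumes "d \<le> N ^ a" "2 \<le> k" "wf_layer q d ly" "feat_vec k d v"
  shows "feat_vec (ffn_level k) d (\<lambda>x. ffn r ly (v x))"
proof -
  note wf = wf_layerD[OF assms(3)]
  have h: "feat_vec (add_level (add_level (dot_level k))) d
      (\<lambda>x. map_vec (max 0) (fp_vec_add r (fp_mat_vec r (W1 ly) (v x)) (b1 ly)))"
    by (intro feat_vec_map feat_vec_add feat_mat_vec[OF assms(1)] assms(4)
        feat_mat_mono[OF feat_mat_const[OF wf(4)]] feat_vec_mono[OF feat_vec_const[OF wf(5)]])
       (use assms(2) in \<open>auto simp: level_defs\<close>)
  show ?thesis unfolding ffn_def Let_def ffn_level_def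
    by (intro feat_vec_add feat_mat_vec[OF assms(1)] h
        feat_mat_mono[OF feat_mat_const[OF wf(6)]] feat_vec_mono[OF feat_vec_const[OF wf(7)]])
       (auto simp: level_defs)
qed

lemma feat_decoder:
  assumes "d \<le> N ^ a" "l \<le> N ^ a" "2 \<le> k" "wf_layer q d ly" "feat_mat k l d H"
  shows "feat_mat (decoder_level k) l d (\<lambda>x. decoder r ly (H x))"
proof -
  have *: "feat_mat (decoder_level k) l d (\<lambda>x. map_rows d (ffn r ly) (hopfield r ly (H x) (H x)))"
    unfolding decoder_level_def
    by (rule feat_mat_map_rows[OF feat_hopfield[OF assms] feat_ffn[OF assms(1) _ assms(4)]])
       (auto simp: level_defs)
  have "dim_col (H x) = d" if "length x = n" for x
    using assms(5) that by (auto simp: feat_mat_def)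
  then show ?thesis by (intro feat_mat_cong[OF *]) (simp add: decoder_def)
qed

lemma feat_mhn:
  assumes "d \<le> N ^ a" "l \<le> N ^ a" "\<forall>ly\<in>set ls. wf_layer q d ly"
    "2 \<le> k" "feat_mat k l d H" "length ls \<le> D"
  shows "feat_mat ((decoder_level ^^ D) k) l d (\<lambda>x. mhn r ls (H x))"
proof -
  have level: "k \<le> decoder_level k" for k by (simp add: level_defs)
  then have mono: "k \<le> (decoder_level ^^ e) k" for e k
    by (induction e) (auto intro: order_trans)
  have "feat_mat ((decoder_level ^^ length ls) k) l d (\<lambda>x. mhn r ls (H x))"
    using assms(3,4,5) unfolding mhn_def
  proof (induction ls arbitrary: k H)
    case (Cons ly ls)
    have "feat_mat ((decoder_level ^^ length ls) (decoder_level k)) l d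
        (\<lambda>x. fold (decoder r) ls (decoder r ly (H x)))"
      using Cons.prems level[of k] feat_decoder[OF assms(1,2)] by (intro Cons.IH) auto
    then show ?case by (simp add: funpow_swap1)
  qed simp
  then show ?thesis
  proof (rule feat_mat_mono)
    \<comment> \<open>The level is raised from the actual number of layers to the bound
      \<open>D\<close>, so that it is the same for all models of a family.\<close>
    have "(decoder_level ^^ D) k = (decoder_level ^^ (D - length ls)) ((decoder_level ^^ length ls) k)"
      using assms(6) by (simp flip: funpow_add[THEN fun_cong, unfolded comp_def])
    then show "(decoder_level ^^ length ls) k \<le> (decoder_level ^^ D) k" using mono by simp
  qed
qed

definition mhm_level :: "nat \<Rightarrow> nat \<Rightarrow> nat" where
  "mhm_level D k = 3 * softmax_level (dot_level ((decoder_level ^^ D) (add_level k))) + 2 * a + 20"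

text \<open>Two lengths are involved: the circuit has \<open>n\<close> input bits, while the model
  reads a word \<open>X x\<close> of \<open>l\<close> tokens, each of them a feature of these
  bits.\<close>

lemma tc_mhm:
  assumes wf: "wf_mhm q M" and d: "embed_dim M \<le> N ^ a" and l: "0 < l" "l \<le> N ^ a" "l \<le> max_len M"
    and V: "vocab M \<le> N ^ a" and D: "length (layers M) \<le> D" and k: "2 \<le> k"
    and X: "\<And>x. length x = n \<Longrightarrow> length (X x) = l" "\<And>i. i < l \<Longrightarrow> feat n N k (\<lambda>x. X x ! i)"
  shows "tc n N (mhm_level D k) (\<lambda>x. mhm r M (X x) = y)"
proof -
  let ?d = "embed_dim M"
  have emb: "feat_mat (add_level k) l ?d (\<lambda>x. embed r M (X x))"
    unfolding feat_mat_def
  proof (intro conjI allI impI)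
    fix i j assume ij: "i < l" "j < ?d"
    have "feat n N (add_level k) (\<lambda>x. r (token_enc M (X x ! i) $ j + pos_enc M (Suc i) $ j))"
      unfolding add_level_def
      by (rule feat_map[OF X(2)[OF ij(1)], of "\<lambda>t. r (token_enc M t $ j + pos_enc M (Suc i) $ j)"])
    moreover have "pos_enc M (Suc i) \<in> carrier_vec ?d"
      using wf l ij by (auto simp: wf_mhm_def fp_carrier_vec_def)
    ultimately show "feat n N (add_level k) (\<lambda>x. embed r M (X x) $$ (i, j))"
      by (elim feat_cong) (use ij X(1) in \<open>simp add: embed_def mat_of_rows_index fp_vec_add_def\<close>)
  qed (use X(1) in \<open>auto simp: embed_def\<close>)
  have pos: "2 \<le> add_level k" "2 \<le> (decoder_level ^^ D) (add_level k)"
  proof -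
    have "2 \<le> (decoder_level ^^ e) (add_level k)" for e
      using k by (cases e) (auto simp: level_defs)
    from this[of D] this[of 0] show "2 \<le> add_level k" "2 \<le> (decoder_level ^^ D) (add_level k)" by auto
  qed
  have "feat_mat ((decoder_level ^^ D) (add_level k)) l ?d (\<lambda>x. mhn r (layers M) (embed r M (X x)))"
    using wf by (intro feat_mhn[OF d l(2) _ pos(1) emb D, where q = q]) (auto simp: wf_mhm_def)
  then have "feat_vec ((decoder_level ^^ D) (add_level k)) ?d
      (\<lambda>x. row (mhn r (layers M) (embed r M (X x))) (l - 1))"
    by (rule feat_vec_row) (use l in simp)
  moreover have "output_mat M \<in> carrier_mat (vocab M) ?d"
    using wf by (auto simp: wf_mhm_def fp_carrier_mat_def)
  ultimately have "feat_vec (softmax_level (dot_level ((decoder_level ^^ D) (add_level k)))) (vocab M)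
      (\<lambda>x. fp_softmax r (fp_mat_vec r (output_mat M) (row (mhn r (layers M) (embed r M (X x))) (l - 1))))"
    by (intro feat_vec_softmax[OF V] feat_mat_vec[OF d] feat_mat_mono[OF feat_mat_const pos(2)])
  then have dist: "feat n N (softmax_level (dot_level ((decoder_level ^^ D) (add_level k))))
      (\<lambda>x. next_token_dist r M (X x) $ z)" if "z < vocab M" for z
    using that X(1) unfolding feat_vec_def next_token_dist_def by (auto elim!: feat_cong)
  let ?K = "3 * softmax_level (dot_level ((decoder_level ^^ D) (add_level k))) + 5"
  let ?le = "\<lambda>z y x. next_token_dist r M (X x) $ z \<le> next_token_dist r M (X x) $ y"
  have le: "tc n N ?K (?le z y)" if "z < vocab M" "y < vocab M" for z y
  proof -
    have "tc n N ?K (\<lambda>x. ?le z y x = True)"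
      using feat_map2[OF dist dist, of z y "\<lambda>u v. u \<le> v"] that unfolding feat_def by blast
    then show ?thesis by simp
  qed
  have P: "tc n N (?K + a + 2) (\<lambda>x. y < vocab M \<and> (\<forall>z\<in>{..<vocab M}. ?le z y x))" for y
  proof (cases "y < vocab M")
    case True
    have "tc n N (?K + a + 2) (\<lambda>x. \<forall>z\<in>{..<vocab M}. ?le z y x)"
      by (rule tc_Ball[OF N]) (use V le True in auto)
    then show ?thesis using True by simp
  next
    case False
    then show ?thesis by (intro tc_weaken[OF tc_const[OF N, of n False]]) auto
  qed
  show ?thesis
  proof (cases "y < vocab M")
    case True
    have "tc n N ((?K + a + 2 + 2) + a + 2)
      (\<lambda>x. \<forall>y'\<in>{..<y}. \<not> (y' < vocab M \<and> (\<forall>z\<in>{..<vocab M}. ?le z y' x)))"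
      by (rule tc_Ball[OF N _ _ tc_not[OF P]]) (use True V in auto)
    then have "tc n N (((?K + a + 2 + 2) + a + 2) + 3)
      (\<lambda>x. (y < vocab M \<and> (\<forall>z\<in>{..<vocab M}. ?le z y x)) \<and>
        (\<forall>y'\<in>{..<y}. \<not> (y' < vocab M \<and> (\<forall>z\<in>{..<vocab M}. ?le z y' x))))"
      by (intro tc_conj tc_mono[OF P]) auto
    then show ?thesis
      by (rule tc_weaken) (use wf in \<open>auto simp: mhm_level_def mhm_eq_iff wf_mhm_def\<close>)
  next
    case False
    have "tc n N 2 (\<lambda>x. False)" by (rule tc_const[OF N])
    then show ?thesis
      by (rule tc_weaken) (use False wf in \<open>auto simp: mhm_level_def mhm_eq_iff wf_mhm_def\<close>)
  qed
qed

end


section \<open>Barrington's theorem\<close>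

locale perfect_group = group +
  assumes finite_carrier: "finite (carrier G)"
    and perfect: "derived G (carrier G) = carrier G"
begin

abbreviation mult_list :: "'a list \<Rightarrow> 'a" where
  "mult_list gs \<equiv> foldr (\<otimes>) gs \<one>"

definition commutator :: "'a \<times> 'a \<Rightarrow> 'a" where
  "commutator p = fst p \<otimes> snd p \<otimes> inv (fst p) \<otimes> inv (snd p)"

lemma mult_list_closed [simp]: "set gs \<subseteq> carrier G \<Longrightarrow> mult_list gs \<in> carrier G"
  by (induction gs) auto

lemma mult_list_append:
  "set gs \<subseteq> carrier G \<Longrightarrow> set hs \<subseteq> carrier G \<Longrightarrow> mult_list (gs @ hs) = mult_list gs \<otimes> mult_list hs"
  by (induction gs) (auto simp: m_assoc)

lemma commutator_closed: "p \<in> carrier G \<times> carrier G \<Longrightarrow> commutator p \<in> carrier G"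
  by (auto simp: commutator_def)

lemma commutator_list_closed:
  "set ps \<subseteq> carrier G \<times> carrier G \<Longrightarrow> set (map commutator ps) \<subseteq> carrier G"
  using commutator_closed by auto

lemma inv_commutator:
  assumes "a \<in> carrier G" "b \<in> carrier G"
  shows "inv (commutator (a, b)) = commutator (b, a)"
  using assms by (simp add: commutator_def inv_mult_group m_assoc)

text \<open>The inverse of a commutator is a commutator, so the derived subgroup consists of
  products of commutators.\<close>

lemma ex_commutator_list:
  assumes "g \<in> carrier G"
  shows "\<exists>ps. set ps \<subseteq> carrier G \<times> carrier G \<and> mult_list (map commutator ps) = g"
proof -
  have "g \<in> generate G (derived_set G (carrier G))"
    using assms perfect by (simp add: derived_def)
  then show ?thesis
  proof (induction rule: generate.induct)
    case one
    show ?case by (rule exI[of _ "[]"]) simp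
  next
    case (incl h)
    then obtain a b where ab: "a \<in> carrier G" "b \<in> carrier G" "h = commutator (a, b)"
      by (auto simp: commutator_def)
    then show ?case using commutator_closed[of "(a, b)"] by (intro exI[of _ "[(a, b)]"]) simp
  next
    case (inv h)
    then obtain a b where ab: "a \<in> carrier G" "b \<in> carrier G" "h = commutator (a, b)"
      by (auto simp: commutator_def)
    then show ?case using commutator_closed[of "(b, a)"] inv_commutator[OF ab(1,2)]
      by (intro exI[of _ "[(b, a)]"]) simp
  next
    case (eng h1 h2)
    then obtain ps qs where "set ps \<subseteq> carrier G \<times> carrier G" "mult_list (map commutator ps) = h1"
      "set qs \<subseteq> carrier G \<times> carrier G" "mult_list (map commutator qs) = h2" by blast
    then show ?case
      by (intro exI[of _ "ps @ qs"])
         (simp add: mult_list_append commutator_list_closed del: foldr_append set_map)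
  qed
qed

text \<open>Finiteness makes the number of commutators uniform in the group element, so that a
  conjunction lengthens programs by a constant factor.\<close>

lemma commutator_length:
  "\<exists>c\<ge>1. \<forall>g\<in>carrier G. \<exists>ps. set ps \<subseteq> carrier G \<times> carrier G \<and> length ps \<le> c \<and>
     mult_list (map commutator ps) = g"
proof -
  obtain ps where ps: "\<And>g. g \<in> carrier G \<Longrightarrow>
      set (ps g) \<subseteq> carrier G \<times> carrier G \<and> mult_list (map commutator (ps g)) = g"
    using ex_commutator_list by metis
  define c where "c = Suc (\<Sum>g\<in>carrier G. length (ps g))"
  have "length (ps g) \<le> c" if "g \<in> carrier G" for g
    using member_le_sum[OF that, of "\<lambda>g. length (ps g)"] finite_carrier by (simp add: c_def)
  then show ?thesis using ps by (intro exI[of _ c]) (auto simp: c_def)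
qed

section \<open>Group programs\<close>

definition instruction :: "nat \<Rightarrow> (bool list \<Rightarrow> 'a) \<Rightarrow> bool" where
  "instruction n q \<longleftrightarrow>
     (\<exists>i<n. \<exists>g\<in>carrier G. \<exists>h\<in>carrier G. q = (\<lambda>x. if x ! i then g else h))"

definition run :: "(bool list \<Rightarrow> 'a) list \<Rightarrow> bool list \<Rightarrow> 'a" where
  "run P x = mult_list (map (\<lambda>q. q x) P)"

text \<open>All targets \<open>g\<close> are demanded at once, so that a construction may pass to
  the inverse of its target or to the entries of commutators. This takes the place of the
  conjugations that move a single target.\<close>

definition programs :: "nat \<Rightarrow> nat \<Rightarrow> (bool list \<Rightarrow> bool) \<Rightarrow> bool" where
  "programs n l f \<longleftrightarrow> (\<forall>g\<in>carrier G. \<exists>P. length P \<le> l \<and> (\<forall>q\<in>set P. instruction n q) \<and>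
     (\<forall>x. length x = n \<longrightarrow> run P x = (if f x then g else \<one>)))"

lemma instruction_closed: "instruction n q \<Longrightarrow> q x \<in> carrier G"
  by (auto simp: instruction_def)

lemma instruction_const: "0 < n \<Longrightarrow> g \<in> carrier G \<Longrightarrow> instruction n (\<lambda>x. g)"
  unfolding instruction_def by (intro exI[of _ 0] conjI bexI[of _ g]) auto

lemma run_closed: "\<forall>q\<in>set P. instruction n q \<Longrightarrow> run P x \<in> carrier G"
  unfolding run_def by (intro mult_list_closed) (auto intro: instruction_closed)

lemma run_append:
  assumes "\<forall>q\<in>set P. instruction n q" "\<forall>q\<in>set Q. instruction n q"
  shows "run (P @ Q) x = run P x \<otimes> run Q x"
proof -
  have "set (map (\<lambda>q. q x) P) \<subseteq> carrier G" "set (map (\<lambda>q. q x) Q) \<subseteq> carrier G"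
    using assms by (auto intro: instruction_closed)
  from mult_list_append[OF this] show ?thesis by (simp add: run_def)
qed

lemma programs_mono: "programs n l f \<Longrightarrow> l \<le> l' \<Longrightarrow> programs n l' f"
  unfolding programs_def by (meson le_trans)

lemma programs_input: "i < n \<Longrightarrow> programs n 1 (\<lambda>x. x ! i)"
  unfolding programs_def
proof (intro ballI)
  fix g assume i: "i < n" and g: "g \<in> carrier G"
  let ?q = "\<lambda>x. if x ! i then g else \<one>"
  have "instruction n ?q" using i g by (auto simp: instruction_def)
  then show "\<exists>P. length P \<le> 1 \<and> (\<forall>q\<in>set P. instruction n q) \<and>
     (\<forall>x. length x = n \<longrightarrow> run P x = (if x ! i then g else \<one>))"
    using g by (intro exI[of _ "[?q]"]) (auto simp: run_def)
qed

lemma programs_const: "0 < n \<Longrightarrow> programs n 1 (\<lambda>x. c)"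
  unfolding programs_def
proof (intro ballI)
  fix g assume n: "0 < n" and g: "g \<in> carrier G"
  let ?q = "\<lambda>x. if c then g else \<one>"
  have "instruction n ?q" using instruction_const[OF n] g by simp
  then show "\<exists>P. length P \<le> 1 \<and> (\<forall>q\<in>set P. instruction n q) \<and>
     (\<forall>x. length x = n \<longrightarrow> run P x = (if c then g else \<one>))"
    using g by (intro exI[of _ "[?q]"]) (auto simp: run_def)
qed

text \<open>Run a program for \<open>f\<close> with target \<open>inv g\<close>, then multiply by
  \<open>g\<close>.\<close>

lemma programs_not:
  assumes "programs n l f" "0 < n"
  shows "programs n (l + 1) (\<lambda>x. \<not> f x)"
  unfolding programs_def
proof (intro ballI)
  fix g assume g: "g \<in> carrier G"
  then obtain P where P: "length P \<le> l" "\<forall>q\<in>set P. instruction n q"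
    "\<forall>x. length x = n \<longrightarrow> run P x = (if f x then inv g else \<one>)"
    using assms(1) unfolding programs_def by (meson inv_closed)
  have c: "\<forall>q\<in>set [\<lambda>x. g]. instruction n q" using instruction_const[OF assms(2) g] by simp
  have "run (P @ [\<lambda>x. g]) x = (if \<not> f x then g else \<one>)" if "length x = n" for x
    unfolding run_append[OF P(2) c] using P(3) that g by (auto simp: run_def)
  then show "\<exists>P. length P \<le> l + 1 \<and> (\<forall>q\<in>set P. instruction n q) \<and>
     (\<forall>x. length x = n \<longrightarrow> run P x = (if \<not> f x then g else \<one>))"
    using P c by (intro exI[of _ "P @ [\<lambda>x. g]"]) auto
qed

lemma programs_commutators:
  assumes f: "programs n l f" and f': "programs n l f'" and ps: "set ps \<subseteq> carrier G \<times> carrier G"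
  shows "\<exists>P. length P \<le> 4 * l * length ps \<and> (\<forall>q\<in>set P. instruction n q) \<and>
     (\<forall>x. length x = n \<longrightarrow> run P x = (if f x \<and> f' x then mult_list (map commutator ps) else \<one>))"
  using ps
proof (induction ps)
  case Nil
  show ?case by (rule exI[of _ "[]"]) (simp add: run_def)
next
  case (Cons p ps)
  then obtain P where P: "length P \<le> 4 * l * length ps" "\<forall>q\<in>set P. instruction n q"
     "\<forall>x. length x = n \<longrightarrow> run P x = (if f x \<and> f' x then mult_list (map commutator ps) else \<one>)"
    by auto
  obtain a b where p: "p = (a, b)" and ab: "a \<in> carrier G" "b \<in> carrier G"
    using Cons.prems by auto
  note f = f[unfolded programs_def] and f' = f'[unfolded programs_def]
  obtain A where A: "length A \<le> l" "\<forall>q\<in>set A. instruction n q"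
    "\<forall>x. length x = n \<longrightarrow> run A x = (if f x then a else \<one>)" using f ab by blast
  obtain B where B: "length B \<le> l" "\<forall>q\<in>set B. instruction n q"
    "\<forall>x. length x = n \<longrightarrow> run B x = (if f' x then b else \<one>)" using f' ab by blast
  obtain A' where A': "length A' \<le> l" "\<forall>q\<in>set A'. instruction n q"
    "\<forall>x. length x = n \<longrightarrow> run A' x = (if f x then inv a else \<one>)" using f inv_closed[OF ab(1)] by blast
  obtain B' where B': "length B' \<le> l" "\<forall>q\<in>set B'. instruction n q"
    "\<forall>x. length x = n \<longrightarrow> run B' x = (if f' x then inv b else \<one>)" using f' inv_closed[OF ab(2)] by blast
  \<comment> \<open>If one of \<open>f\<close> and \<open>f'\<close> fails, its two blocks are
    trivial, and the two blocks of the other cancel.\<close>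
  let ?P = "A @ B @ A' @ B' @ P"
  have cl: "mult_list (map commutator ps) \<in> carrier G"
    using Cons.prems by (intro mult_list_closed commutator_list_closed) simp
  have "run ?P x = run A x \<otimes> (run B x \<otimes> (run A' x \<otimes> (run B' x \<otimes> run P x)))" for x
  proof -
    have BP: "\<forall>q\<in>set (B' @ P). instruction n q" using B'(2) P(2) by auto
    have AP: "\<forall>q\<in>set (A' @ B' @ P). instruction n q" using A'(2) BP by auto
    have BAP: "\<forall>q\<in>set (B @ A' @ B' @ P). instruction n q" using B(2) AP by auto
    show ?thesis
      by (simp only: run_append[OF A(2) BAP] run_append[OF B(2) AP] run_append[OF A'(2) BP]
          run_append[OF B'(2) P(2)])
  qed
  then have "run ?P x = (if f x \<and> f' x then mult_list (map commutator (p # ps)) else \<one>)"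
    if "length x = n" for x
    using A(3) B(3) A'(3) B'(3) P(3) that ab cl
    by (cases "f x"; cases "f' x") (simp_all add: p commutator_def m_assoc)
  moreover have "length ?P \<le> 4 * l * length (p # ps)"
    using A(1) B(1) A'(1) B'(1) P(1) by simp
  ultimately show ?case using A(2) B(2) A'(2) B'(2) P(2) by (intro exI[of _ ?P]) auto
qed

text \<open>
  Barrington's construction.  For a perfect group it needs no particular group elements: a product
  of commutators of programs for \<open>f\<close> and \<open>f'\<close> is trivial unless both \<open>f\<close> and \<open>f'\<close> hold.
\<close>

lemma programs_circuit:
  "\<exists>K. \<forall>n C. 0 < n \<longrightarrow> topological n C \<longrightarrow> (\<forall>g\<in>set C. \<not> is_MajG g \<and> length (gate_args g) \<le> b) \<longrightarrow>
     (\<forall>i<length C. programs n (K ^ (gate_depths C ! i + 1)) (\<lambda>x. gate_vals x C ! i))"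
proof -
  obtain c where c: "1 \<le> c" "\<And>g. g \<in> carrier G \<Longrightarrow> \<exists>ps. set ps \<subseteq> carrier G \<times> carrier G \<and>
      length ps \<le> c \<and> mult_list (map commutator ps) = g"
    using commutator_length by auto
  have conj: "programs n (4 * c * l) (\<lambda>x. f x \<and> f' x)" if "programs n l f" "programs n l f'" for n l f f'
    unfolding programs_def
  proof (intro ballI)
    fix g assume "g \<in> carrier G"
    then obtain ps where ps: "set ps \<subseteq> carrier G \<times> carrier G" "length ps \<le> c"
      "mult_list (map commutator ps) = g" using c by blast
    have "4 * l * length ps \<le> 4 * c * l" using ps(2) by simp
    then show "\<exists>P. length P \<le> 4 * c * l \<and> (\<forall>q\<in>set P. instruction n q) \<and>
        (\<forall>x. length x = n \<longrightarrow> run P x = (if f x \<and> f' x then g else \<one>))"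
      using programs_commutators[OF that ps(1)] ps(3) by (metis (no_types, lifting) le_trans)
  qed
  have list: "programs n ((4 * c) ^ length js * l) (\<lambda>x. \<forall>j\<in>set js. F j x)"
    if "0 < n" "1 \<le> l" "\<And>j. j \<in> set js \<Longrightarrow> programs n l (F j)" for n l js and F :: "nat \<Rightarrow> bool list \<Rightarrow> bool"
    using that(3)
  proof (induction js)
    case Nil
    then show ?case using programs_mono[OF programs_const[OF that(1)], of l] that(2) by simp
  next
    case (Cons j js)
    have "1 * l \<le> (4 * c) ^ length js * l" using c(1) by (intro mult_le_mono1) simp
    then have "programs n ((4 * c) ^ length js * l) (F j)"
      using programs_mono[of n l "F j"] Cons.prems by simp
    moreover have "programs n ((4 * c) ^ length js * l) (\<lambda>x. \<forall>j\<in>set js. F j x)"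
      by (rule Cons.IH) (simp add: Cons.prems)
    ultimately have "programs n (4 * c * ((4 * c) ^ length js * l)) (\<lambda>x. F j x \<and> (\<forall>j\<in>set js. F j x))"
      by (rule conj)
    then show ?case by (simp add: mult.assoc)
  qed
  \<comment> \<open>A conjunction of \<open>b\<close> arguments costs \<open>(4 * c) ^ b\<close>.
    The further factor 4 pays for the negations when a disjunction is written by De Morgan's
    law.\<close>
  define K where "K = 4 * (4 * c) ^ b"
  have cb: "1 \<le> (4 * c) ^ b" using c(1) by simp
  have K: "2 \<le> K" using cb by (simp add: K_def)
  have all: "programs n (K * l) (\<lambda>x. \<forall>j\<in>set js. F j x)"
    "programs n (K * l) (\<lambda>x. \<exists>j\<in>set js. F j x)"
    if "0 < n" "1 \<le> l" "\<And>j. j \<in> set js \<Longrightarrow> programs n l (F j)" "length js \<le> b"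
    for n l js and F :: "nat \<Rightarrow> bool list \<Rightarrow> bool"
  proof -
    have len: "(4 * c) ^ length js \<le> (4 * c) ^ b" using that(4) c(1) by (intro power_increasing) auto
    have "(4 * c) ^ length js * l \<le> K * l" using len by (intro mult_le_mono1) (simp add: K_def)
    then show "programs n (K * l) (\<lambda>x. \<forall>j\<in>set js. F j x)"
      using programs_mono[OF list[of n l js F]] that(1-3) by blast
    have "programs n ((4 * c) ^ length js * (l + 1) + 1) (\<lambda>x. \<not> (\<forall>j\<in>set js. \<not> F j x))"
      by (intro programs_not list) (use that programs_not in auto)
    moreover have "(4 * c) ^ length js * (l + 1) + 1 \<le> K * l"
    proof -
      have "(4 * c) ^ length js * (l + 1) \<le> (4 * c) ^ b * (2 * l)"
        using len that(2) by (intro mult_le_mono) auto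
      moreover have "1 \<le> (4 * c) ^ b * l" using cb that(2) by (metis mult_le_mono nat_mult_1)
      moreover have "K * l = (4 * c) ^ b * (2 * l) + 2 * ((4 * c) ^ b * l)"
        by (simp add: K_def)
      ultimately show ?thesis by linarith
    qed
    ultimately show "programs n (K * l) (\<lambda>x. \<exists>j\<in>set js. F j x)"
      using programs_mono by fastforce
  qed
  have "programs n (K ^ (gate_depths C ! i + 1)) (\<lambda>x. gate_vals x C ! i)"
    if "0 < n" "topological n C" "\<forall>g\<in>set C. \<not> is_MajG g \<and> length (gate_args g) \<le> b" "i < length C"
    for n C i
    using that(2-)
  proof (induction C arbitrary: i rule: rev_induct)
    case (snoc g C)
    have IH: "programs n (K ^ (gate_depths C ! j + 1)) (\<lambda>x. gate_vals x C ! j)" if "j < length C" for j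
      using snoc that by (auto simp: topological_snoc)
    have args: "\<forall>j\<in>set (gate_args g). j < length C" "\<not> is_MajG g" "length (gate_args g) \<le> b"
      "\<forall>k. g = InputG k \<longrightarrow> k < n"
      using snoc.prems by (auto simp: topological_snoc)
    have gate: "programs n (K ^ (gate_depth (gate_depths C) g + 1)) (\<lambda>x. gate_val x (gate_vals x C) g)"
    proof (cases "\<exists>k. g = InputG k")
      case True
      then obtain k where "g = InputG k" "k < n" using args(4) by auto
      then show ?thesis using programs_mono[OF programs_input[of k n], of K] K by simp
    next
      case False
      define D where "D = Max (insert 0 ((\<lambda>j. gate_depths C ! j) ` set (gate_args g)))"
      have D: "gate_depth (gate_depths C) g = Suc D"
        using False by (cases g) (auto simp: D_def)
      have l: "1 \<le> K ^ (D + 1)" using K by simp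
      have IH': "programs n (K ^ (D + 1)) (\<lambda>x. gate_vals x C ! j)" if "j \<in> set (gate_args g)" for j
      proof (rule programs_mono[OF IH])
        have "gate_depths C ! j \<le> D" using that by (auto simp: D_def)
        then show "K ^ (gate_depths C ! j + 1) \<le> K ^ (D + 1)" using K by (intro power_increasing) auto
      qed (use that args in auto)
      note all' = all[OF \<open>0 < n\<close> l IH' args(3)]
      show ?thesis
      proof (cases g)
        case (NotG j)
        have "K ^ (D + 1) + 1 \<le> K * K ^ (D + 1)"
          using l mult_le_mono1[OF K, of "K ^ (D + 1)"] by linarith
        then show ?thesis
          using programs_mono[OF programs_not[OF IH'[of j] \<open>0 < n\<close>]] unfolding D by (simp add: NotG)
      next
        case (AndG js)
        then show ?thesis using all'(1) unfolding D by simp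
      next
        case (OrG js)
        then show ?thesis using all'(2) unfolding D by simp
      qed (use False args(2) in auto)
    qed
    show ?case
    proof (cases "i < length C")
      case True
      then show ?thesis using IH[of i] by (simp add: nth_append)
    next
      case False
      then have "i = length C" using snoc.prems by simp
      then show ?thesis using gate by (simp add: nth_append)
    qed
  qed simp
  then show ?thesis by blast
qed

end

lemma perfect_alt_group:
  assumes "5 \<le> n"
  shows "perfect_group (alt_group n)"
proof -
  interpret group "alt_group n" by (rule alt_group_is_group)
  show ?thesis
  proof
    have "carrier (alt_group n) \<subseteq> {p. p permutes {1..n}}" by (auto simp: alt_group_carrier)
    then show "finite (carrier (alt_group n))" by (rule finite_subset) (simp add: finite_permutations)
  qed (rule derived_alt_group_const[OF assms])
qed

lemma alt_group_nontrivial: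
  assumes "3 \<le> n"
  shows "\<exists>g\<in>carrier (alt_group n). g \<noteq> \<one>\<^bsub>alt_group n\<^esub>"
proof (rule ccontr)
  assume "\<not> ?thesis"
  then have "carrier (alt_group n) \<subseteq> {\<one>\<^bsub>alt_group n\<^esub>}" by auto
  from card_mono[OF _ this] have "fact n \<le> (2 :: nat)"
    using alt_group_card_carrier[of n] assms by simp
  moreover have "fact 3 \<le> (fact n :: nat)" using assms by (intro fact_mono_nat)
  ultimately show False by (simp add: fact_numeral)
qed


section \<open>From logarithmic to constant depth\<close>

text \<open>\<open>K ^ (c * ln n) = n ^ (c * ln K)\<close>, and the spare factor \<open>K\<close> is
  absorbed by one more factor \<open>n\<close>. Applied to circuit depth this bounds the program
  length, applied to the precision it bounds \<open>2 ^ p\<close>.\<close>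

lemma power_of_log_bound:
  fixes f :: "nat \<Rightarrow> nat" and K :: nat
  assumes "(\<lambda>n. real (f n)) \<in> O(\<lambda>n. ln (real n))" "1 \<le> K"
  shows "\<exists>e\<ge>1. \<exists>n0. \<forall>n\<ge>n0. K ^ (f n + 1) \<le> n ^ e"
proof -
  obtain c where c: "0 < c" "eventually (\<lambda>n. norm (real (f n)) \<le> c * norm (ln (real n))) sequentially"
    using assms(1) by (rule landau_o.bigE)
  then obtain n1 where n1: "\<And>n. n1 \<le> n \<Longrightarrow> norm (real (f n)) \<le> c * norm (ln (real n))"
    unfolding eventually_sequentially by blast
  define E where "E = nat \<lceil>c * ln (real K)\<rceil>"
  have "K ^ (f n + 1) \<le> n ^ (E + 1)" if "max (max n1 K) 1 \<le> n" for n
  proof -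
    have n: "n1 \<le> n" "K \<le> n" "1 \<le> n" using that by auto
    have f: "real (f n) \<le> c * ln (real n)" using n1[OF n(1)] n(3) by simp
    have lnK: "0 \<le> ln (real K)" using assms(2) by simp
    have "real K ^ f n = exp (ln (real K) * real (f n))"
      using assms(2) by (simp add: exp_of_nat2_mult)
    also have "\<dots> \<le> exp (ln (real K) * (c * ln (real n)))"
      using f lnK by (simp add: mult_left_mono)
    also have "\<dots> = exp ((c * ln (real K)) * ln (real n))" by (simp add: mult_ac)
    also have "\<dots> \<le> exp (real E * ln (real n))"
    proof -
      have "c * ln (real K) \<le> real E" unfolding E_def by linarith
      then show ?thesis using n(3) by (simp add: mult_right_mono)
    qed
    also have "\<dots> = real n ^ E" using n(3) by (simp add: exp_of_nat_mult)
    finally have "real (K ^ f n) \<le> real (n ^ E)" by simp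
    then have "K ^ f n \<le> n ^ E" by (simp only: of_nat_le_iff)
    then show ?thesis using n(2) mult_le_mono[OF n(2)] by simp
  qed
  then have "\<forall>n\<ge>max (max n1 K) 1. K ^ (f n + 1) \<le> n ^ (E + 1)" by blast
  then show ?thesis by (metis le_add2)
qed

lemma polynomial_bound:
  fixes f :: "nat \<Rightarrow> nat"
  assumes "(\<lambda>n. real (f n)) \<in> O(\<lambda>n. real n ^ k)"
  shows "\<exists>n0. \<forall>n\<ge>n0. f n \<le> n ^ (k + 1)"
proof -
  obtain c where c: "0 < c" "eventually (\<lambda>n. norm (real (f n)) \<le> c * norm (real n ^ k)) sequentially"
    using assms by (rule landau_o.bigE)
  then obtain n1 where n1: "\<And>n. n1 \<le> n \<Longrightarrow> norm (real (f n)) \<le> c * norm (real n ^ k)"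
    unfolding eventually_sequentially by blast
  have "f n \<le> n ^ (k + 1)" if "max n1 (nat \<lceil>c\<rceil>) \<le> n" for n
  proof -
    have "real (f n) \<le> c * real n ^ k" using n1[of n] that by simp
    also have "\<dots> \<le> real n * real n ^ k" using that by (intro mult_right_mono) (linarith, simp)
    finally have "real (f n) \<le> real (n ^ (k + 1))" by simp
    then show ?thesis by (simp only: of_nat_le_iff)
  qed
  then show ?thesis by blast
qed

lemma feat_input:
  assumes "2 \<le> N" "j < n"
  shows "feat n N 2 (\<lambda>x. x ! j)"
proof -
  have t: "tc n N 0 (\<lambda>x. x ! j)" by (rule tc_input[OF assms])
  have "tc n N 2 (\<lambda>x. x ! j = v)" for v
    using tc_not[OF t] tc_mono[OF t, of 2] by (cases v) (simp_all add: numeral_2_eq_2)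
  moreover have "card (UNIV :: bool set) \<le> N ^ 2"
    using power_mono[OF assms(1), of 2] by simp
  ultimately show ?thesis unfolding feat_def using assms(1) by (auto intro!: exI[of _ UNIV])
qed

lemma wf_circuit_topological: "wf_circuit n C \<Longrightarrow> topological n C \<and> C \<noteq> []"
  by (simp add: wf_circuit_def topological_def)

lemma circuit_eval_nth: "C \<noteq> [] \<Longrightarrow> circuit_eval C x = gate_vals x C ! (length C - 1)"
proof -
  assume "C \<noteq> []"
  then have "gate_vals x C \<noteq> []" by (metis length_0_conv length_gate_vals)
  then show ?thesis by (simp add: circuit_eval_def gate_vals_def[symmetric] last_conv_nth)
qed

lemma gate_depths_le: "i < length C \<Longrightarrow> gate_depths C ! i \<le> circuit_depth C"
  unfolding circuit_depth_def gate_depths_def[symmetric]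
  by (intro Max_ge) auto

text \<open>
  A circuit of logarithmic depth turns into a word of polynomial length over the alternating group,
  each letter of which depends on one input bit.  Finitely many input lengths, at which the
  asymptotic bounds may fail, keep their original circuit.
\<close>

lemma NC1_subset_TC0:
  fixes rnd :: "nat \<Rightarrow> real \<Rightarrow> real"
  assumes rounding: "\<And>p. rounding p (rnd p)" and m: "5 \<le> m"
    and p: "(\<lambda>n. real (p n)) \<in> O(\<lambda>n. ln (real n))"
    and d: "(\<lambda>n. real (d n)) \<in> O(\<lambda>n. real n ^ k)"
    and fam: "mhm_family V L p d M"
    and solves: "solves_word_problem (sym_group m) V rnd p M (\<lambda>n. 1)"
  shows "NC1 \<subseteq> TC0"
proof
  fix A assume "A \<in> NC1"
  then obtain C0 b where C0: "computed_by C0 A" "polynomial_size C0"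
    "(\<lambda>n. real (circuit_depth (C0 n))) \<in> O(\<lambda>n. ln (real n))"
    "\<forall>n. \<forall>g\<in>set (C0 n). \<not> is_MajG g" "\<forall>n. \<forall>g\<in>set (C0 n). length (gate_args g) \<le> b"
    unfolding NC1_def by blast
  interpret perfect_group "alt_group m" by (rule perfect_alt_group[OF m])
  obtain h where h: "h \<in> carrier (alt_group m)" "h \<noteq> \<one>\<^bsub>alt_group m\<^esub>"
    using alt_group_nontrivial[of m] m by auto
  have carrier_sub: "carrier (alt_group m) \<subseteq> carrier (sym_group m)"
    by (auto simp: alt_group_carrier sym_group_carrier)
  obtain K where K: "\<And>n C i. 0 < n \<Longrightarrow> topological n C \<Longrightarrow>
      \<forall>g\<in>set C. \<not> is_MajG g \<and> length (gate_args g) \<le> b \<Longrightarrow> i < length C \<Longrightarrow>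
      programs n (K ^ (gate_depths C ! i + 1)) (\<lambda>x. gate_vals x C ! i)"
    using programs_circuit[of b] by blast
  \<comment> \<open>The base is \<open>K + 1\<close> because \<open>power_of_log_bound\<close> wants
    a base of at least 1.\<close>
  obtain e n1 where e: "1 \<le> e" and n1: "\<And>n. n1 \<le> n \<Longrightarrow> (K + 1) ^ (circuit_depth (C0 n) + 1) \<le> n ^ e"
    using power_of_log_bound[OF C0(3), of "K + 1"] by auto
  obtain e2 n2 where n2: "\<And>n. n2 \<le> n \<Longrightarrow> 2 ^ (p n + 1) \<le> n ^ e2"
    using power_of_log_bound[OF p, of 2] by auto
  obtain n3 where n3: "\<And>n. n3 \<le> n \<Longrightarrow> d n \<le> n ^ (k + 1)"
    using polynomial_bound[OF d] by blast
  obtain enc yes no where enc: "yes \<noteq> no"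
    "\<forall>n\<ge>1. cot_defined (M n) 1 n \<and> (\<forall>fs. length fs = n \<and> set fs \<subseteq> carrier (sym_group m) \<longrightarrow>
      mhm_cot (rnd (p n)) (M n) 1 (map enc fs) =
        (if fs \<in> word_problem (sym_group m) then yes else no))"
    using solves unfolding solves_word_problem_def by blast
  then have model: "cot_defined (M n) 1 n"
    "length fs = n \<Longrightarrow> set fs \<subseteq> carrier (sym_group m) \<Longrightarrow> mhm (rnd (p n)) (M n) (map enc fs) =
        (if fs \<in> word_problem (sym_group m) then yes else no)" if "1 \<le> n" for n fs
    using that by auto
  \<comment> \<open>One exponent for all bounds: with \<open>w = n ^ e\<close>, each of
    \<open>w\<close>, \<open>2 ^ p w \<le> w ^ e2\<close> and \<open>d w \<le> w ^ (k + 1)\<close>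
    is at most \<open>n ^ a\<close>. The level 11 in \<open>lv\<close> is \<open>3 * 2 + 5\<close>,
    that of a table lookup on one input bit.\<close>
  define a where "a = e * (e2 + k + 1)"
  define lv where "lv = simulation.mhm_level a L 11"
  define n0 where "n0 = n1 + n2 + n3 + V + 2"
  have main: "\<exists>C. wf_circuit n C \<and> circuit_depth C \<le> Suc lv \<and> circuit_size C \<le> n ^ lv + 2 \<and>
      (\<forall>x. length x = n \<longrightarrow> circuit_eval C x = (x \<in> A))" if n: "n0 \<le> n" for n
  proof -
    have n': "0 < n" "2 \<le> n" "n1 \<le> n" "V \<le> n" using n by (auto simp: n0_def)
    define w where "w = n ^ e"
    have "n ^ 1 \<le> n ^ e" using n' e by (intro power_increasing) auto
    then have w: "n \<le> w" "1 \<le> w" "n2 \<le> w" "n3 \<le> w" using n by (auto simp: w_def n0_def)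
    have C: "topological n (C0 n)" "C0 n \<noteq> []" "\<And>x. length x = n \<Longrightarrow> x \<in> A \<longleftrightarrow> circuit_eval (C0 n) x"
      using C0(1) wf_circuit_topological unfolding computed_by_def by auto
    have "programs n (K ^ (gate_depths (C0 n) ! (length (C0 n) - 1) + 1))
        (\<lambda>x. gate_vals x (C0 n) ! (length (C0 n) - 1))"
      by (rule K) (use n' C C0 in auto)
    moreover have "K ^ (gate_depths (C0 n) ! (length (C0 n) - 1) + 1) \<le> w"
    proof -
      have "K ^ (gate_depths (C0 n) ! (length (C0 n) - 1) + 1) \<le>
          (K + 1) ^ (gate_depths (C0 n) ! (length (C0 n) - 1) + 1)" by (intro power_mono) auto
      also have "\<dots> \<le> (K + 1) ^ (circuit_depth (C0 n) + 1)"
        using gate_depths_le[of "length (C0 n) - 1" "C0 n"] C(2) by (intro power_increasing) auto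
      also have "\<dots> \<le> w" using n1[OF n'(3)] by (simp add: w_def)
      finally show ?thesis .
    qed
    ultimately have "programs n w (\<lambda>x. circuit_eval (C0 n) x)"
      unfolding circuit_eval_nth[OF C(2)] by (rule programs_mono)
    then obtain P where P: "length P \<le> w" "\<forall>q\<in>set P. instruction n q"
      "\<forall>x. length x = n \<longrightarrow> run P x = (if circuit_eval (C0 n) x then h else \<one>\<^bsub>alt_group m\<^esub>)"
      unfolding programs_def using h(1) by blast
    \<comment> \<open>The model for length \<open>w\<close> is known to be correct on words of
      exactly \<open>w\<close> letters, so the program is padded with trivial instructions.\<close>
    define Q where "Q = P @ replicate (w - length P) (\<lambda>x. \<one>\<^bsub>alt_group m\<^esub>)"
    have Q: "length Q = w" "\<forall>q\<in>set Q. instruction n q"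
      using P instruction_const[OF n'(1) one_closed] by (auto simp: Q_def)
    have "run (replicate l (\<lambda>x. \<one>\<^bsub>alt_group m\<^esub>)) x = \<one>\<^bsub>alt_group m\<^esub>" for l x
      by (induction l) (auto simp: run_def)
    then have "run Q x = run P x" for x
      using run_append[OF P(2), of "replicate (w - length P) (\<lambda>x. \<one>\<^bsub>alt_group m\<^esub>)" x]
        instruction_const[OF n'(1) one_closed] run_closed[OF P(2)] by (auto simp: Q_def)
    then have runQ: "run Q x = \<one>\<^bsub>alt_group m\<^esub> \<longleftrightarrow> x \<notin> A" if "length x = n" for x
      using P(3) C(3) h(2) that by auto
    define X where "X x = map enc (map (\<lambda>q. q x) Q)" for x
    \<comment> \<open>The answers are swapped: for \<open>x \<in> A\<close> the word multiplies to
      \<open>h\<close>, which is not the identity.\<close>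
    have out: "mhm (rnd (p w)) (M w) (X x) = no \<longleftrightarrow> x \<in> A" if "length x = n" for x
    proof -
      have sub: "set (map (\<lambda>q. q x) Q) \<subseteq> carrier (sym_group m)"
        using Q(2) instruction_closed[of n _ x] carrier_sub by auto
      have "foldr (\<otimes>\<^bsub>sym_group m\<^esub>) (map (\<lambda>q. q x) Q) \<one>\<^bsub>sym_group m\<^esub> = run Q x"
        by (simp add: run_def alt_group_mult sym_group_mult alt_group_one sym_group_one)
      then have "map (\<lambda>q. q x) Q \<in> word_problem (sym_group m) \<longleftrightarrow> x \<notin> A"
        using sub runQ[OF that] by (simp add: word_problem_def alt_group_one sym_group_one)
      then show ?thesis
        using model(2)[OF w(2) _ sub] enc(1) Q(1) unfolding X_def by (auto split: if_splits)
    qed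
    have pw: "2 ^ p w \<le> n ^ a"
    proof -
      have "2 ^ p w \<le> (2::nat) ^ (p w + 1)" by simp
      also have "\<dots> \<le> n ^ (e * e2)" using n2[OF w(3)] by (simp add: w_def power_mult)
      also have "\<dots> \<le> n ^ a" unfolding a_def using n' by (intro power_increasing mult_le_mono2) auto
      finally show ?thesis .
    qed
    have dw: "d w \<le> n ^ a"
    proof -
      have "d w \<le> n ^ (e * (k + 1))" using n3[OF w(4)] by (simp only: w_def power_mult)
      also have "\<dots> \<le> n ^ a" unfolding a_def using n' by (intro power_increasing mult_le_mono2) auto
      finally show ?thesis .
    qed
    have wa: "w \<le> n ^ a" unfolding w_def a_def using n' by (intro power_increasing) auto
    have fam': "wf_mhm (p w) (M w)" "vocab (M w) = V" "embed_dim (M w) = d w" "length (layers (M w)) \<le> L"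
      using fam w(2) unfolding mhm_family_def by auto
    interpret simulation n n a "p w" "rnd (p w)"
      by standard (use n' pw rounding in auto)
    have "tc n n (mhm_level L 11) (\<lambda>x. mhm (rnd (p w)) (M w) (X x) = no)"
    proof (rule tc_mhm[OF fam'(1)])
      show "w \<le> max_len (M w)" using model(1)[OF w(2)] by (simp add: cot_defined_def)
      show "feat n n 11 (\<lambda>x. X x ! i)" if "i < w" for i
      proof -
        have "instruction n (Q ! i)" using Q that by auto
        then obtain j g g' where j: "j < n" "Q ! i = (\<lambda>x. if x ! j then g else g')"
          unfolding instruction_def by blast
        have "feat n n (3 * 2 + 5) (\<lambda>x. enc (if x ! j then g else g'))"
          by (rule feat_map[OF feat_input[OF n'(2) j(1)], of "\<lambda>c. enc (if c then g else g')"])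
        then show ?thesis using that Q(1) j by (simp add: X_def)
      qed
    qed (use fam' dw wa w n' Q in \<open>auto simp: X_def\<close>)
    then have "tc n n lv (\<lambda>x. x \<in> A)"
      unfolding lv_def by (rule tc_cong) (rule out)
    then have "computes n lv (n ^ lv) (\<lambda>x. x \<in> A)" by (simp add: tc_def)
    from computes_imp_circuit[OF this] show ?thesis .
  qed
  then obtain C1 where C1: "\<And>n. n0 \<le> n \<Longrightarrow> wf_circuit n (C1 n) \<and> circuit_depth (C1 n) \<le> Suc lv \<and>
      circuit_size (C1 n) \<le> n ^ lv + 2 \<and> (\<forall>x. length x = n \<longrightarrow> circuit_eval (C1 n) x = (x \<in> A))"
    by metis
  define C where "C n = (if n < n0 then C0 n else C1 n)" for n
  have "computed_by C A"
    using C0(1) C1 unfolding computed_by_def C_def by (auto simp: not_less)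
  moreover have "polynomial_size C"
    unfolding polynomial_size_def
  proof (rule exI[of _ lv], rule landau_o.bigI[of 3])
    show "eventually (\<lambda>n. norm (real (circuit_size (C n))) \<le> 3 * norm (real n ^ lv)) sequentially"
      using eventually_ge_at_top[of "max n0 1"]
    proof eventually_elim
      case (elim n)
      then have "circuit_size (C n) \<le> n ^ lv + 2" using C1[of n] by (simp add: C_def)
      moreover have "1 \<le> n ^ lv" using elim by simp
      ultimately have "circuit_size (C n) \<le> 3 * n ^ lv" by linarith
      then have "real (circuit_size (C n)) \<le> real (3 * n ^ lv)" by (simp only: of_nat_le_iff)
      then show ?case by simp
    qed
  qed simp
  moreover have "circuit_depth (C n) \<le> Suc lv + (\<Sum>i<n0. circuit_depth (C0 i))" for n
    using C1[of n] member_le_sum[of n "{..<n0}" "\<lambda>i. circuit_depth (C0 i)"]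
    by (cases "n < n0") (auto simp: C_def)
  ultimately show "A \<in> TC0" unfolding TC0_def by blast
qed


section \<open>Solving the word problem with chain of thought\<close>

lemma fp_pow2:
  assumes "1 \<le> p" "- (2 ^ p) + (int p - 1) \<le> k" "k < 2 ^ p"
  shows "2 powi k \<in> fp p" "- (2 powi k) \<in> fp p"
proof -
  have eq: "(2::real) powi k = of_int (2 ^ (p - 1)) * 2 powi (k - (int p - 1))"
    using assms(1) by (simp add: of_nat_diff power_int_diff flip: power_int_of_nat)
  have lt: "(2::int) ^ (p - 1) < 2 ^ p" using assms(1) by (intro power_strict_increasing) auto
  have "(2::real) powi k = of_int (2 ^ (p - 1)) * 2 powi (k - (int p - 1)) \<and>
      2 ^ (p - 1) \<in> {- (2 ^ p) <.. - (2 ^ (p - 1))} \<union> {0} \<union> {2 ^ (p - 1) ..< (2::int) ^ p} \<and>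
      k - (int p - 1) \<in> {- (2 ^ p) ..< 2 ^ p}"
    using eq lt assms by simp
  then show "2 powi k \<in> fp p" unfolding fp_def by blast
  have "- ((2::real) powi k) = of_int (- (2 ^ (p - 1))) * 2 powi (k - (int p - 1)) \<and>
      - (2 ^ (p - 1)) \<in> {- (2 ^ p) <.. - (2 ^ (p - 1))} \<union> {0} \<union> {2 ^ (p - 1) ..< (2::int) ^ p} \<and>
      k - (int p - 1) \<in> {- (2 ^ p) ..< 2 ^ p}"
    using eq lt assms by simp
  then show "- (2 powi k) \<in> fp p" unfolding fp_def by blast
qed

lemma fp_zero: "0 \<in> fp p"
proof -
  have "(0::real) = of_int 0 * 2 powi 0 \<and>
      0 \<in> {- (2 ^ p) <.. - (2 ^ (p - 1))} \<union> {0} \<union> {2 ^ (p - 1) ..< (2::int) ^ p} \<and>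
      (0::int) \<in> {- (2 ^ p) ..< 2 ^ p}" by simp
  then show ?thesis unfolding fp_def by blast
qed

lemma fp8_values [simp]:
  "0 \<in> fp 8" "1 \<in> fp 8" "-1 \<in> fp 8" "2 \<in> fp 8" "-2 \<in> fp 8" "1 / 2 \<in> fp 8" "- (1 / 2) \<in> fp 8"
  "-256 \<in> fp 8" "-512 \<in> fp 8"
  using fp_zero fp_pow2[of 8 0] fp_pow2[of 8 1] fp_pow2[of 8 "-1"] fp_pow2[of 8 8] fp_pow2[of 8 9]
  by (simp_all add: power_int_minus field_simps)

text \<open>The smallest positive float is \<open>2 ^ 7 * 2 powi (- 256)\<close>, whereas
  \<open>exp s\<close> is at most \<open>2 powi (- 256)\<close>, so zero is nearer.\<close>

lemma rounding_underflow:
  assumes r: "rounding 8 r" and "s \<le> - 256"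
  shows "r (exp s) = 0"
proof (rule ccontr)
  assume nz: "r (exp s) \<noteq> 0"
  have "(2::real) ^ 256 \<le> exp 1 ^ 256"
    using exp_ge_add_one_self[of 1] by (intro power_mono) auto
  also have "\<dots> = exp 256" using exp_of_nat_mult[of 256 "1::real"] by simp
  also have "\<dots> \<le> exp (- s)" using assms(2) by simp
  finally have s: "exp s \<le> 1 / 2 ^ 256" by (simp add: exp_minus field_simps)
  have near: "\<bar>exp s - r (exp s)\<bar> \<le> \<bar>exp s - 0\<bar>"
    using r fp_zero unfolding rounding_def by blast
  then have up: "r (exp s) \<le> 2 * exp s" "0 \<le> r (exp s)" by auto
  obtain a e :: int where ae: "r (exp s) = of_int a * 2 powi e"
    "a \<in> {- (2 ^ 8) <.. - (2 ^ (8 - 1))} \<union> {0} \<union> {2 ^ (8 - 1) ..< 2 ^ 8}" "- (2 ^ 8) \<le> e"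
    using rounding_in[OF r, of "exp s"] unfolding fp_def by auto
  have "0 < a"
  proof (rule ccontr)
    assume "\<not> 0 < a"
    moreover have "(0::real) < 2 powi e" by simp
    ultimately have "r (exp s) \<le> 0" unfolding ae(1) by (simp add: mult_le_0_iff)
    then show False using up(2) nz by simp
  qed
  then have "128 \<le> a" using ae(2) by auto
  moreover have "(2::real) powi (- 256) \<le> 2 powi e" using ae(3) by (intro power_int_increasing) auto
  ultimately have "128 * 2 powi (- 256) \<le> r (exp s)" unfolding ae(1) by (intro mult_mono) auto
  moreover have "(2::real) powi (- 256) = 1 / 2 ^ 256"
    using power_int_minus[of "2::real" 256] by (simp only: power_int_numeral divide_inverse mult_1)
  moreover have "(0::real) < 1 / 2 ^ 256" by simp
  ultimately show False using up(1) s by linarith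
qed

text \<open>Rounding disappears when all products and their sum are floats. The constants of the
  model are chosen such that this covers the dot products evaluated below, except for the attention
  scores.\<close>

lemma fp_dot_exact:
  assumes r: "rounding p r" and "dim_vec v = d" and "\<And>k. k < d \<Longrightarrow> u $ k * v $ k \<in> fp p"
    and "(\<Sum>k<d. u $ k * v $ k) = y" and "y \<in> fp p"
  shows "fp_dot r u v = y"
proof -
  have "(\<Sum>k<d. r (u $ k * v $ k)) = y"
    unfolding assms(4)[symmetric] using assms(3) rounding_fp[OF r] by (intro sum.cong) auto
  then show ?thesis using assms(2,5) rounding_fp[OF r] by (simp add: fp_dot_def)
qed

lemma fp_mat_mult_one:
  assumes r: "rounding p r" and A: "A \<in> carrier_mat l d"
    and fp: "\<And>i k. i < l \<Longrightarrow> k < d \<Longrightarrow> A $$ (i, k) \<in> fp p"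
  shows "fp_mat_mult r A (1\<^sub>m d) = A"
proof (rule eq_matI)
  fix i j assume ij: "i < dim_row A" "j < dim_col A"
  have "fp_dot r (row A i) (col (1\<^sub>m d) j) = A $$ (i, j)"
    using A fp ij fp_zero
    by (intro fp_dot_exact[OF r, where d = d]) (auto simp: if_distrib cong: if_cong)
  then show "fp_mat_mult r A (1\<^sub>m d) $$ (i, j) = A $$ (i, j)"
    using A ij by (simp add: fp_mat_mult_def)
qed (use A in \<open>auto simp: fp_mat_mult_def\<close>)

lemma fp_mat_vec_one:
  assumes r: "rounding p r" and v: "v \<in> carrier_vec d" and fp: "\<And>k. k < d \<Longrightarrow> v $ k \<in> fp p"
  shows "fp_mat_vec r (1\<^sub>m d) v = v"
proof (rule eq_vecI)
  fix i assume i: "i < dim_vec v"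
  have "fp_dot r (row (1\<^sub>m d) i) v = v $ i"
    using v fp i fp_zero
    by (intro fp_dot_exact[OF r, where d = d]) (auto simp: if_distrib[of "\<lambda>c. c * _"] cong: if_cong)
  then show "fp_mat_vec r (1\<^sub>m d) v $ i = v $ i" using v i by (simp add: fp_mat_vec_def)
qed (use v in \<open>auto simp: fp_mat_vec_def\<close>)

text \<open>
  Scores that are either \<open>0\<close> or at most \<open>-256\<close> make the softmax uniform on the zeros, since the
  other exponentials underflow.
\<close>

lemma fp_softmax_hard:
  assumes r: "rounding 8 r" and v: "dim_vec v = l" and J: "J \<subseteq> {..<l}" "card J = c" "c = 1 \<or> c = 2"
    and zero: "\<And>j. j \<in> J \<Longrightarrow> v $ j = 0" and low: "\<And>j. j < l \<Longrightarrow> j \<notin> J \<Longrightarrow> v $ j \<le> - 256"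
    and i: "i < l"
  shows "fp_softmax r v $ i = (if i \<in> J then 1 / real c else 0)"
proof -
  have e: "r (exp (v $ j)) = (if j \<in> J then 1 else 0)" if "j < l" for j
    using zero low[OF that] rounding_underflow[OF r] rounding_fp[OF r, of 1] by auto
  have "(\<Sum>j<l. r (exp (v $ j))) = (\<Sum>j<l. if j \<in> J then 1 else 0)" using e by (intro sum.cong) auto
  also have "\<dots> = real c" using J(1,2) by (simp add: sum.If_cases Int_absorb1)
  finally have "r (\<Sum>j<l. r (exp (v $ j))) = real c"
    using J(3) rounding_fp[OF r, of 1] rounding_fp[OF r, of 2] by auto
  then show ?thesis
    using e[OF i] i v J(3) rounding_fp[OF r, of 1] rounding_fp[OF r, of "1 / 2"] rounding_fp[OF r, of 0]
    by (auto simp: fp_softmax_def)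
qed

text \<open>
  Tokens: \<open>0, \<dots>, m - 1\<close> for the group elements \<open>g 0, \<dots>, g (m - 1)\<close>, then \<open>m, \<dots>, 2 m - 1\<close> for the
  same elements as states, i.e. partial products, then \<open>2 m\<close> for yes and \<open>2 m + 1\<close> for no.
  At step \<open>i\<close>, the last position
  \<open>n + i - 1\<close> attends to position \<open>i\<close>, which holds the \<open>i\<close>-th letter, and to itself, which holds the
  state (at step 1, the state \<open>g e\<close> is supplied by the encoding of position 1).
  Coordinates: \<open>m\<close> for the letter, \<open>m\<close> for the state, two that tell whether the letter is the last
  one, then \<open>2 l\<close> for the query and \<open>2 l\<close> for the key, both coding positions in binary.
  The coordinates \<open>u < 2 m * m\<close> of the hidden layer stand for the triples of a letter
  \<open>u div (2 m)\<close>, a state \<open>u mod (2 m) div 2\<close> and a flag \<open>u mod 2\<close>.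
\<close>

locale word_model = group G for G (structure) +
  fixes m e n l :: nat and g :: "nat \<Rightarrow> 'a" and r :: "real \<Rightarrow> real"
  assumes g: "bij_betw g {..<m} (carrier G)" and e: "e < m" "g e = \<one>"
    and n: "1 \<le> n" "n < 2 ^ l"
    and rounding: "rounding 8 r"
begin

definition idx :: "'a \<Rightarrow> nat" where
  "idx a = the_inv_into {..<m} g a"

text \<open>The feed-forward matrices are square, so one dimension has to hold both the
  \<open>2 * m * m\<close> hidden units and the \<open>2 * m + 2 + 4 * l\<close> input
  coordinates.\<close>

definition dim :: nat where
  "dim = 2 * m * m + 2 * m + 2 + 4 * l"

definition query_pos :: "nat \<Rightarrow> nat" where
  "query_pos j = j - n + 1"

text \<open>The state for step \<open>i \<ge> 2\<close> is the token at position
  \<open>n + i - 1 > n\<close>, so it gets the key \<open>i\<close>, like the letter at position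
  \<open>i\<close>. No third position has this key, and the key 1 belongs to position 1
  alone.\<close>

definition key_pos :: "nat \<Rightarrow> nat" where
  "key_pos j = (if j \<le> n then j else j - n + 1)"

text \<open>Bit \<open>s\<close> has the coordinates \<open>2 * s\<close> and
  \<open>2 * s + 1\<close>, one for each value. A query marks the value of its bit by 1 and a key
  penalises the opposite of its own by -256, so the inner product is -256 times the number of
  differing bits.\<close>

definition query_bit :: "nat \<Rightarrow> nat \<Rightarrow> real" where
  "query_bit i t = (if odd (i div 2 ^ (t div 2)) = odd t then 1 else 0)"

definition key_bit :: "nat \<Rightarrow> nat \<Rightarrow> real" where
  "key_bit i t = (if odd (i div 2 ^ (t div 2)) = odd t then 0 else - 256)"

definition token_coord :: "nat \<Rightarrow> nat \<Rightarrow> real" where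
  "token_coord x k = (if x < 2 * m \<and> k = x then 1 else 0)"

definition pos_coord :: "nat \<Rightarrow> nat \<Rightarrow> real" where
  "pos_coord j k =
     (if k < 2 * m then if j = 1 \<and> k = m + e then 1 else 0
      else if k = 2 * m then if j < n then 1 else 0
      else if k = 2 * m + 1 then if j = n then 1 else 0
      else if k < 2 * m + 2 + 2 * l then query_bit (query_pos j) (k - (2 * m + 2))
      else if k < 2 * m + 2 + 4 * l then key_bit (key_pos j) (k - (2 * m + 2 + 2 * l))
      else 0)"

text \<open>Shifts the query block onto the key block and erases everything else. With an identity
  for \<open>WK\<close>, queries then meet keys, and letters and states stay out of the
  scores.\<close>

definition query_coord :: "nat \<Rightarrow> nat \<Rightarrow> real" where
  "query_coord a b = (if 2 * m + 2 \<le> a \<and> a < 2 * m + 2 + 2 * l \<and> b = a + 2 * l then 1 else 0)"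

text \<open>Unit \<open>u\<close> receives 1 for its letter, 1 for its state, and -1 or -2 for the
  right or wrong flag, so it is positive for its own triple only. The flag acts as the bias: unlike
  an entry of \<open>b1\<close>, it is scaled by the attention weight together with the other
  summands.\<close>

definition hidden_coord :: "nat \<Rightarrow> nat \<Rightarrow> real" where
  "hidden_coord u k =
     (if 2 * m * m \<le> u then 0
      else if k < m then if k = u div (2 * m) then 1 else 0
      else if k < 2 * m then if k - m = u mod (2 * m) div 2 then 1 else 0
      else if k < 2 * m + 2 then if k = 2 * m + u mod 2 then - 1 else - 2
      else 0)"

definition target :: "nat \<Rightarrow> nat" where
  "target u =
     (let a = g (u mod (2 * m) div 2) \<otimes> g (u div (2 * m))
      in if even u then m + idx a else if a = \<one> then 2 * m else 2 * m + 1)"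

text \<open>Halved by attention, -512 is still a logit of -256, whose exponential
  underflows.\<close>

definition output_coord :: "nat \<Rightarrow> nat \<Rightarrow> real" where
  "output_coord t u = (if u < 2 * m * m \<and> t \<noteq> target u then - 512 else 0)"

definition attention :: decoder_layer where
  "attention = \<lparr>WQ = mat dim dim (\<lambda>(a, b). query_coord a b), WK = 1\<^sub>m dim, WV = StandAlone (1\<^sub>m dim),
     beta = 1, W1 = mat dim dim (\<lambda>(u, k). hidden_coord u k), b1 = 0\<^sub>v dim, W2 = 1\<^sub>m dim, b2 = 0\<^sub>v dim\<rparr>"

text \<open>For \<open>n \<ge> 2\<close>, \<open>cot_defined\<close> with \<open>n\<close> steps
  asks for \<open>n + n < max_len\<close>.\<close>

definition model :: mhm_model where
  "model = \<lparr>vocab = 2 * m + 2, max_len = 2 * n + 1, embed_dim = dim,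
     token_enc = (\<lambda>x. vec dim (token_coord x)), pos_enc = (\<lambda>j. vec dim (pos_coord j)),
     layers = [attention], output_mat = mat (2 * m + 2) dim (\<lambda>(t, u). output_coord t u)\<rparr>"

lemma attention_simps:
  shows b1_attention: "b1 attention = 0\<^sub>v dim" and b2_attention: "b2 attention = 0\<^sub>v dim"
    and W2_attention: "W2 attention = 1\<^sub>m dim"
  by (simp_all add: attention_def)

lemma m_pos: "0 < m"
  using e by simp

lemma idx: "a \<in> carrier G \<Longrightarrow> idx a < m" "a \<in> carrier G \<Longrightarrow> g (idx a) = a"
  using g the_inv_into_into[of g "{..<m}" a "{..<m}"] f_the_inv_into_f[of g "{..<m}" a]
  unfolding idx_def bij_betw_def by auto

lemma wf_model: "wf_mhm 8 model"
proof -
  have "query_bit i t \<in> fp 8" "key_bit i t \<in> fp 8" for i t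
    by (auto simp: query_bit_def key_bit_def)
  then have "pos_coord j k \<in> fp 8" for j k by (auto simp: pos_coord_def)
  moreover have "token_coord x k \<in> fp 8" "query_coord a b \<in> fp 8" "hidden_coord u k \<in> fp 8"
    "output_coord t u \<in> fp 8" for x k a b u t
    by (auto simp: token_coord_def query_coord_def hidden_coord_def output_coord_def)
  ultimately show ?thesis
    by (auto simp: wf_mhm_def wf_layer_def model_def attention_def fp_carrier_vec_def
        fp_carrier_mat_def one_mat_def)
qed

lemma pos_coord_query: "t < 2 * l \<Longrightarrow> pos_coord j (2 * m + 2 + t) = query_bit (query_pos j) t"
  by (simp add: pos_coord_def)

lemma pos_coord_key: "t < 2 * l \<Longrightarrow> pos_coord j (2 * m + 2 + 2 * l + t) = key_bit (key_pos j) t"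
  by (simp add: pos_coord_def)

lemma token_coord_high: "2 * m \<le> k \<Longrightarrow> token_coord x k = 0"
  by (simp add: token_coord_def)

definition prefix_tokens :: "'a list \<Rightarrow> nat \<Rightarrow> nat list" where
  "prefix_tokens fs i = map idx fs @ map (\<lambda>j. m + idx (foldl (\<otimes>) \<one> (take j fs))) [1..<i]"

section \<open>Comparing positions in binary\<close>

lemma query_key_match: "query_bit i t * key_bit i t = 0"
  by (simp add: query_bit_def key_bit_def)

lemma query_key_le: "query_bit i t * key_bit j t = 0 \<or> query_bit i t * key_bit j t = - 256"
  by (simp add: query_bit_def key_bit_def)

lemma query_key_mismatch:
  assumes "i < 2 ^ l" "j < 2 ^ l" "i \<noteq> j"
  shows "\<exists>t<2 * l. query_bit i t * key_bit j t = - 256"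
proof (rule ccontr)
  assume no: "\<not> ?thesis"
  have "i div 2 ^ s mod 2 = j div 2 ^ s mod 2" if "s < l" for s
  proof (rule ccontr)
    assume "i div 2 ^ s mod 2 \<noteq> j div 2 ^ s mod 2"
    then have neq: "odd (i div 2 ^ s) \<noteq> odd (j div 2 ^ s)" by (auto simp: odd_iff_mod_2_eq_one)
    \<comment> \<open>Of the two coordinates of bit \<open>s\<close>, the one that the query of
      \<open>i\<close> marks.\<close>
    define t where "t = 2 * s + (if odd (i div 2 ^ s) then 1 else 0)"
    have t: "t div 2 = s" "odd t = odd (i div 2 ^ s)" "t < 2 * l" using that by (auto simp: t_def)
    have "query_bit i t * key_bit j t = - 256"
      using neq t unfolding query_bit_def key_bit_def by auto
    then show False using no t(3) by blast
  qed
  then have "(\<Sum>s<l. (i div 2 ^ s mod 2) * 2 ^ s) = (\<Sum>s<l. (j div 2 ^ s mod 2) * 2 ^ s)"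
    by (intro sum.cong) auto
  then show False using assms by (simp add: sum_binary_digits)
qed

section \<open>A single step: the letter \<open>f\<close> is read in the state
  \<open>s\<close>\<close>

context
  fixes xs :: "nat list" and i f s :: nat
  assumes i: "1 \<le> i" "i \<le> n" and len: "length xs = n + i - 1"
    and letter: "xs ! (i - 1) = f" "f < m" "xs ! 0 < m"
    and state: "i = 1 \<Longrightarrow> s = e" "2 \<le> i \<Longrightarrow> xs ! (n + i - 2) = m + s" and s: "s < m"
begin

abbreviation "T \<equiv> n + i - 1"

definition coord :: "nat \<Rightarrow> nat \<Rightarrow> real" where
  "coord j k = token_coord (xs ! j) k + pos_coord (Suc j) k"

definition flag :: nat where
  "flag = (if i = n then 1 else 0)"

definition matches :: "nat set" where
  "matches = (if i = 1 then {0} else {i - 1, T - 1})"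

definition weight :: real where
  "weight = (if i = 1 then 1 else 1 / 2)"

text \<open>Tokens and positions write to disjoint coordinates, except that position 1 writes the
  state \<open>e\<close>. The token there is a letter, so no two ones are added.\<close>

lemma coord_values: "coord j k \<in> {0, 1, - 256}" if "j < T"
proof -
  have "token_coord (xs ! j) k = 0 \<or> pos_coord (Suc j) k = 0"
    using letter(3) by (cases "j = 0") (auto simp: token_coord_def pos_coord_def)
  moreover have "token_coord (xs ! j) k \<in> {0, 1, - 256}" by (auto simp: token_coord_def)
  moreover have "pos_coord (Suc j) k \<in> {0, 1, - 256}"
    by (auto simp: pos_coord_def query_bit_def key_bit_def)
  ultimately show ?thesis by (auto simp: coord_def)
qed

lemma coord_fp: "j < T \<Longrightarrow> coord j k \<in> fp 8"
  using coord_values[of j k] by auto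

abbreviation "H \<equiv> embed r model xs"

lemma H_carrier: "H \<in> carrier_mat T dim"
  using len by (auto simp: embed_def model_def)

lemma H_entry:
  assumes "j < T" "k < dim"
  shows "H $$ (j, k) = coord j k"
  using assms len rounding_fp[OF rounding coord_fp[OF assms(1), of k]]
  by (simp add: embed_def model_def mat_of_rows_index fp_vec_add_def coord_def)

lemma H_one: "fp_mat_mult r H (1\<^sub>m dim) = H"
  by (rule fp_mat_mult_one[OF rounding H_carrier]) (simp add: H_entry coord_fp)

lemma query_entry:
  assumes "b < dim"
  shows "fp_mat_mult r H (WQ attention) $$ (T - 1, b) =
    (if 2 * m + 2 + 2 * l \<le> b \<and> b < 2 * m + 2 + 4 * l then query_bit i (b - (2 * m + 2 + 2 * l)) else 0)"
proof -
  let ?y = "if 2 * m + 2 + 2 * l \<le> b \<and> b < 2 * m + 2 + 4 * l then query_bit i (b - (2 * m + 2 + 2 * l)) else 0"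
  have T: "T - 1 < T" using i n by simp
  have "fp_dot r (row H (T - 1)) (col (WQ attention) b) = ?y"
  proof (rule fp_dot_exact[OF rounding, where d = dim])
    have eq: "row H (T - 1) $ a * col (WQ attention) b $ a =
        (if a = b - 2 * l then if 2 * m + 2 + 2 * l \<le> b \<and> b < 2 * m + 2 + 4 * l
          then coord (T - 1) (b - 2 * l) else 0 else 0)" if "a < dim" for a
      using that assms T H_carrier H_entry[OF T that]
      by (auto simp: attention_def query_coord_def)
    then show "row H (T - 1) $ a * col (WQ attention) b $ a \<in> fp 8" if "a < dim" for a
      using that coord_fp[OF T] by auto
    have "coord (T - 1) (b - 2 * l) = query_bit i (b - (2 * m + 2 + 2 * l))"
      if b: "2 * m + 2 + 2 * l \<le> b" "b < 2 * m + 2 + 4 * l"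
    proof -
      define t where "t = b - (2 * m + 2 + 2 * l)"
      have t: "t < 2 * l" "b - 2 * l = 2 * m + 2 + t" using b by (auto simp: t_def)
      have "query_pos (Suc (T - 1)) = i" using i n by (simp add: query_pos_def)
      then show ?thesis
        using pos_coord_query[OF t(1)] token_coord_high[of "2 * m + 2 + t"]
        unfolding t(2) by (simp add: coord_def t_def)
    qed
    moreover have "b - 2 * l < dim" using assms by simp
    ultimately show "(\<Sum>a<dim. row H (T - 1) $ a * col (WQ attention) b $ a) = ?y"
      using eq by simp
  qed (auto simp: attention_def query_bit_def)
  then show ?thesis using T H_carrier assms by (simp add: fp_mat_mult_def attention_def)
qed

section \<open>Attention scores and weights\<close>

abbreviation "S \<equiv> fp_mat_mult r (fp_mat_mult r H (WQ attention))
  (transpose_mat (fp_mat_mult r H (WK attention)))"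

lemma S_carrier: "S \<in> carrier_mat T T"
  using H_carrier by (auto simp: fp_mat_mult_def)

lemma S_sum:
  assumes "j < T"
  shows "S $$ (T - 1, j) = r (\<Sum>t<2 * l. query_bit i t * key_bit (key_pos (Suc j)) t)"
proof -
  have T: "T - 1 < T" using i n by simp
  let ?q = "2 * m + 2 + 2 * l"
  let ?F = "\<lambda>b. if ?q \<le> b \<and> b < ?q + 2 * l then query_bit i (b - ?q) * key_bit (key_pos (Suc j)) (b - ?q) else 0"
  have WQ: "dim_col (WQ attention) = dim" "dim_row (WQ attention) = dim" by (auto simp: attention_def)
  have prod: "row (fp_mat_mult r H (WQ attention)) (T - 1) $ b * col (transpose_mat H) j $ b = ?F b"
    if "b < dim" for b
  proof -
    have "row (fp_mat_mult r H (WQ attention)) (T - 1) $ b = fp_mat_mult r H (WQ attention) $$ (T - 1, b)"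
      using H_carrier T that WQ by (simp add: fp_mat_mult_def)
    moreover have "col (transpose_mat H) j $ b = coord j b"
      using H_carrier assms that H_entry[OF assms that] by simp
    moreover have "coord j b = key_bit (key_pos (Suc j)) (b - ?q)" if b: "?q \<le> b" "b < ?q + 2 * l"
    proof -
      have "b - ?q < 2 * l" "b = ?q + (b - ?q)" using b by auto
      then show ?thesis
        using pos_coord_key[of "b - ?q" "Suc j"] token_coord_high[of b] b by (simp add: coord_def)
    qed
    ultimately show ?thesis using query_entry[OF that] by auto
  qed
  have Ffp: "?F b \<in> fp 8" for b using query_key_le[of i "b - ?q" "key_pos (Suc j)"] by auto
  have "S $$ (T - 1, j) = fp_dot r (row (fp_mat_mult r H (WQ attention)) (T - 1)) (col (transpose_mat H) j)"
    using H_carrier T assms H_one by (simp add: fp_mat_mult_def attention_def)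
  also have "\<dots> = r (\<Sum>b<dim. r (?F b))"
    unfolding fp_dot_def using H_carrier prod by (auto intro!: arg_cong[of _ _ r] sum.cong)
  also have "(\<Sum>b<dim. r (?F b)) = (\<Sum>b<dim. ?F b)"
    by (rule sum.cong[OF refl]) (rule rounding_fp[OF rounding Ffp])
  also have "\<dots> = (\<Sum>b\<in>{?q..<?q + 2 * l}. query_bit i (b - ?q) * key_bit (key_pos (Suc j)) (b - ?q))"
    by (rule sum.mono_neutral_cong_right) (auto simp: dim_def)
  also have "\<dots> = (\<Sum>t<2 * l. query_bit i t * key_bit (key_pos (Suc j)) t)"
    by (rule sum.reindex_bij_witness[of _ "\<lambda>t. t + ?q" "\<lambda>b. b - ?q"]) auto
  finally show ?thesis .
qed

lemma S_match:
  assumes "j < T" "key_pos (Suc j) = i"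
  shows "S $$ (T - 1, j) = 0"
  using S_sum[OF assms(1)] rounding_fp[OF rounding, of 0] by (simp add: assms(2) query_key_match)

lemma S_mismatch:
  assumes "j < T" "key_pos (Suc j) \<noteq> i"
  shows "S $$ (T - 1, j) \<le> - 256"
proof -
  let ?P = "\<lambda>t. query_bit i t * key_bit (key_pos (Suc j)) t"
  have "i < 2 ^ l" "key_pos (Suc j) < 2 ^ l"
    using i n assms(1) by (auto simp: key_pos_def)
  then obtain t where t: "t < 2 * l" "?P t = - 256"
    using query_key_mismatch assms(2) by metis
  have "(\<Sum>t<2 * l. ?P t) = ?P t + (\<Sum>t\<in>{..<2 * l} - {t}. ?P t)"
    using t(1) by (intro sum.remove) auto
  moreover have "(\<Sum>t\<in>{..<2 * l} - {t}. ?P t) \<le> 0"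
  proof (rule sum_nonpos)
    fix t show "?P t \<le> 0" using query_key_le[of i t "key_pos (Suc j)"] by linarith
  qed
  ultimately have "(\<Sum>t<2 * l. ?P t) \<le> - 256" using t(2) by linarith
  \<comment> \<open>The exact score need not be a float, but a bound that is a float survives
    rounding by monotonicity.\<close>
  then have "S $$ (T - 1, j) \<le> r (- 256)"
    unfolding S_sum[OF assms(1)] by (rule rounding_mono[OF rounding])
  then show ?thesis using rounding_fp[OF rounding, of "- 256"] by simp
qed

lemma matches: "j < T \<Longrightarrow> key_pos (Suc j) = i \<longleftrightarrow> j \<in> matches" "matches \<subseteq> {..<T}"
  "card matches = (if i = 1 then 1 else 2)"
  using i n by (auto simp: matches_def key_pos_def split: if_splits)

lemma attention_weights:
  assumes "j < T"
  shows "fp_softmax r (row (map_mat (\<lambda>s. r (beta attention * s)) S) (T - 1)) $ j =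
    (if j \<in> matches then weight else 0)"
proof -
  have T: "T - 1 < T" using i n by simp
  have row: "row (map_mat (\<lambda>s. r (beta attention * s)) S) (T - 1) $ j = S $$ (T - 1, j)" if "j < T" for j
  proof -
    have "S $$ (T - 1, j) \<in> fp 8" unfolding S_sum[OF that] by (rule rounding_in[OF rounding])
    then show ?thesis using S_carrier T that rounding_fp[OF rounding]
      by (simp add: attention_def[THEN arg_cong[of _ _ beta]])
  qed
  have "fp_softmax r (row (map_mat (\<lambda>s. r (beta attention * s)) S) (T - 1)) $ j =
    (if j \<in> matches then 1 / real (card matches) else 0)"
  proof (rule fp_softmax_hard[OF rounding])
    show "row (map_mat (\<lambda>s. r (beta attention * s)) S) (T - 1) $ j = 0" if "j \<in> matches" for j
      using that matches(2) row[of j] S_match[of j] matches(1)[of j] by auto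
    show "row (map_mat (\<lambda>s. r (beta attention * s)) S) (T - 1) $ j \<le> - 256"
      if "j < T" "j \<notin> matches" for j
      using that row[of j] S_mismatch[of j] matches(1)[of j] by simp
  qed (use S_carrier matches assms in auto)
  then show ?thesis using matches(3) by (simp add: weight_def)
qed

definition active :: "nat \<Rightarrow> bool" where
  "active k \<longleftrightarrow> k = f \<or> k = m + s \<or> k = 2 * m + flag"

lemma coord_nonneg: "k < 2 * m + 2 \<Longrightarrow> 0 \<le> coord j k"
  by (simp add: coord_def token_coord_def pos_coord_def)

text \<open>Position \<open>i\<close> supplies the letter and the flag, the last position the state.
  Positions beyond \<open>n\<close> carry no flag, so it is counted once. At step 1, position 1
  supplies all three.\<close>

lemma matched_sum:
  assumes "k < 2 * m + 2"
  shows "(\<Sum>j\<in>matches. coord j k) = (if active k then 1 else 0)"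
proof (cases "i = 1")
  case True
  have f0: "xs ! 0 = f" using True letter(1) by simp
  have flag: "flag = (if n = 1 then 1 else 0)" unfolding flag_def by (auto simp: True)
  have "matches = {0}" unfolding matches_def by (simp add: True)
  then have "(\<Sum>j\<in>matches. coord j k) = coord 0 k" by simp
  also have "\<dots> = (if active k then 1 else 0)"
  proof -
    consider "k < 2 * m" | "k = 2 * m" | "k = 2 * m + 1" using assms by linarith
    then show ?thesis
      unfolding coord_def token_coord_def pos_coord_def active_def flag f0
      unfolding state(1)[OF True]
      by cases (use letter(2) e(1) n(1) in auto)
  qed
  finally show ?thesis .
next
  case False
  then have i2: "2 \<le> i" using i by simp
  have letter_coord: "coord (i - 1) k = (if k = f \<or> k = 2 * m + flag then 1 else 0)"
  proof -
    have "Suc (i - 1) = i" using i by simp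
    then show ?thesis using assms letter(1,2) i i2
      by (auto simp: coord_def token_coord_def pos_coord_def flag_def)
  qed
  have state_coord: "coord (T - 1) k = (if k = m + s then 1 else 0)"
  proof -
    have "xs ! (T - 1) = m + s" using state(2)[OF i2] by (simp add: numeral_2_eq_2)
    moreover have "Suc (T - 1) = T" "n < T" "T \<noteq> 1" using i2 n by auto
    ultimately show ?thesis using assms s
      unfolding coord_def token_coord_def pos_coord_def by auto
  qed
  have "i - 1 \<noteq> T - 1" using i2 i n by auto
  then have "(\<Sum>j\<in>matches. coord j k) = coord (i - 1) k + coord (T - 1) k"
    using False by (simp add: matches_def)
  then show ?thesis using letter(2) s unfolding letter_coord state_coord active_def by auto
qed

text \<open>The range of \<open>k\<close> is that of the coordinates on which
  \<open>hidden_coord\<close> can be nonzero.\<close>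

lemma hopfield_entry:
  assumes "k < 2 * m + 2"
  shows "hopfield r attention H H $$ (T - 1, k) = (if active k then weight else 0)"
proof -
  have T: "T - 1 < T" using i n by simp
  have k: "k < dim" using assms by (simp add: dim_def)
  define P where "P = map_rows (dim_row H) (fp_softmax r) (map_mat (\<lambda>s. r (beta attention * s)) S)"
  have Pdim: "dim_row P = T" "dim_col P = T"
    using H_carrier S_carrier by (auto simp: P_def map_rows_def)
  have P: "P $$ (T - 1, j) = (if j \<in> matches then weight else 0)" if "j < T" for j
    using H_carrier S_carrier T that attention_weights[OF that]
    by (simp add: P_def map_rows_def mat_of_rows_index)
  have "hopfield r attention H H = fp_mat_mult r P H"
    using H_one by (simp add: hopfield_def P_def attention_def)
  moreover have "fp_dot r (row P (T - 1)) (col H k) = (if active k then weight else 0)"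
  proof (rule fp_dot_exact[OF rounding, where d = T])
    have eq: "row P (T - 1) $ j * col H k $ j = (if j \<in> matches then weight * coord j k else 0)"
      if "j < T" for j
      using that Pdim T P[OF that] H_carrier H_entry[OF that k] k by simp
    show "row P (T - 1) $ j * col H k $ j \<in> fp 8" if "j < T" for j
    proof -
      have "coord j k = 0 \<or> coord j k = 1"
        using coord_values[OF that, of k] coord_nonneg[OF assms, of j] by auto
      then show ?thesis unfolding eq[OF that] by (auto simp: weight_def)
    qed
    have "(\<Sum>j<T. row P (T - 1) $ j * col H k $ j) = (\<Sum>j\<in>matches. weight * coord j k)"
      using eq matches(2) by (simp add: sum.If_cases Int_absorb1)
    also have "\<dots> = weight * (if active k then 1 else 0)"
      using matched_sum[OF assms] by (simp only: sum_distrib_left[symmetric])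
    finally show "(\<Sum>j<T. row P (T - 1) $ j * col H k $ j) = (if active k then weight else 0)" by simp
  qed (use H_carrier in \<open>auto simp: weight_def\<close>)
  ultimately show ?thesis using Pdim H_carrier T k by (simp add: fp_mat_mult_def)
qed

section \<open>Feed-forward network and output\<close>

abbreviation "out \<equiv> row (hopfield r attention H H) (T - 1)"

lemma hopfield_dim: "dim_row (hopfield r attention H H) = T" "dim_col (hopfield r attention H H) = dim"
  using H_carrier S_carrier
  by (auto simp: hopfield_def fp_mat_mult_def map_rows_def attention_def)

lemma out_entry: "k < 2 * m + 2 \<Longrightarrow> out $ k = (if active k then weight else 0)"
  using hopfield_entry hopfield_dim i n by (simp add: dim_def)

definition unit :: nat where
  "unit = f * (2 * m) + s * 2 + flag"

lemma flag_less: "flag < 2"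
  by (simp add: flag_def)

lemma unit: "unit < 2 * m * m" "unit div (2 * m) = f" "unit mod (2 * m) div 2 = s" "unit mod 2 = flag"
proof -
  have low: "s * 2 + flag < 2 * m" using s flag_less by simp
  have "f * (2 * m) + (s * 2 + flag) < (f + 1) * (2 * m)" using low by simp
  also have "\<dots> \<le> m * (2 * m)" using letter(2) by (intro mult_le_mono1) simp
  finally show "unit < 2 * m * m" by (simp add: unit_def mult_ac)
  have u: "unit = (s * 2 + flag) + f * (2 * m)" by (simp add: unit_def)
  show "unit div (2 * m) = f" using low m_pos unfolding u by simp
  have "unit mod (2 * m) = s * 2 + flag" using low unfolding u by simp
  then show "unit mod (2 * m) div 2 = s" using flag_less by simp
  have "unit = flag + 2 * (f * m + s)" by (simp add: unit_def)
  then show "unit mod 2 = flag" using flag_less by (metis mod_less mod_mult_self2)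
qed

lemma unit_unique:
  assumes "u div (2 * m) = f" "u mod (2 * m) div 2 = s" "u mod 2 = flag"
  shows "u = unit"
proof -
  have "u mod (2 * m) mod 2 = flag" using assms(3) by (simp add: mod_mod_cancel)
  then have "u mod (2 * m) = s * 2 + flag" using assms(2) div_mult_mod_eq[of "u mod (2 * m)" 2] by simp
  then show ?thesis using assms(1) div_mult_mod_eq[of u "2 * m"] by (simp add: unit_def)
qed

lemma unit_less_dim: "unit < dim"
  using unit(1) by (simp add: dim_def)

lemma hidden_entry:
  assumes "u < dim"
  shows "max 0 (fp_mat_vec r (W1 attention) out $ u) = (if u = unit then weight else 0)"
    and "fp_mat_vec r (W1 attention) out $ u \<in> fp 8"
proof -
  let ?y = "weight * (hidden_coord u f + hidden_coord u (m + s) + hidden_coord u (2 * m + flag))"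
  have hidden_sum: "hidden_coord u f + hidden_coord u (m + s) + hidden_coord u (2 * m + flag) =
      (if u < 2 * m * m then (if u div (2 * m) = f then 1 else 0) +
        (if u mod (2 * m) div 2 = s then 1 else 0) + (if u mod 2 = flag then - 1 else - 2) else 0)"
    using letter(2) s flag_less by (auto simp: hidden_coord_def)
  have y: "?y \<in> fp 8" unfolding hidden_sum by (auto simp: weight_def)
  have dot: "fp_dot r (row (W1 attention) u) out = ?y"
  proof (rule fp_dot_exact[OF rounding _ _ _ y])
    show "dim_vec out = dim" by (simp add: hopfield_dim)
    have eq: "row (W1 attention) u $ k * out $ k =
        (if k = f then weight * hidden_coord u f else 0) +
        (if k = m + s then weight * hidden_coord u (m + s) else 0) +
        (if k = 2 * m + flag then weight * hidden_coord u (2 * m + flag) else 0)" if "k < dim" for k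
    proof (cases "k < 2 * m + 2")
      case True
      have "row (W1 attention) u $ k = hidden_coord u k"
        using assms that by (simp add: attention_def)
      then show ?thesis using letter(2) s unfolding out_entry[OF True] active_def by auto
    next
      case False
      then have "hidden_coord u k = 0" by (simp add: hidden_coord_def)
      then have "row (W1 attention) u $ k = 0" using assms that by (simp add: attention_def)
      then show ?thesis using False letter(2) s flag_less by auto
    qed
    show "row (W1 attention) u $ k * out $ k \<in> fp 8" if "k < dim" for k
    proof (cases "k < 2 * m + 2")
      case True
      have "row (W1 attention) u $ k = hidden_coord u k"
        using assms that by (simp add: attention_def)
      then show ?thesis unfolding out_entry[OF True] by (auto simp: hidden_coord_def weight_def)
    next
      case False
      then have "hidden_coord u k = 0" by (simp add: hidden_coord_def)
      then have "row (W1 attention) u $ k = 0" using assms that by (simp add: attention_def)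
      then show ?thesis by simp
    qed
    have "f < dim" "m + s < dim" "2 * m + flag < dim" using letter(2) s flag_less by (auto simp: dim_def)
    then show "(\<Sum>k<dim. row (W1 attention) u $ k * out $ k) = ?y"
      using eq by (simp add: sum.distrib distrib_left)
  qed
  then have val: "fp_mat_vec r (W1 attention) out $ u = ?y"
    using assms by (simp add: fp_mat_vec_def attention_def)
  then show "fp_mat_vec r (W1 attention) out $ u \<in> fp 8" using y by simp
  show "max 0 (fp_mat_vec r (W1 attention) out $ u) = (if u = unit then weight else 0)"
  proof (cases "u = unit")
    case True
    then show ?thesis unfolding val hidden_sum using unit by (simp add: weight_def)
  next
    case False
    then have "\<not> (u div (2 * m) = f \<and> u mod (2 * m) div 2 = s \<and> u mod 2 = flag)"
      using unit_unique by blast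
    then have "(if u < 2 * m * m then (if u div (2 * m) = f then 1 else 0) +
        (if u mod (2 * m) div 2 = s then 1 else 0) + (if u mod 2 = flag then - 1 else - 2) else 0)
        \<le> (0::real)" by (simp split: if_split)
    moreover have "0 \<le> weight" by (simp add: weight_def)
    ultimately have "?y \<le> 0" unfolding hidden_sum by (rule mult_nonneg_nonpos[rotated])
    then show ?thesis unfolding val using False by simp
  qed
qed

lemma ffn_entry:
  assumes "u < dim"
  shows "ffn r attention out $ u = (if u = unit then weight else 0)"
proof -
  define h where "h = map_vec (max 0) (fp_vec_add r (fp_mat_vec r (W1 attention) out) (b1 attention))"
  have hd: "dim_vec h = dim" by (simp add: h_def fp_vec_add_def attention_def)
  have h: "h $ v = (if v = unit then weight else 0)" if "v < dim" for v
  proof -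
    have "dim_vec (fp_mat_vec r (W1 attention) out) = dim"
      by (simp add: fp_mat_vec_def attention_def)
    then have "h $ v = max 0 (r (fp_mat_vec r (W1 attention) out $ v))"
      unfolding h_def fp_vec_add_def b1_attention using that by simp
    then show ?thesis
      unfolding rounding_fp[OF rounding hidden_entry(2)[OF that]] hidden_entry(1)[OF that] .
  qed
  have fp: "h $ v \<in> fp 8" if "v < dim" for v using h[OF that] by (simp add: weight_def)
  have "fp_mat_vec r (W2 attention) h = h"
    unfolding W2_attention
  proof (rule fp_mat_vec_one[OF rounding])
    show "h \<in> carrier_vec dim" by (rule carrier_vecI[OF hd])
  qed (rule fp)
  then have ffn: "ffn r attention out = fp_vec_add r h (0\<^sub>v dim)"
    unfolding ffn_def Let_def h_def[symmetric] b2_attention by simp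
  have "fp_vec_add r h (0\<^sub>v dim) $ u = r (h $ u)"
    using assms hd by (simp add: fp_vec_add_def)
  also have "\<dots> = h $ u" by (rule rounding_fp[OF rounding fp[OF assms]])
  also have "\<dots> = (if u = unit then weight else 0)" by (rule h[OF assms])
  finally show ?thesis unfolding ffn .
qed

lemma target_less: "target unit < 2 * m + 2"
proof -
  have "g s \<otimes> g f \<in> carrier G" using g letter(2) s by (auto simp: bij_betw_def)
  from idx(1)[OF this] show ?thesis unfolding target_def Let_def unit(2,3) by simp
qed

text \<open>All logits but that of the target are at most -256, so their exponentials underflow and
  the distribution is exactly a point mass.\<close>

lemma next_token_entry:
  assumes "t < 2 * m + 2"
  shows "next_token_dist r model xs $ t = (if t = target unit then 1 else 0)"
proof -
  have T: "T - 1 < T" "length xs - 1 = T - 1" using i n len by auto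
  define h where "h = row (decoder r attention H) (T - 1)"
  have h: "h $ u = (if u = unit then weight else 0)" "dim_vec h = dim" if "u < dim" for u
    using that T hopfield_dim H_carrier ffn_entry[OF that]
    by (simp_all add: h_def decoder_def map_rows_def mat_of_rows_index)
  have hd: "dim_vec h = dim" using H_carrier by (simp add: h_def decoder_def map_rows_def)
  have logit: "fp_mat_vec r (output_mat model) h $ t = (if t = target unit then 0 else - 512 * weight)"
    if "t < 2 * m + 2" for t
  proof -
    have "fp_dot r (row (output_mat model) t) h = (if t = target unit then 0 else - 512 * weight)"
    proof (rule fp_dot_exact[OF rounding hd])
      have eq: "row (output_mat model) t $ u * h $ u =
          (if u = unit then if t = target unit then 0 else - 512 * weight else 0)" if "u < dim" for u
      proof -
        have "row (output_mat model) t $ u = output_coord t u"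
          using that \<open>t < 2 * m + 2\<close> by (simp add: model_def)
        then show ?thesis using h(1)[OF that] unit(1) by (simp add: output_coord_def)
      qed
      then show "row (output_mat model) t $ u * h $ u \<in> fp 8" if "u < dim" for u
        using that by (auto simp: weight_def)
      show "(\<Sum>u<dim. row (output_mat model) t $ u * h $ u) =
          (if t = target unit then 0 else - 512 * weight)"
        using eq unit_less_dim by simp
    qed (auto simp: weight_def)
    then show ?thesis using that by (simp add: fp_mat_vec_def model_def)
  qed
  have "next_token_dist r model xs = fp_softmax r (fp_mat_vec r (output_mat model) h)"
    unfolding next_token_dist_def h_def T(2) by (simp add: mhn_def model_def[THEN arg_cong[of _ _ layers]])
  moreover have "fp_softmax r (fp_mat_vec r (output_mat model) h) $ t =
      (if t \<in> {target unit} then 1 / real 1 else 0)"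
    by (rule fp_softmax_hard[OF rounding, where l = "2 * m + 2"])
       (use assms target_less logit in \<open>auto simp: weight_def fp_mat_vec_def model_def[THEN arg_cong[of _ _ output_mat]]\<close>)
  ultimately show ?thesis by simp
qed

lemma mhm_target: "mhm r model xs = target unit"
proof -
  have V: "vocab model = 2 * m + 2" by (simp add: model_def)
  show ?thesis
    using mhm_eq_iff[of model r xs "target unit"] next_token_entry target_less unfolding V by auto
qed

end

section \<open>Iterating the step\<close>

lemma mhm_step:
  assumes "1 \<le> i" "i \<le> n" "length xs = n + i - 1" "xs ! (i - 1) = f" "f < m" "xs ! 0 < m"
    and "i = 1 \<Longrightarrow> s = e" "2 \<le> i \<Longrightarrow> xs ! (n + i - 2) = m + s" "s < m"
  shows "mhm r model xs =
    (if i < n then m + idx (g s \<otimes> g f) else if g s \<otimes> g f = \<one> then 2 * m else 2 * m + 1)"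
proof -
  have "unit i f s mod 2 = flag i" "unit i f s div (2 * m) = f" "unit i f s mod (2 * m) div 2 = s"
    using unit[OF assms] by auto
  moreover have "mhm r model xs = target (unit i f s)" by (rule mhm_target[OF assms])
  moreover have "flag i = (if i = n then 1 else 0)" by (rule flag_def[OF assms])
  ultimately show ?thesis using assms(2)
    by (simp add: target_def even_iff_mod_2_eq_zero Let_def)
qed

lemma foldl_mult_closed: "set fs \<subseteq> carrier G \<Longrightarrow> a \<in> carrier G \<Longrightarrow> foldl (\<otimes>) a fs \<in> carrier G"
  by (induction fs arbitrary: a) auto

text \<open>The model accumulates products from the left, whereas \<open>word_problem\<close> folds
  from the right.\<close>

lemma foldl_mult_eq_foldr:
  "set fs \<subseteq> carrier G \<Longrightarrow> a \<in> carrier G \<Longrightarrow> foldl (\<otimes>) a fs = a \<otimes> foldr (\<otimes>) fs \<one>"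
proof (induction fs arbitrary: a)
  case (Cons b fs)
  have "foldr (\<otimes>) fs \<one> \<in> carrier G" using Cons.prems(1) by (induction fs) auto
  then show ?case using Cons by (simp add: m_assoc)
qed simp

abbreviation "state fs j \<equiv> foldl (\<otimes>) \<one> (take j fs)"

lemma mhm_prefix_tokens:
  assumes fs: "length fs = n" "set fs \<subseteq> carrier G" and i: "1 \<le> i" "i \<le> n"
  shows "mhm r model (prefix_tokens fs i) =
    (if i < n then m + idx (state fs i) else if state fs n = \<one> then 2 * m else 2 * m + 1)"
proof -
  let ?s = "idx (state fs (i - 1))"
  have closed: "state fs j \<in> carrier G" for j
    using fs(2) set_take_subset[of j fs] by (intro foldl_mult_closed) auto
  have letters: "fs ! j \<in> carrier G" if "j < n" for j using that fs by (auto intro: nth_mem)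
  have e_eq: "idx \<one> = e"
    using e g the_inv_into_f_f[of g "{..<m}" e] by (auto simp: idx_def bij_betw_def)
  have "g ?s \<otimes> g (idx (fs ! (i - 1))) = state fs i"
  proof -
    have "take i fs = take (i - 1) fs @ [fs ! (i - 1)]"
      using take_Suc_conv_app_nth[of "i - 1" fs] i fs(1) by simp
    then show ?thesis using idx(2) closed letters[of "i - 1"] i by simp
  qed
  moreover have "mhm r model (prefix_tokens fs i) =
    (if i < n then m + idx (g ?s \<otimes> g (idx (fs ! (i - 1))))
     else if g ?s \<otimes> g (idx (fs ! (i - 1))) = \<one> then 2 * m else 2 * m + 1)"
  proof (rule mhm_step[OF i])
    show "length (prefix_tokens fs i) = n + i - 1" using fs(1) i by (simp add: prefix_tokens_def)
    show "prefix_tokens fs i ! (i - 1) = idx (fs ! (i - 1))"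
    proof -
      have "i - 1 < length fs" using i fs(1) by simp
      then show ?thesis by (simp add: prefix_tokens_def nth_append)
    qed
    show "idx (fs ! (i - 1)) < m" using idx(1)[OF letters[of "i - 1"]] i by simp
    show "prefix_tokens fs i ! 0 < m"
      using idx(1)[OF letters[of 0]] n(1) fs(1) by (simp add: prefix_tokens_def nth_append)
    show "?s = e" if "i = 1" using that e_eq by simp
    show "prefix_tokens fs i ! (n + i - 2) = m + ?s" if "2 \<le> i"
    proof -
      \<comment> \<open>The last token has index \<open>i - 2\<close> among the generated ones, and
        \<open>[1..<i] ! (i - 2) = i - 1\<close>, so it encodes the product of the first
        \<open>i - 1\<close> letters.\<close>
      have "n + i - 2 = length (map idx fs) + (i - 2)" using that fs(1) by simp
      then have "prefix_tokens fs i ! (n + i - 2) = map (\<lambda>j. m + idx (state fs j)) [1..<i] ! (i - 2)"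
        unfolding prefix_tokens_def by (simp only: nth_append_length_plus)
      moreover have "i - 2 < i - 1" "1 + (i - 2) = i - 1" using that by auto
      ultimately show ?thesis by simp
    qed
    show "?s < m" using idx(1)[OF closed] .
  qed
  ultimately show ?thesis using i by auto
qed

text \<open>Induction on the number \<open>k\<close> of steps after step \<open>i\<close>, for
  arbitrary \<open>i\<close>, because the counter of \<open>mhm_cot\<close> falls while the prefix
  grows.\<close>

lemma mhm_cot_prefix_tokens:
  assumes fs: "length fs = n" "set fs \<subseteq> carrier G" and i: "1 \<le> i" "i + k = n"
  shows "mhm_cot r model (Suc k) (prefix_tokens fs i) = (if state fs n = \<one> then 2 * m else 2 * m + 1)"
  using i
proof (induction k arbitrary: i)
  case 0
  then show ?case using mhm_prefix_tokens[OF fs, of i] by simp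
next
  case (Suc k)
  have "prefix_tokens fs i @ [mhm r model (prefix_tokens fs i)] = prefix_tokens fs (Suc i)"
    using mhm_prefix_tokens[OF fs, of i] Suc.prems by (simp add: prefix_tokens_def)
  then show ?case using Suc.IH[of "Suc i"] Suc.prems by simp
qed

lemma mhm_cot_word_problem:
  assumes fs: "length fs = n" "set fs \<subseteq> carrier G"
  shows "mhm_cot r model n (map idx fs) = (if fs \<in> word_problem G then 2 * m else 2 * m + 1)"
proof -
  have "foldr (\<otimes>) fs \<one> \<in> carrier G" using fs(2) by (induction fs) auto
  then have "state fs n = \<one> \<longleftrightarrow> fs \<in> word_problem G"
    using fs foldl_mult_eq_foldr[of fs \<one>] by (simp add: word_problem_def)
  moreover have "mhm_cot r model (Suc (n - 1)) (prefix_tokens fs 1) =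
      (if state fs n = \<one> then 2 * m else 2 * m + 1)"
    using n(1) by (intro mhm_cot_prefix_tokens[OF fs]) auto
  ultimately show ?thesis using n(1) by (simp add: prefix_tokens_def)
qed

lemma inj_idx: "inj_on idx (carrier G)"
  using idx(2) by (rule inj_on_inverseI)

end

text \<open>Any finite group will do, as its multiplication table fits into a constant number of
  hidden units. Only the binary positions let the embedding size grow with \<open>n\<close>.\<close>

lemma ex_cot_family:
  fixes G (structure) and rnd :: "nat \<Rightarrow> real \<Rightarrow> real"
  assumes rounding: "rounding 8 (rnd 8)" and "group G" and fin: "finite (carrier G)"
  shows "\<exists>V L d M. (\<lambda>n. real (d n)) \<in> O(\<lambda>n. ln (real n)) \<and> mhm_family V L (\<lambda>n. 8) d M \<and>
    solves_word_problem G V rnd (\<lambda>n. 8) M (\<lambda>n. n)"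
proof -
  interpret group G by fact
  define m where "m = card (carrier G)"
  obtain g where g: "bij_betw g {..<m} (carrier G)"
    using ex_bij_betw_nat_finite[OF fin] by (auto simp: m_def atLeast0LessThan)
  then obtain e where e: "e < m" "g e = \<one>"
    using one_closed unfolding bij_betw_def by (metis imageE lessThan_iff)
  have "\<exists>l. 2 ^ l \<le> 2 * n \<and> n < 2 ^ l" if n: "1 \<le> n" for n :: nat
  proof -
    obtain q where "2 ^ q \<le> n" "n < 2 ^ (q + 1)" using ex_power_ivl1[of 2 n] n by auto
    then show ?thesis by (intro exI[of _ "q + 1"]) auto
  qed
  then obtain l where l: "\<And>n :: nat. 1 \<le> n \<Longrightarrow> 2 ^ l n \<le> 2 * n \<and> n < 2 ^ l n" by metis
  define d where "d n = word_model.dim m (l n)" for n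
  define M where "M n = word_model.model G m e n (l n) g" for n
  have word: "word_model G m e n (l n) g (rnd 8)" if "1 \<le> n" for n
    by unfold_locales (use g e l[OF that] that rounding in auto)
  have dim: "d n = 2 * m * m + 2 * m + 2 + 4 * l n" if "1 \<le> n" for n
    unfolding d_def by (rule word_model.dim_def[OF word[OF that]])
  have "(\<lambda>n. real (d n)) \<in> O(\<lambda>n. ln (real n))"
  proof (rule landau_o.bigI)
    define A where "A = real (2 * m * m + 2 * m + 2)"
    let ?c = "A + 4 * (1 / ln 2 + 1)"
    have A: "0 \<le> A" unfolding A_def by (rule of_nat_0_le_iff)
    have "0 < 4 * (1 / ln 2 + 1 :: real)" by (simp add: add_pos_pos)
    with A show "0 < ?c" by (rule add_nonneg_pos)
    show "eventually (\<lambda>n. norm (real (d n)) \<le> ?c * norm (ln (real n))) sequentially"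
      \<comment> \<open>From 3 on, \<open>ln n \<ge> 1\<close>, so the constant part of the
        embedding size is absorbed.\<close>
      using eventually_ge_at_top[of 3]
    proof eventually_elim
      case (elim n)
      have "exp 1 \<le> real n" using exp_le elim by linarith
      then have ln1: "1 \<le> ln (real n)" using elim by (simp add: ln_ge_iff)
      have "real (2 ^ l n) \<le> real (2 * n)" using l[of n] elim by (simp only: of_nat_le_iff)
      then have "ln (2 ^ l n) \<le> ln (2 * real n)" using elim by simp
      then have "real (l n) * ln 2 \<le> ln 2 + ln (real n)"
        using elim by (simp add: ln_realpow ln_mult)
      then have "real (l n) \<le> 1 + ln (real n) * (1 / ln 2)" by (simp add: field_simps)
      then have "real (l n) \<le> (1 / ln 2 + 1) * ln (real n)" using ln1 by (simp add: algebra_simps)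
      moreover have "A * 1 \<le> A * ln (real n)" using ln1 A by (intro mult_left_mono)
      moreover have "real (d n) = A + 4 * real (l n)" using dim[of n] elim by (simp add: A_def)
      moreover have "?c * ln (real n) = A * ln (real n) + 4 * ((1 / ln 2 + 1) * ln (real n))"
        by (simp add: algebra_simps)
      ultimately have "real (d n) \<le> ?c * ln (real n)" by linarith
      then show ?case using ln1 by simp
    qed
  qed
  moreover have "mhm_family (2 * m + 2) 1 (\<lambda>n. 8) d M"
    unfolding mhm_family_def
  proof (intro allI impI)
    fix n :: nat assume n: "1 \<le> n"
    have "wf_mhm 8 (M n)" unfolding M_def by (rule word_model.wf_model[OF word[OF n]])
    then show "wf_mhm 8 (M n) \<and> vocab (M n) = 2 * m + 2 \<and> embed_dim (M n) = d n \<and> length (layers (M n)) \<le> 1"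
      by (simp add: d_def M_def word_model.model_def[OF word[OF n]])
  qed
  moreover have "solves_word_problem G (2 * m + 2) rnd (\<lambda>n. 8) M (\<lambda>n. n)"
  proof -
    define enc where "enc = the_inv_into {..<m} g"
    have enc: "enc = word_model.idx m g" using word_model.idx_def[OF word[of 1]] by (auto simp: enc_def)
    have "inj_on enc (carrier G)" unfolding enc by (rule word_model.inj_idx[OF word[of 1]]) simp
    moreover have "enc ` carrier G \<subseteq> {..<2 * m + 2}"
      using word_model.idx(1)[OF word[of 1]] unfolding enc by fastforce
    moreover have "cot_defined (M n) n n" if "1 \<le> n" for n
      using that by (simp add: cot_defined_def M_def word_model.model_def[OF word[OF that]])
    moreover have "mhm_cot (rnd 8) (M n) n (map enc fs) =
        (if fs \<in> word_problem G then 2 * m else 2 * m + 1)"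
      if "1 \<le> n" "length fs = n" "set fs \<subseteq> carrier G" for n fs
      unfolding enc M_def by (rule word_model.mhm_cot_word_problem[OF word[OF that(1)] that(2,3)])
    ultimately show ?thesis
      unfolding solves_word_problem_def
      by (intro exI[of _ enc] exI[of _ "2 * m"] exI[of _ "2 * m + 1"]) auto
  qed
  ultimately show ?thesis by blast
qed

lemma finite_sym_group: "finite (carrier (sym_group n))"
proof -
  have "carrier (sym_group n) = {p. p permutes {1..n}}" by (auto simp: sym_group_carrier)
  then show ?thesis by (simp add: finite_permutations)
qed

theorem theorem7p4:
  fixes rnd :: "nat \<Rightarrow> real \<Rightarrow> real"
  assumes rounding: "\<And>p. rounding p (rnd p)"
    and TC0_NC1: "TC0 \<subset> NC1"
  shows "(\<exists>V L p0 d M.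
            (\<lambda>n. real (d n)) \<in> O(\<lambda>n. ln (real n)) \<and>
            mhm_family V L (\<lambda>n. p0) d M \<and>
            solves_word_problem (sym_group 5) V rnd (\<lambda>n. p0) M (\<lambda>n. n)) \<and>
         \<not> (\<exists>V L p d M k.
            (\<lambda>n. real (p n)) \<in> O(\<lambda>n. ln (real n)) \<and>
            (\<lambda>n. real (d n)) \<in> O(\<lambda>n. real n ^ k) \<and>
            mhm_family V L p d M \<and>
            solves_word_problem (sym_group 5) V rnd p M (\<lambda>n. 1))"
proof
  have "\<exists>V L d M. (\<lambda>n. real (d n)) \<in> O(\<lambda>n. ln (real n)) \<and> mhm_family V L (\<lambda>n. 8) d M \<and>
      solves_word_problem (sym_group 5) V rnd (\<lambda>n. 8) M (\<lambda>n. n)"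
    by (rule ex_cot_family[of rnd "sym_group 5"]) (rule rounding sym_group_is_group finite_sym_group)+
  then show "\<exists>V L p0 d M. (\<lambda>n. real (d n)) \<in> O(\<lambda>n. ln (real n)) \<and> mhm_family V L (\<lambda>n. p0) d M \<and>
      solves_word_problem (sym_group 5) V rnd (\<lambda>n. p0) M (\<lambda>n. n)"
    by blast
  show "\<not> (\<exists>V L p d M k. (\<lambda>n. real (p n)) \<in> O(\<lambda>n. ln (real n)) \<and>
      (\<lambda>n. real (d n)) \<in> O(\<lambda>n. real n ^ k) \<and> mhm_family V L p d M \<and>
      solves_word_problem (sym_group 5) V rnd p M (\<lambda>n. 1))"
  proof
    assume "\<exists>V L p d M k. (\<lambda>n. real (p n)) \<in> O(\<lambda>n. ln (real n)) \<and>
      (\<lambda>n. real (d n)) \<in> O(\<lambda>n. real n ^ k) \<and> mhm_family V L p d M \<and>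
      solves_word_problem (sym_group 5) V rnd p M (\<lambda>n. 1)"
    then obtain V L p d M k where "(\<lambda>n. real (p n)) \<in> O(\<lambda>n. ln (real n))"
      "(\<lambda>n. real (d n)) \<in> O(\<lambda>n. real n ^ k)" "mhm_family V L p d M"
      "solves_word_problem (sym_group 5) V rnd p M (\<lambda>n. 1)" by blast
    from NC1_subset_TC0[OF rounding _ this] have "NC1 \<subseteq> TC0" by simp
    with TC0_NC1 show False by blast
  qed
qed

end
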